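(* For $c_1,c_2,c_3$ and $n\in\mathbb{N}$ let $M(1,c_1,c_2,c_3;n)$ be the number of $(x_1,\dots,x_8)\in\mathbb{Z}^8$ with $n=(x_1^2+x_1x_2+x_2^2)+c_1(x_3^2+x_3x_4+x_4^2)+c_2(x_5^2+x_5x_6+x_6^2)+c_3(x_7^2+x_7x_8+x_8^2)$. Let $(c_1,c_2,c_3)$ be one of the 19 triples $(1,1,2),(1,1,4),(1,1,8),(1,2,2),(1,2,4),(1,2,8),(1,4,4),(1,4,8),(1,8,8),(2,2,2),(2,2,4),(2,2,8),(2,4,4),(2,4,8),(2,8,8),(4,4,4),(4,4,8),(4,8,8),(8,8,8)$. Then for every $n\in\mathbb{N}$, $$M(1,c_1,c_2,c_3;n)=\sum_{i=1}^{16}\nu_iA_i(n),$$ where $A_i(n)$ are the Fourier coefficients of the functions $f_i$ in the context and $(\nu_1,\dots,\nu_{16})$ is the vector assigned to $(1,c_1,c_2,c_3)$ in the table in the context.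
   Context: $q=e^{2\pi iz}$, $\eta(z)=q^{1/24}\prod_{n\ge1}(1-q^n)$, $E_4(z)=1+240\sum_{n\ge1}\sigma_3(n)q^n$. Put $f_{4,6}(z)=\eta^2(z)\eta^2(2z)\eta^2(3z)\eta^2(6z)$, $f_{4,8}(z)=\eta^4(2z)\eta^4(4z)$, $f_{4,12}(z)=\eta^{-1}(z)\eta^{2}(2z)\eta^{3}(3z)\eta^{3}(4z)\eta^{2}(6z)\eta^{-1}(12z)-\eta^{3}(z)\eta^{2}(2z)\eta^{-1}(3z)\eta^{-1}(4z)\eta^{2}(6z)\eta^{3}(12z)$, $f_{4,24}(z)=\eta^{-4}(z)\eta^{11}(2z)\eta^{-4}(3z)\eta^{-3}(4z)\eta^{11}(6z)\eta^{-3}(12z)=\sum a_{4,24}(n)q^n$. Set $f_1,\dots,f_8=E_4(tz)$ for $t=1,2,3,4,6,8,12,24$ respectively, $f_9=f_{4,6}(z)$, $f_{10}=f_{4,6}(2z)$, $f_{11}=f_{4,6}(4z)$, $f_{12}=f_{4,8}(z)$, $f_{13}=f_{4,8}(3z)$, $f_{14}=f_{4,12}(z)$, $f_{15}=f_{4,12}(2z)$, $f_{16}=\sum_{n\ \mathrm{odd}}a_{4,24}(n)q^n$; $f_i(z)=\sum_{n\ge0}A_i(n)q^n$. Table of $(\nu_1,\dots,\nu_{16})$: (1,1,1,2): 3/40, -1/5, -27/40, 0, 9/5, 0, 0, 0, 0, 0, 0, 0, 0, 0, 0, 0. (1,1,1,4): 3/100, -9/100, 27/100, 4/25, -81/100,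 0, 36/25, 0, 54/5, 432/5, 0, 0, 0, 0, 0, 0. (1,1,1,8): 3/160, -9/160, -27/160, 9/80, 81/160, -1/5, -81/80, 9/5, 0, 0, 0, -27/4, 243/4, 0, 81, 81/4. (1,1,2,2): 1/50, 2/25, 9/50, 0, 18/25, 0, 0, 0, 36/5, 0, 0, 0, 0, 0, 0, 0. (1,1,2,4): 1/80, 1/16, -9/80, -1/5, -9/16, 0, 9/5, 0, 0, 0, 0, 0, 0, 9, 0, 0. (1,1,2,8): 1/200, 1/40, 9/200, -9/100, 9/40, 4/25, -81/100, 36/25, 9/5, 144/5, 1152/5, 9, 81, 0, 0, 0. (1,1,4,4): 1/200, 3/200, 9/200, 2/25, 27/200, 0, 18/25, 0, 54/5, 216/5, 0, 0, 0, 0, 0, 0. (1,1,4,8): 1/320, 3/320, -9/320, 1/16, -27/320, -1/5, -9/16, 9/5, 0, 0, 0, 9/4, -81/4, 9/4, 27, 27/4. (1,1,8,8): 1/800, 3/800, 9/800, 3/200, 27/800, 2/25, 27/200, 18/25, 36/5, 234/5, 576/5, 9/2, 81/2, 0, 0, 0. (1,2,2,2): 1/40, -3/20, -9/40, 0, 27/20, 0, 0, 0, 0, 0, 0, 0, 0, 0, 0, 0. (1,2,2,4): 1/100, -7/100, 9/100, 4/25, -63/100, 0, 36/25, 0, 18/5, 72/5, 0, 0, 0, 0, 0, 0. (1,2,2,8): 1/160, -7/160, -9/160, 9/80, 63/160, -1/5, -81/80, 9/5, 0, 0, 0, -9/4, 81/4, 0, 9, 27/4. (1,2,4,4): 1/160,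 -1/32, -9/160, -1/10, 9/32, 0, 9/10, 0, 0, 0, 0, 0, 0, 9/2, 0, 0. (1,2,4,8): 1/400, -1/80, 9/400, -1/20, -9/80, 4/25, -9/20, 36/25, 9/10, 27/5, 72/5, 9/2, 81/2, 0, 0, 0. (1,2,8,8): 1/640, -1/128, -9/640, -3/160, 9/128, -1/10, 27/160, 9/10, 0, 0, 0, -9/8, 81/8, 27/8, 9/2, 27/8. (1,4,4,4): 1/400, -9/400, 9/400, 3/25, -81/400, 0, 27/25, 0, 27/5, 54/5, 0, 0, 0, 0, 0, 0. (1,4,4,8): 1/640, -9/640, -9/640, 7/80, 81/640, -1/5, -63/80, 9/5, 0, 0, 0, 9/8, -81/8, 9/8, 0, 27/8. (1,4,8,8): 1/1600, -9/1600, 9/1600, 1/40, -81/1600, 2/25, 9/40, 18/25, 18/5, 36/5, 36/5, 9/4, 81/4, 0, 0, 0. (1,8,8,8): 1/2560, -9/2560, -9/2560, 9/320, 81/2560, -3/20, -81/320, 27/20, 0, 0, 0, 27/32, -243/32, 81/32, 0, 81/32. *)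

theory Defs
  imports "HOL-Computational_Algebra.Formal_Power_Series"
begin

definition Qf :: "int \<Rightarrow> int \<Rightarrow> int" where
  "Qf a b = a^2 + a*b + b^2"

definition M :: "nat \<Rightarrow> nat \<Rightarrow> nat \<Rightarrow> nat \<Rightarrow> nat" where
  "M c1 c2 c3 n = card {(x1,x2,x3,x4,x5,x6,x7,x8).
      int n = Qf x1 x2 + int c1 * Qf x3 x4 + int c2 * Qf x5 x6 + int c3 * Qf x7 x8}"

definition sigma3 :: "nat \<Rightarrow> nat" where
  "sigma3 n = (\<Sum>d\<in>{d. d dvd n}. d ^ 3)"

definition E4c :: "nat \<Rightarrow> rat" where
  "E4c n = (if n = 0 then 1 else 240 * of_nat (sigma3 n))"

(* coefficients of g(tz) given those of g(z) *)
definition dil :: "nat \<Rightarrow> (nat \<Rightarrow> rat) \<Rightarrow> nat \<Rightarrow> rat" where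
  "dil t a n = (if t dvd n then a (n div t) else 0)"

(* the power series prod_{n>=1} (1 - q^{tn})^k, truncated at n <= N
   (the truncation does not affect coefficients of q^m for m <= N when t >= 1) *)
definition eta_factor :: "nat \<Rightarrow> int \<Rightarrow> nat \<Rightarrow> rat fps" where
  "eta_factor t k N =
     (let P = (\<Prod>n\<in>{1..N}. 1 - fps_X ^ (t*n))
      in if k \<ge> 0 then P ^ nat k else inverse P ^ nat (-k))"

definition etaprod_coeff :: "(nat \<times> int) list \<Rightarrow> nat \<Rightarrow> rat" where
  "etaprod_coeff L m = fps_nth (\<Prod>(t,k)\<leftarrow>L. eta_factor t k m) m"

(* q-coefficients of the eta quotient prod_{(t,k) in L} eta(tz)^k, i.e.
   q^s prod (1-q^{tn})^k with s = (sum t*k)/24 (an integer in all uses below) *)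
definition eta_quot :: "(nat \<times> int) list \<Rightarrow> nat \<Rightarrow> rat" where
  "eta_quot L n =
     (let s = (\<Sum>(t,k)\<leftarrow>L. int t * k) div 24
      in if int n < s then 0 else etaprod_coeff L (nat (int n - s)))"

definition f46 :: "nat \<Rightarrow> rat" where
  "f46 = eta_quot [(1,2),(2,2),(3,2),(6,2)]"

definition f48 :: "nat \<Rightarrow> rat" where
  "f48 = eta_quot [(2,4),(4,4)]"

definition f412 :: "nat \<Rightarrow> rat" where
  "f412 n = eta_quot [(1,-1),(2,2),(3,3),(4,3),(6,2),(12,-1)] n
          - eta_quot [(1,3),(2,2),(3,-1),(4,-1),(6,2),(12,3)] n"

definition a424 :: "nat \<Rightarrow> rat" where
  "a424 = eta_quot [(1,-4),(2,11),(3,-4),(4,-3),(6,11),(12,-3)]"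

definition A :: "nat \<Rightarrow> nat \<Rightarrow> rat" where
  "A i n =
    (if i = 1 then dil 1 E4c n
     else if i = 2 then dil 2 E4c n
     else if i = 3 then dil 3 E4c n
     else if i = 4 then dil 4 E4c n
     else if i = 5 then dil 6 E4c n
     else if i = 6 then dil 8 E4c n
     else if i = 7 then dil 12 E4c n
     else if i = 8 then dil 24 E4c n
     else if i = 9 then f46 n
     else if i = 10 then dil 2 f46 n
     else if i = 11 then dil 4 f46 n
     else if i = 12 then f48 n
     else if i = 13 then dil 3 f48 n
     else if i = 14 then f412 n
     else if i = 15 then dil 2 f412 n
     else if i = 16 then (if odd n then a424 n else 0)
     else 0)"

definition nu_table :: "((nat \<times> nat \<times> nat) \<times> rat list) list" where
  "nu_table = [
   ((1,1,2), [3/40, -1/5, -27/40, 0, 9/5, 0, 0, 0, 0, 0, 0, 0, 0, 0, 0, 0]),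
   ((1,1,4), [3/100, -9/100, 27/100, 4/25, -81/100, 0, 36/25, 0, 54/5, 432/5, 0, 0, 0, 0, 0, 0]),
   ((1,1,8), [3/160, -9/160, -27/160, 9/80, 81/160, -1/5, -81/80, 9/5, 0, 0, 0, -27/4, 243/4, 0, 81, 81/4]),
   ((1,2,2), [1/50, 2/25, 9/50, 0, 18/25, 0, 0, 0, 36/5, 0, 0, 0, 0, 0, 0, 0]),
   ((1,2,4), [1/80, 1/16, -9/80, -1/5, -9/16, 0, 9/5, 0, 0, 0, 0, 0, 0, 9, 0, 0]),
   ((1,2,8), [1/200, 1/40, 9/200, -9/100, 9/40, 4/25, -81/100, 36/25, 9/5, 144/5, 1152/5, 9, 81, 0, 0, 0]),
   ((1,4,4), [1/200, 3/200, 9/200, 2/25, 27/200, 0, 18/25, 0, 54/5, 216/5, 0, 0, 0, 0, 0, 0]),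
   ((1,4,8), [1/320, 3/320, -9/320, 1/16, -27/320, -1/5, -9/16, 9/5, 0, 0, 0, 9/4, -81/4, 9/4, 27, 27/4]),
   ((1,8,8), [1/800, 3/800, 9/800, 3/200, 27/800, 2/25, 27/200, 18/25, 36/5, 234/5, 576/5, 9/2, 81/2, 0, 0, 0]),
   ((2,2,2), [1/40, -3/20, -9/40, 0, 27/20, 0, 0, 0, 0, 0, 0, 0, 0, 0, 0, 0]),
   ((2,2,4), [1/100, -7/100, 9/100, 4/25, -63/100, 0, 36/25, 0, 18/5, 72/5, 0, 0, 0, 0, 0, 0]),
   ((2,2,8), [1/160, -7/160, -9/160, 9/80, 63/160, -1/5, -81/80, 9/5, 0, 0, 0, -9/4, 81/4, 0, 9, 27/4]),
   ((2,4,4), [1/160, -1/32, -9/160, -1/10, 9/32, 0, 9/10, 0, 0, 0, 0, 0, 0, 9/2, 0, 0]),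
   ((2,4,8), [1/400, -1/80, 9/400, -1/20, -9/80, 4/25, -9/20, 36/25, 9/10, 27/5, 72/5, 9/2, 81/2, 0, 0, 0]),
   ((2,8,8), [1/640, -1/128, -9/640, -3/160, 9/128, -1/10, 27/160, 9/10, 0, 0, 0, -9/8, 81/8, 27/8, 9/2, 27/8]),
   ((4,4,4), [1/400, -9/400, 9/400, 3/25, -81/400, 0, 27/25, 0, 27/5, 54/5, 0, 0, 0, 0, 0, 0]),
   ((4,4,8), [1/640, -9/640, -9/640, 7/80, 81/640, -1/5, -63/80, 9/5, 0, 0, 0, 9/8, -81/8, 9/8, 0, 27/8]),
   ((4,8,8), [1/1600, -9/1600, 9/1600, 1/40, -81/1600, 2/25, 9/40, 18/25, 18/5, 36/5, 36/5, 9/4, 81/4, 0, 0, 0]),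
   ((8,8,8), [1/2560, -9/2560, -9/2560, 9/320, 81/2560, -3/20, -81/320, 27/20, 0, 0, 0, 27/32, -243/32, 81/32, 0, 81/32])]"

end

(* Write q for fps_X, phi(q) for the theta series of x^2, phim(q) = phi(-q), and a(q), called hexa
   below, for the theta series of x^2 + xy + y^2. Lattice bijections give the quadratic relations
   between phi and phim under q -> q^2, a relation of degree 3 between their values at q and q^3, and
   a(q) in terms of them. The logarithmic derivative of phim/phi is found by self-similarity: its
   quotient by the expected answer is invariant under q -> q^2, hence constant. Together with Gauss'
   product for the triangular theta series this gives the Lambert series of the fourth power of that
   series; Liouville's identity turns its square into a sum over cubes of divisors, so that each
   E_4(q^t) with t | 24 becomes a form of degree 8 in phi and phim at q or at q^3. Differentiating the
   degree 3 relation determines phi(q)^2/phi(q^3)^2, after which every series is k^4 times a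
   polynomial in p and om, where om^2 = (1 + 2p)(1 - p^2) is a model of X_0(24). What remains are 19
   polynomial identities. *)

theory Submission
  imports Defs
begin

unbundle fps_syntax

text \<open>Comparing finitely many coefficients would require a dimension bound for modular forms
  of weight 4 on Gamma_0(24). Everything here is instead an exact identity between formal power
  series, where q -> q^2 supplies the rigidity: a series that it fixes is constant, and a series
  with constant term 1 that is the square of its own image is 1. There are no zero divisors, so
  common factors cancel and an equation between squares leaves only a sign, which one low
  coefficient decides. The parameters turn out to satisfy 1 + 2p = phi(q)^2 / phi(q^3)^2 and k =
  phi(q^3)^3 / phi(q). They enter through a conic in u = phi(q) phi(q^3), v = phim(q) phim(q^3) and
  b = a(q^2), which yields products such as phi(q)^2 phim(q^3)^2 but not phi(q)^4 alone; this is why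
  derivatives are needed. At level 12 p suffices; om = v(q^2) / k enters where the level is
  divisible by 8.\<close>

section \<open>The substitution q -> q^t\<close>

definition dilate :: "nat \<Rightarrow> 'a::field fps \<Rightarrow> 'a fps" where
  "dilate t f = fps_compose f (fps_X ^ t)"

lemma dilate_nth:
  assumes "t > 0"
  shows "dilate t f $ n = (if t dvd n then f $ (n div t) else 0)"
proof -
  have "dilate t f $ n = (\<Sum>i=0..n. f $ i * (if n = t * i then 1 else 0))"
    unfolding dilate_def fps_compose_nth power_mult[symmetric] by (simp add: fps_X_power_nth)
  also have "\<dots> = (\<Sum>i\<in>{0..n}. if n = t * i then f $ i else 0)"
    by (intro sum.cong) auto
  also have "\<dots> = (if t dvd n then f $ (n div t) else 0)"
  proof (cases "t dvd n")
    case True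
    then obtain m where m: "n = t * m" by auto
    have "(\<Sum>i\<in>{0..n}. if n = t * i then f $ i else 0) = (\<Sum>i\<in>{0..n}. if m = i then f $ i else 0)"
      using assms by (intro sum.cong) (auto simp: m)
    also have "\<dots> = f $ m" using assms by (subst sum.delta') (auto simp: m)
    finally show ?thesis using assms by (simp add: m)
  qed (auto intro!: sum.neutral)
  finally show ?thesis .
qed

lemma dilate_mult: "t > 0 \<Longrightarrow> dilate t (f * g) = dilate t f * dilate t g"
  by (simp add: dilate_def fps_compose_mult_distrib)

lemma dilate_power: "t > 0 \<Longrightarrow> dilate t (f ^ n) = dilate t f ^ n"
  by (induction n) (simp_all add: dilate_mult, simp add: dilate_def)

lemma dilate_prod: "t > 0 \<Longrightarrow> dilate t (prod f S) = (\<Prod>i\<in>S. dilate t (f i))"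
  by (simp add: dilate_def fps_compose_prod_distrib)

lemma dilate_add: "dilate t (f + g) = dilate t f + dilate t g"
  by (simp add: dilate_def fps_compose_add_distrib)

lemma dilate_diff: "dilate t (f - g) = dilate t f - dilate t g"
  by (simp add: dilate_def fps_compose_sub_distrib)

lemma dilate_uminus: "dilate t (- f) = - dilate t f"
  by (simp add: dilate_def fps_compose_uminus)

lemma dilate_const [simp]: "dilate t (fps_const c) = fps_const c"
  by (simp add: dilate_def)

lemma dilate_0 [simp]: "dilate t 0 = 0"
  by (simp add: dilate_def)

lemma dilate_1 [simp]: "dilate t 1 = 1"
  by (simp add: dilate_def)

lemma dilate_numeral [simp]: "dilate t (numeral k) = numeral k"
  by (simp add: numeral_fps_const)

lemma dilate_X: "t > 0 \<Longrightarrow> dilate t fps_X = fps_X ^ t"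
  by (simp add: dilate_def fps_X_fps_compose_startby0)

lemma dilate_nth_0 [simp]: "dilate t f $ 0 = f $ 0"
  by (simp add: dilate_def)

lemma dilate_dilate:
  assumes "s > 0" "t > 0"
  shows "dilate s (dilate t f) = dilate (s * t) f"
proof (rule fps_ext)
  fix n
  show "dilate s (dilate t f) $ n = dilate (s * t) f $ n"
  proof (cases "s dvd n")
    case True
    then obtain m where "n = s * m" by auto
    then show ?thesis using assms by (simp add: dilate_nth)
  next
    case False
    then have "\<not> s * t dvd n" by (meson dvd_mult_left)
    then show ?thesis using assms False by (simp add: dilate_nth)
  qed
qed

lemma dilate_one_left [simp]: "dilate 1 f = f" "dilate (Suc 0) f = f"
  by (simp_all add: dilate_def)

lemma dilate_inj: "t > 0 \<Longrightarrow> dilate t f = dilate t g \<longleftrightarrow> f = g"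
proof (intro iffI)
  assume t: "t > 0" and eq: "dilate t f = dilate t g"
  show "f = g"
  proof (rule fps_ext)
    fix n
    have "dilate t f $ (t * n) = dilate t g $ (t * n)" by (simp add: eq)
    thus "f $ n = g $ n" using t by (simp add: dilate_nth)
  qed
qed simp

text \<open>The coefficient of q^n is that of q^(n div 2) for even n and 0 for odd n, so descent on
  n leaves only the constant term.\<close>

lemma dilate_invariant_imp_const:
  assumes "dilate 2 f = f"
  shows "f = fps_const (f $ 0)"
proof (rule fps_ext)
  fix n
  show "f $ n = fps_const (f $ 0) $ n"
  proof (induction n rule: less_induct)
    case (less n)
    have "f $ n = dilate 2 f $ n" by (simp add: assms)
    also have "\<dots> = (if even n then f $ (n div 2) else 0)" by (simp add: dilate_nth)
    finally show ?case using less[of "n div 2"] by (cases "n = 0") auto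
  qed
qed

lemma fps_square_nth_first:
  fixes f :: "'a::comm_ring_1 fps"
  assumes "n > 0" "\<And>m. 0 < m \<Longrightarrow> m < n \<Longrightarrow> f $ m = 0"
  shows "(f ^ 2) $ n = 2 * f $ 0 * f $ n"
proof -
  have "(f ^ 2) $ n = (\<Sum>i=0..n. f $ i * f $ (n - i))"
    by (simp add: power2_eq_square fps_mult_nth)
  also have "\<dots> = (\<Sum>i\<in>{0, n}. f $ i * f $ (n - i))"
    using assms by (intro sum.mono_neutral_right) auto
  also have "\<dots> = 2 * f $ 0 * f $ n" using assms by (simp add: algebra_simps)
  finally show ?thesis .
qed

text \<open>Up to q^n the image under q -> q^2 involves, besides the constant term, only
  coefficients of smaller positive index. These vanish by induction, so its square has no term in
  q^n.\<close>

lemma eq_dilate_square_imp_1: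
  fixes f :: "'a::field_char_0 fps"
  assumes "f = dilate 2 f ^ 2" "f $ 0 = 1"
  shows "f = 1"
proof (rule fps_ext)
  fix n
  show "f $ n = 1 $ n"
  proof (induction n rule: less_induct)
    case (less n)
    show ?case
    proof (cases "n = 0")
      case False
      have z: "dilate 2 f $ m = 0" if "0 < m" "m \<le> n" for m 
        using less[of "m div 2"] that by (auto simp: dilate_nth)
      have "f $ n = (dilate 2 f ^ 2) $ n" using assms by simp
      also have "\<dots> = 0"
        using False z by (subst fps_square_nth_first) auto
      finally show ?thesis using False assms(2) by simp
    qed (use assms in simp)
  qed
qed

section \<open>Generating series of weighted sets\<close>

text \<open>The weight \<open>w\<close> carries signs such as (-1)^x, so that a theta series and its
  image under q -> -q fall under the same lemmas.\<close>

definition gser :: "'a set \<Rightarrow> ('a \<Rightarrow> nat) \<Rightarrow> ('a \<Rightarrow> rat) \<Rightarrow> rat fps" where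
  "gser S f w = Abs_fps (\<lambda>n. \<Sum>x\<in>{x\<in>S. f x = n}. w x)"

text \<open>A sum over an infinite fibre is 0 by convention; this condition keeps that default out
  of products and unions.\<close>

definition fin_fibres :: "'a set \<Rightarrow> ('a \<Rightarrow> nat) \<Rightarrow> bool" where
  "fin_fibres S f \<longleftrightarrow> (\<forall>n. finite {x\<in>S. f x = n})"

lemma gser_nth: "gser S f w $ n = (\<Sum>x\<in>{x\<in>S. f x = n}. w x)"
  by (simp add: gser_def)

lemma fin_fibres_subset:
  assumes "fin_fibres S f" "T \<subseteq> S"
  shows "fin_fibres T f"
  unfolding fin_fibres_def
proof
  fix n
  have "{x\<in>T. f x = n} \<subseteq> {x\<in>S. f x = n}" using assms by auto
  thus "finite {x\<in>T. f x = n}" using assms(1) finite_subset by (auto simp: fin_fibres_def)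
qed

lemma fin_fibres_Times:
  assumes "fin_fibres S f" "fin_fibres T g"
  shows "fin_fibres (S \<times> T) (\<lambda>(x,y). f x + g y)"
  unfolding fin_fibres_def
proof
  fix n
  have "{z \<in> S \<times> T. (case z of (x, y) \<Rightarrow> f x + g y) = n} \<subseteq>
        (\<Union>i\<in>{..n}. {x\<in>S. f x = i} \<times> {y\<in>T. g y = n - i})" by auto
  moreover have "finite \<dots>" using assms by (auto simp: fin_fibres_def)
  ultimately show "finite {z \<in> S \<times> T. (case z of (x, y) \<Rightarrow> f x + g y) = n}"
    using finite_subset by blast
qed

lemma fin_fibres_cmult:
  assumes "fin_fibres S f" "c > 0"
  shows "fin_fibres S (\<lambda>x. c * f x)"
  unfolding fin_fibres_def
proof
  fix n
  have "{x\<in>S. c * f x = n} \<subseteq> {x\<in>S. f x = n div c}" using assms by auto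
  thus "finite {x\<in>S. c * f x = n}" using assms(1) finite_subset by (auto simp: fin_fibres_def)
qed

lemma gser_mult:
  assumes "fin_fibres S f" "fin_fibres T g"
  shows "gser S f w * gser T g v = gser (S \<times> T) (\<lambda>(x,y). f x + g y) (\<lambda>(x,y). w x * v y)"
proof (rule fps_ext)
  fix n
  have "(gser S f w * gser T g v) $ n = 
     (\<Sum>i\<in>{0..n}. (\<Sum>x\<in>{x\<in>S. f x = i}. w x) * (\<Sum>y\<in>{y\<in>T. g y = n - i}. v y))"
    by (simp add: fps_mult_nth gser_nth)
  also have "\<dots> = (\<Sum>i\<in>{0..n}. \<Sum>(x,y)\<in>{x\<in>S. f x = i} \<times> {y\<in>T. g y = n - i}. w x * v y)"
    by (simp add: sum_product sum.cartesian_product)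
  also have "\<dots> = (\<Sum>(x,y)\<in>(\<Union>i\<in>{0..n}. {x\<in>S. f x = i} \<times> {y\<in>T. g y = n - i}). w x * v y)"
    using assms by (subst sum.UNION_disjoint) (auto simp: fin_fibres_def)
  also have "(\<Union>i\<in>{0..n}. {x\<in>S. f x = i} \<times> {y\<in>T. g y = n - i}) = 
     {z \<in> S \<times> T. (case z of (x, y) \<Rightarrow> f x + g y) = n}" by auto
  finally show "(gser S f w * gser T g v) $ n = 
     gser (S \<times> T) (\<lambda>(x,y). f x + g y) (\<lambda>(x,y). w x * v y) $ n" by (simp add: gser_nth)
qed

lemma gser_Un:
  assumes "fin_fibres (S \<union> T) f" "S \<inter> T = {}"
  shows "gser (S \<union> T) f w = gser S f w + gser T f w"
proof (rule fps_ext)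
  fix n
  have "{x \<in> S \<union> T. f x = n} = {x \<in> S. f x = n} \<union> {x \<in> T. f x = n}" by auto
  moreover have "finite {x \<in> S. f x = n}" "finite {x \<in> T. f x = n}"
    using assms(1) fin_fibres_subset[OF assms(1)] by (auto simp: fin_fibres_def)
  ultimately show "gser (S \<union> T) f w $ n = (gser S f w + gser T f w) $ n"
    using assms(2) by (simp add: gser_nth) (subst sum.union_disjoint, auto)
qed

text \<open>Lattice identities enter through this lemma: a bijection of index sets that preserves
  exponent and weight restricts to each fibre.\<close>

lemma gser_reindex:
  assumes "bij_betw h T S" "\<And>y. y \<in> T \<Longrightarrow> f (h y) = g y" "\<And>y. y \<in> T \<Longrightarrow> w (h y) = v y"
  shows "gser S f w = gser T g v"
proof (rule fps_ext)
  fix n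
  have "bij_betw h {y\<in>T. g y = n} {x\<in>S. f x = n}"
  proof (rule bij_betw_subset[OF assms(1)])
    show "h ` {y \<in> T. g y = n} = {x \<in> S. f x = n}"
      using assms(2) bij_betw_imp_surj_on[OF assms(1)] by (auto simp: image_iff) 
  qed auto
  hence "(\<Sum>x\<in>{x\<in>S. f x = n}. w x) = (\<Sum>y\<in>{y\<in>T. g y = n}. w (h y))"
    by (rule sum.reindex_bij_betw[symmetric])
  also have "\<dots> = (\<Sum>y\<in>{y\<in>T. g y = n}. v y)" using assms(3) by (intro sum.cong) auto
  finally show "gser S f w $ n = gser T g v $ n" by (simp add: gser_nth)
qed

lemma gser_cong:
  assumes "S = T" "\<And>y. y \<in> T \<Longrightarrow> f y = g y" "\<And>y. y \<in> T \<Longrightarrow> w y = v y"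
  shows "gser S f w = gser T g v"
  by (rule gser_reindex[of id]) (use assms in auto)

lemma gser_dilate:
  assumes "t > 0"
  shows "dilate t (gser S f w) = gser S (\<lambda>x. t * f x) w"
proof (rule fps_ext)
  fix n
  show "dilate t (gser S f w) $ n = gser S (\<lambda>x. t * f x) w $ n"
  proof (cases "t dvd n")
    case True
    then obtain m where m: "n = t * m" by auto
    then show ?thesis using assms by (simp add: dilate_nth gser_nth)
  next
    case False
    then show ?thesis using assms by (auto simp: dilate_nth gser_nth intro!: sum.neutral)
  qed
qed

lemma gser_X_power: "fps_X ^ c * gser S f w = gser S (\<lambda>x. c + f x) w"
proof (rule fps_ext)
  fix n
  show "(fps_X ^ c * gser S f w) $ n = gser S (\<lambda>x. c + f x) w $ n"
  proof (cases "n < c")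
    case True
    then show ?thesis by (auto simp: fps_X_power_mult_nth gser_nth intro!: sum.neutral)
  next
    case False
    then have "{x\<in>S. c + f x = n} = {x\<in>S. f x = n - c}" by auto
    then show ?thesis using False by (simp add: fps_X_power_mult_nth gser_nth)
  qed
qed

lemma gser_X: "fps_X * gser S f w = gser S (\<lambda>x. 1 + f x) w"
  using gser_X_power[of 1 S f w] by simp

lemma gser_add: "gser S f w + gser S f v = gser S f (\<lambda>x. w x + v x)"
  by (rule fps_ext) (simp add: gser_nth sum.distrib)

lemma gser_diff: "gser S f w - gser S f v = gser S f (\<lambda>x. w x - v x)"
  by (rule fps_ext) (simp add: gser_nth sum_subtractf)

lemma gser_cmult: "fps_const c * gser S f w = gser S f (\<lambda>x. c * w x)"
  by (rule fps_ext) (simp add: gser_nth sum_distrib_left)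

text \<open>Weights such as 1 + (-1)^(x+y) vanish off a parity class, so that adding two theta
  series selects a sublattice, and subtracting them its coset.\<close>

lemma gser_restrict:
  assumes "fin_fibres S f" "T \<subseteq> S" "\<And>x. x \<in> S - T \<Longrightarrow> w x = 0"
  shows "gser S f w = gser T f w"
proof (rule fps_ext)
  fix n
  show "gser S f w $ n = gser T f w $ n"
    unfolding gser_nth using assms by (intro sum.mono_neutral_right) (auto simp: fin_fibres_def)
qed

section \<open>Theta series\<close>

definition phi :: "rat fps" where
  "phi = gser (UNIV :: int set) (\<lambda>x. nat (x\<^sup>2)) (\<lambda>_. 1)"

text \<open>The character (-1)^x. Since x and x^2 have equal parity, weighting by it amounts to q ->
  -q; see \<open>alternate_phi\<close>.\<close>

definition sign_even :: "int \<Rightarrow> rat" where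
  "sign_even x = (if even x then 1 else -1)"

definition phim :: "rat fps" where
  "phim = gser (UNIV :: int set) (\<lambda>x. nat (x\<^sup>2)) sign_even"

definition tri :: "int \<Rightarrow> nat" where
  "tri x = nat (x * (x + 1) div 2)"

text \<open>The sum runs over all integers, so this is twice the usual \<open>\<psi>(q)\<close>.\<close>

definition psi2 :: "rat fps" where
  "psi2 = gser (UNIV :: int set) tri (\<lambda>_. 1)"

definition hexa :: "rat fps" where
  "hexa = gser (UNIV :: (int \<times> int) set) (\<lambda>(x,y). nat (Qf x y)) (\<lambda>_. 1)"

lemma int_tri: "2 * int (tri x) = x * (x + 1)"
proof -
  have "x * (x + 1) \<ge> 0"
  proof (cases "x \<ge> 0")
    case False
    then have "(- x) * (- (x + 1)) \<ge> 0" by (intro mult_nonneg_nonneg) auto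
    then show ?thesis by (simp add: algebra_simps)
  qed simp
  moreover have "even (x * (x + 1))" by simp
  ultimately show ?thesis by (simp add: tri_def)
qed

lemma Qf_nonneg: "Qf x y \<ge> 0"
proof -
  have "4 * Qf x y = (2 * x + y)\<^sup>2 + 3 * y\<^sup>2"
    by (simp add: Qf_def power2_eq_square algebra_simps)
  moreover have "(2 * x + y)\<^sup>2 \<ge> 0" "y\<^sup>2 \<ge> 0" by simp_all
  ultimately show ?thesis by linarith
qed

lemma abs_le_square_int: "\<bar>x\<bar> \<le> (x::int)\<^sup>2"
proof (cases "x = 0")
  case False
  then have "1 \<le> \<bar>x\<bar>" by simp
  from mult_left_mono[OF this abs_ge_zero[of x]] show ?thesis by (simp add: power2_eq_square)
qed simp

lemma fin_fibres_square: "fin_fibres (UNIV :: int set) (\<lambda>x. nat (x\<^sup>2))"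
  unfolding fin_fibres_def
proof
  fix n
  have "x \<in> {- int n..int n}" if "nat (x\<^sup>2) = n" for x
    using that abs_le_square_int[of x] by auto
  hence "{x \<in> UNIV. nat (x\<^sup>2) = n} \<subseteq> {- int n..int n}" by blast
  thus "finite {x::int \<in> UNIV. nat (x\<^sup>2) = n}" using finite_subset by blast
qed

lemma fin_fibres_tri: "fin_fibres (UNIV :: int set) tri"
  unfolding fin_fibres_def
proof
  fix n
  have "x \<in> {- 2 * int n - 1..2 * int n}" if "tri x = n" for x
  proof -
    have "2 * int n = x * (x + 1)" using int_tri[of x] that by simp
    moreover have "x \<le> x * (x + 1)" using zero_le_square[of x] by (simp add: algebra_simps)
    moreover have "- x - 1 \<le> x * (x + 1)"
      using zero_le_square[of "x + 1"] by (simp add: algebra_simps)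
    ultimately show ?thesis by auto
  qed
  hence "{x \<in> UNIV. tri x = n} \<subseteq> {- 2 * int n - 1..2 * int n}" by blast
  thus "finite {x \<in> UNIV. tri x = n}" using finite_subset by blast
qed

lemma fin_fibres_Qf: "fin_fibres (UNIV :: (int \<times> int) set) (\<lambda>(x,y). nat (Qf x y))"
  unfolding fin_fibres_def
proof
  fix n
  have "x \<in> {-2 * int n..2 * int n} \<and> y \<in> {-2 * int n..2 * int n}" if "nat (Qf x y) = n" for x y
  proof -
    have "2 * int n = x\<^sup>2 + y\<^sup>2 + (x + y)\<^sup>2"
      using that Qf_nonneg[of x y] by (auto simp: Qf_def power2_eq_square algebra_simps)
    moreover have "(x + y)\<^sup>2 \<ge> 0" "x\<^sup>2 \<ge> 0" "y\<^sup>2 \<ge> 0" by simp_all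
    ultimately have "\<bar>x\<bar> \<le> 2 * int n" "\<bar>y\<bar> \<le> 2 * int n"
      using abs_le_square_int[of x] abs_le_square_int[of y] by linarith+
    thus ?thesis by auto
  qed
  hence "{z \<in> UNIV. (case z of (x,y) \<Rightarrow> nat (Qf x y)) = n} \<subseteq> 
    {-2 * int n..2 * int n} \<times> {-2 * int n..2 * int n}" by auto
  thus "finite {z \<in> UNIV. (case z of (x,y) \<Rightarrow> nat (Qf x y)) = n}" using finite_subset by blast
qed

lemma dilate_phi: "t > 0 \<Longrightarrow> dilate t phi = gser UNIV (\<lambda>x. t * nat (x\<^sup>2)) (\<lambda>_. 1)"
  and dilate_phim: "t > 0 \<Longrightarrow> dilate t phim = gser UNIV (\<lambda>x. t * nat (x\<^sup>2)) sign_even"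
  and dilate_psi2: "t > 0 \<Longrightarrow> dilate t psi2 = gser UNIV (\<lambda>x. t * tri x) (\<lambda>_. 1)"
  by (simp_all add: phi_def phim_def psi2_def gser_dilate)

lemma gser_two_squares:
  assumes "s > 0" "t > 0"
  shows "gser UNIV (\<lambda>x. s * nat (x\<^sup>2)) w * gser UNIV (\<lambda>x. t * nat (x\<^sup>2)) v =
     gser UNIV (\<lambda>(x,y). s * nat (x\<^sup>2) + t * nat ((y::int)\<^sup>2)) (\<lambda>(x::int,y). w x * v y)"
  by (subst gser_mult) (auto intro!: fin_fibres_cmult fin_fibres_square assms)

lemma fin_fibres_two_squares:
  assumes "s > 0" "t > 0"
  shows "fin_fibres S (\<lambda>(x::int,y::int). s * nat (x\<^sup>2) + t * nat (y\<^sup>2))"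
  using fin_fibres_Times[OF fin_fibres_cmult[OF fin_fibres_square assms(1)] fin_fibres_cmult[OF fin_fibres_square assms(2)]]
  by (rule fin_fibres_subset) auto

lemma gser_two_tri:
  assumes "s > 0" "t > 0"
  shows "gser UNIV (\<lambda>x. s * tri x) w * gser UNIV (\<lambda>x. t * tri x) v =
     gser UNIV (\<lambda>(x,y). s * tri x + t * tri y) (\<lambda>(x,y). w x * v y)"
  by (subst gser_mult) (auto intro!: fin_fibres_cmult fin_fibres_tri assms)

lemma fin_fibres_two_tri:
  assumes "s > 0" "t > 0"
  shows "fin_fibres S (\<lambda>(x,y). s * tri x + t * tri y)"
  using fin_fibres_Times[OF fin_fibres_cmult[OF fin_fibres_tri assms(1)] fin_fibres_cmult[OF fin_fibres_tri assms(2)]]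
  by (rule fin_fibres_subset) auto

section \<open>Quadratic relations from a sublattice of index 2\<close>

text \<open>On Gaussian integers this is conjugation followed by multiplication by 1 + i, which
  doubles the norm x^2 + y^2.\<close>

lemma bij_sum_diff: "bij_betw (\<lambda>(u,v). (u + v, u - v)) UNIV {(x::int, y). even (x + y)}"
  by (rule bij_betw_byWitness[where f' = "\<lambda>(x,y). ((x + y) div 2, (x - y) div 2)"])
     (auto, presburger+)

lemma nat_eqI_int: "int m = int n \<Longrightarrow> m = n"
  by simp

lemma parallelogram_nat:
  "nat ((u + v)\<^sup>2) + nat ((u - v)\<^sup>2) = 2 * nat (u\<^sup>2) + 2 * nat ((v::int)\<^sup>2)"
  by (rule nat_eqI_int) (simp, simp add: power2_eq_square algebra_simps)

text \<open>The weight 1 + (-1)^(x+y) is 2 for x + y even and 0 otherwise, and x = u + v, y = u - v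
  turns x^2 + y^2 into 2u^2 + 2v^2. Together with the next lemma this says that q -> q^2 acts on
  (phi^2, phim^2) as one step of the arithmetic-geometric mean.\<close>

lemma phi_square_plus: "phi\<^sup>2 + phim\<^sup>2 = 2 * (dilate 2 phi)\<^sup>2"
proof -
  let ?f = "\<lambda>(x::int,y::int). 1 * nat (x\<^sup>2) + 1 * nat (y\<^sup>2)"
  let ?E = "{(x::int, y). even (x + y)}"
  have "phi\<^sup>2 + phim\<^sup>2 = dilate 1 phi * dilate 1 phi + dilate 1 phim * dilate 1 phim"
    by (simp add: power2_eq_square)
  also have "\<dots> = gser UNIV ?f (\<lambda>(x,y). 1 + sign_even x * sign_even y)"
    unfolding dilate_phi[OF zero_less_one] dilate_phim[OF zero_less_one]
    by (subst (1 2) gser_two_squares) (simp_all add: gser_add case_prod_unfold)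
  also have "\<dots> = gser ?E ?f (\<lambda>(x,y). 1 + sign_even x * sign_even y)"
    by (rule gser_restrict[OF fin_fibres_two_squares]) (auto simp: sign_even_def split: if_splits)
  also have "\<dots> = gser UNIV (\<lambda>(u,v). 2 * nat (u\<^sup>2) + 2 * nat (v\<^sup>2)) (\<lambda>_. 2)"
    by (rule gser_reindex[OF bij_sum_diff])
       (auto simp: sign_even_def parallelogram_nat)
  also have "\<dots> = fps_const 2 * (dilate 2 phi * dilate 2 phi)"
    by (simp add: dilate_phi gser_two_squares gser_cmult case_prod_unfold)
  finally show ?thesis by (simp add: power2_eq_square numeral_fps_const)
qed

text \<open>The product is added to its mirror image, so that the weight (-1)^x + (-1)^y again
  vanishes for x + y odd; on the rest both signs equal (-1)^(u+v).\<close>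

lemma phi_times_phim: "phi * phim = (dilate 2 phim)\<^sup>2"
proof -
  let ?f = "\<lambda>(x::int,y::int). 1 * nat (x\<^sup>2) + 1 * nat (y\<^sup>2)"
  let ?E = "{(x::int, y). even (x + y)}"
  have "fps_const 2 * (phi * phim) = dilate 1 phi * dilate 1 phim + dilate 1 phim * dilate 1 phi"
    by (simp add: power2_eq_square numeral_fps_const[symmetric])
  also have "\<dots> = gser UNIV ?f (\<lambda>(x,y). sign_even x + sign_even y)"
    unfolding dilate_phi[OF zero_less_one] dilate_phim[OF zero_less_one]
    by (subst (1 2) gser_two_squares) (simp_all add: gser_add case_prod_unfold add.commute)
  also have "\<dots> = gser ?E ?f (\<lambda>(x,y). sign_even x + sign_even y)"
    by (rule gser_restrict[OF fin_fibres_two_squares]) (auto simp: sign_even_def split: if_splits)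
  also have "\<dots> = gser UNIV (\<lambda>(u,v). 2 * nat (u\<^sup>2) + 2 * nat (v\<^sup>2)) (\<lambda>(u,v). 2 * (sign_even u * sign_even v))"
    by (rule gser_reindex[OF bij_sum_diff])
       (auto simp: sign_even_def parallelogram_nat)
  also have "\<dots> = fps_const 2 * (dilate 2 phim * dilate 2 phim)"
    by (simp add: dilate_phim gser_two_squares gser_cmult case_prod_unfold)
  finally show ?thesis by (simp add: power2_eq_square)
qed

lemma bij_double: "bij_betw (\<lambda>x. 2 * x) UNIV {x::int. even x}"
  by (rule bij_betw_byWitness[where f' = "\<lambda>x. x div 2"]) auto

lemma bij_odd: "bij_betw (\<lambda>x. 2 * x + 1) UNIV {x::int. odd x}"
  by (rule bij_betw_byWitness[where f' = "\<lambda>x. x div 2"]) auto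

lemma phi_plus: "phi + phim = 2 * dilate 4 phi"
proof -
  have "phi + phim = gser UNIV (\<lambda>x. nat (x\<^sup>2)) (\<lambda>x. 1 + sign_even x)"
    by (simp add: phi_def phim_def gser_add)
  also have "\<dots> = gser {x. even x} (\<lambda>x. nat (x\<^sup>2)) (\<lambda>x. 1 + sign_even x)"
    by (rule gser_restrict) (auto simp: sign_even_def intro!: fin_fibres_square)
  also have "\<dots> = gser UNIV (\<lambda>x. 4 * nat (x\<^sup>2)) (\<lambda>_. 2)"
    by (rule gser_reindex[OF bij_double]) (auto simp: sign_even_def power2_eq_square intro!: nat_eqI_int)
  also have "\<dots> = fps_const 2 * dilate 4 phi"
    by (simp add: dilate_phi gser_cmult)
  finally show ?thesis by (simp add: numeral_fps_const)
qed

lemma phi_minus: "phi - phim = 2 * fps_X * dilate 8 psi2"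
proof -
  have "phi - phim = gser UNIV (\<lambda>x. nat (x\<^sup>2)) (\<lambda>x. 1 - sign_even x)"
    by (simp add: phi_def phim_def gser_diff)
  also have "\<dots> = gser {x. odd x} (\<lambda>x. nat (x\<^sup>2)) (\<lambda>x. 1 - sign_even x)"
    by (rule gser_restrict) (auto simp: sign_even_def intro!: fin_fibres_square)
  also have "\<dots> = gser UNIV (\<lambda>x. 1 + 8 * tri x) (\<lambda>_. 2)"
  proof (rule gser_reindex[OF bij_odd])
    fix x :: int
    show "nat ((2 * x + 1)\<^sup>2) = 1 + 8 * tri x"
      using int_tri[of x] by (intro nat_eqI_int) (auto simp: power2_eq_square algebra_simps)
  qed (auto simp: sign_even_def)
  also have "\<dots> = fps_const 2 * (fps_X * dilate 8 psi2)"
    by (simp add: dilate_psi2 gser_cmult gser_X)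
  finally show ?thesis by (simp add: numeral_fps_const)
qed

text \<open>The same map at half-integers: with u = i + 1/2 and v = j + 1/2 the image is (u + v, u -
  v), and 2u^2 + 2v^2 = 1 + 4 tri i + 4 tri j.\<close>

lemma bij_odd_sum_diff: "bij_betw (\<lambda>(i,j). (i + j + 1, i - j)) UNIV {(x::int, y). odd (x + y)}"
  by (rule bij_betw_byWitness[where f' = "\<lambda>(x,y). ((x + y - 1) div 2, (x - y - 1) div 2)"])
     (auto elim!: oddE simp: algebra_simps)

lemma phi_square_minus: "phi\<^sup>2 - phim\<^sup>2 = 2 * fps_X * (dilate 4 psi2)\<^sup>2"
proof -
  let ?f = "\<lambda>(x::int,y::int). 1 * nat (x\<^sup>2) + 1 * nat (y\<^sup>2)"
  let ?E = "{(x::int, y). odd (x + y)}"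
  have "phi\<^sup>2 - phim\<^sup>2 = dilate 1 phi * dilate 1 phi - dilate 1 phim * dilate 1 phim"
    by (simp add: power2_eq_square)
  also have "\<dots> = gser UNIV ?f (\<lambda>(x,y). 1 - sign_even x * sign_even y)"
    unfolding dilate_phi[OF zero_less_one] dilate_phim[OF zero_less_one]
    by (subst (1 2) gser_two_squares) (simp_all add: gser_diff case_prod_unfold)
  also have "\<dots> = gser ?E ?f (\<lambda>(x,y). 1 - sign_even x * sign_even y)"
    by (rule gser_restrict[OF fin_fibres_two_squares]) (auto simp: sign_even_def split: if_splits)
  also have "\<dots> = gser UNIV (\<lambda>z. 1 + (case z of (i,j) \<Rightarrow> 4 * tri i + 4 * tri j)) (\<lambda>_. 2)"
  proof (rule gser_reindex[OF bij_odd_sum_diff])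
    fix z :: "int \<times> int"
    obtain i j where z: "z = (i,j)" by force
    have "int (nat ((i + j + 1)\<^sup>2) + nat ((i - j)\<^sup>2)) = (i + j + 1)\<^sup>2 + (i - j)\<^sup>2" by simp
    also have "\<dots> = int (1 + 4 * tri i + 4 * tri j)"
      using int_tri[of i] int_tri[of j] by (simp add: power2_eq_square algebra_simps)
    finally show "?f (case z of (i, j) \<Rightarrow> (i + j + 1, i - j)) = 1 + (case z of (i,j) \<Rightarrow> 4 * tri i + 4 * tri j)"
      unfolding of_nat_eq_iff by (simp add: z)
  qed (auto simp: sign_even_def)
  also have "\<dots> = fps_const 2 * (fps_X * (dilate 4 psi2 * dilate 4 psi2))"
    by (simp add: dilate_psi2 gser_two_tri gser_cmult gser_X case_prod_unfold)
  finally show ?thesis by (simp add: power2_eq_square numeral_fps_const)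
qed

text \<open>Factoring phi^2 - phim^2 as (phi - phim)(phi + phim) and cancelling q gives psi(q)^2 =
  phi(q) psi(q^2) at q^4. The factor 2 is due to \<open>psi2\<close> being 2 psi.\<close>

lemma psi2_square: "psi2\<^sup>2 = 2 * phi * dilate 2 psi2"
proof -
  have "2 * fps_X * (dilate 4 psi2)\<^sup>2 = (phi - phim) * (phi + phim)"
    unfolding phi_square_minus[symmetric] by (simp add: power2_eq_square algebra_simps)
  also have "\<dots> = 2 * fps_X * (2 * dilate 4 phi * dilate 8 psi2)"
    by (simp add: phi_minus phi_plus)
  finally have "(dilate 4 psi2)\<^sup>2 = 2 * dilate 4 phi * dilate 8 psi2"
    by (subst (asm) mult_left_cancel) auto
  hence "dilate 4 (psi2\<^sup>2) = dilate 4 (2 * phi * dilate 2 psi2)"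
    by (simp add: dilate_power dilate_mult dilate_dilate)
  thus ?thesis by (simp add: dilate_inj)
qed

section \<open>A relation of degree 3 from Eisenstein integers\<close>

text \<open>Theta series of x^2 + 3y^2, the norm form of Z[sqrt(-3)]; \<open>v_ser\<close> is its
  image under q -> -q.\<close>

definition u_ser :: "rat fps" where "u_ser = phi * dilate 3 phi"
definition v_ser :: "rat fps" where "v_ser = phim * dilate 3 phim"

text \<open>Multiplication by the sixth root of unity \<open>(1 + \<surd>-3)/2\<close> carries those \<open>(A + B\<surd>-3)/2\<close> with
  \<open>A\<close>, \<open>B\<close> odd and \<open>A + B\<close> divisible by 4 to the \<open>x + y\<surd>-3\<close> with \<open>x + y\<close> odd; replacing \<open>B\<close>
  by \<open>-B\<close> covers the remaining odd pairs. Here \<open>A = 2i + 1\<close> and \<open>B = 2j + 1\<close>.\<close>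

lemma bij_eisenstein_unit:
  "bij_betw (\<lambda>(i,j). ((i - 3 * j - 1) div 2, (i + j + 1) div 2)) {(i::int, j). odd (i + j)} {(x, y). odd (x + y)}"
  (is "bij_betw ?h ?O ?O")
proof (rule bij_betw_byWitness[where f' = "\<lambda>(x,y). ((x + 3 * y - 1) div 2, (y - x - 1) div 2)"], goal_cases)
  let ?g = "\<lambda>(x::int,y). ((x + 3 * y - 1) div 2, (y - x - 1) div 2)"
  have odd_pair: "\<exists>m j. z = (2 * m + 1 - j, j)" if "z \<in> ?O" for z
  proof -
    obtain i j where z: "z = (i, j)" by force
    with that have "odd (i + j)" by simp
    then obtain m where "i + j = 2 * m + 1" by (blast elim: oddE)
    hence "i = 2 * m + 1 - j" by simp
    thus ?thesis using z by auto
  qed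
  have h: "?h (2 * m + 1 - j, j) = (m - 2 * j, m + 1)" for m j
  proof -
    have "2 * m + 1 - j - 3 * j - 1 = 2 * (m - 2 * j)" "2 * m + 1 - j + j + 1 = 2 * (m + 1)" by simp_all
    thus ?thesis unfolding prod.case by (simp only: nonzero_mult_div_cancel_left)
  qed
  have g: "?g (2 * m + 1 - j, j) = (m + j, j - m - 1)" for m j
  proof -
    have "2 * m + 1 - j + 3 * j - 1 = 2 * (m + j)" "j - (2 * m + 1 - j) - 1 = 2 * (j - m - 1)" by simp_all
    thus ?thesis unfolding prod.case by (simp only: nonzero_mult_div_cancel_left)
  qed
  have *: "?g (m - 2 * j, m + 1) = (2 * m + 1 - j, j)" "?h (m + j, j - m - 1) = (2 * m + 1 - j, j)" for m j
    using g[of "m - j" "m + 1"] h[of "j - 1" "j - m - 1"] by (simp_all add: algebra_simps)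
  {
    case 1
    have "?g (?h z) = z" if "z \<in> ?O" for z using odd_pair[OF that] by (elim exE) (simp only: h *(1))
    thus ?case by (rule ballI)
  next
    case 2
    have "?h (?g z) = z" if "z \<in> ?O" for z using odd_pair[OF that] by (elim exE) (simp only: g *(2))
    thus ?case by (rule ballI)
  next
    case 3
    have "?h z \<in> ?O" if "z \<in> ?O" for z using odd_pair[OF that] by (elim exE) (simp only: h mem_Collect_eq prod.case, presburger)
    thus ?case by (rule image_subsetI)
  next
    case 4
    have "?g z \<in> ?O" if "z \<in> ?O" for z using odd_pair[OF that] by (elim exE) (simp only: g mem_Collect_eq prod.case, presburger)
    thus ?case by (rule image_subsetI)
  }
qed

text \<open>The weight 1 - (-1)^(x+y) leaves twice the points with x + y odd. The sixth root of
  unity matches these points with the pairs (i, j) of odd sum, which account for half of the series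
  over all pairs.\<close>

lemma uv_minus: "u_ser - v_ser = fps_X * dilate 2 psi2 * dilate 6 psi2"
proof -
  let ?f = "\<lambda>(x::int,y::int). 1 * nat (x\<^sup>2) + 3 * nat (y\<^sup>2)"
  let ?g = "\<lambda>(i,j). 2 * tri i + 6 * tri j"
  let ?O = "{(x::int, y). odd (x + y)}" and ?E = "{(x::int, y). even (x + y)}"
  have "u_ser - v_ser = dilate 1 phi * dilate 3 phi - dilate 1 phim * dilate 3 phim"
    by (simp add: u_ser_def v_ser_def)
  also have "\<dots> = gser UNIV ?f (\<lambda>(x,y). 1 - sign_even x * sign_even y)"
    unfolding dilate_phi[OF zero_less_one] dilate_phim[OF zero_less_one] dilate_phi[OF zero_less_numeral] dilate_phim[OF zero_less_numeral]
    by (subst (1 2) gser_two_squares) (simp_all add: gser_diff case_prod_unfold)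
  also have "\<dots> = gser ?O ?f (\<lambda>(x,y). 1 - sign_even x * sign_even y)"
    by (rule gser_restrict[OF fin_fibres_two_squares]) (auto simp: sign_even_def split: if_splits)
  also have "\<dots> = gser ?O ?f (\<lambda>_. 2)"
    by (rule gser_cong) (auto simp: sign_even_def)
  finally have 1: "u_ser - v_ser = gser ?O ?f (\<lambda>_. 2)" .
  have "gser ?O ?f (\<lambda>_. 1) = gser ?O (\<lambda>z. 1 + ?g z) (\<lambda>_. 1)"
  proof (rule gser_reindex[OF bij_eisenstein_unit])
    fix z :: "int \<times> int" assume "z \<in> ?O"
    moreover obtain i j where z: "z = (i, j)" by force
    ultimately have "odd (i + j)" by simp
    then obtain m where m: "i + j = 2 * m + 1" by (blast elim: oddE)
    have i: "i = 2 * m + 1 - j" using m by simp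
    have "i - 3 * j - 1 = 2 * (m - 2 * j)" "i + j + 1 = 2 * (m + 1)" using m by simp_all
    hence h: "(i - 3 * j - 1) div 2 = m - 2 * j" "(i + j + 1) div 2 = m + 1"
      by (simp_all only: nonzero_mult_div_cancel_left)
    have "int (?f (m - 2 * j, m + 1)) = (m - 2 * j)\<^sup>2 + 3 * (m + 1)\<^sup>2" by simp
    also have "\<dots> = int (1 + 2 * tri i + 6 * tri j)"
      using int_tri[of i] int_tri[of j] by (simp add: i power2_eq_square algebra_simps)
    finally show "?f (case z of (i, j) \<Rightarrow> ((i - 3 * j - 1) div 2, (i + j + 1) div 2)) = 1 + ?g z"
      unfolding of_nat_eq_iff by (simp add: z h)
  qed auto
  \<comment> \<open>The reflection j -> -j - 1 preserves \<open>tri j\<close> and changes the parity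
    of i + j.\<close>
  moreover have "gser ?E (\<lambda>z. 1 + ?g z) (\<lambda>_. 1) = gser ?O (\<lambda>z. 1 + ?g z) (\<lambda>_. 1)"
  proof (rule gser_reindex[where h = "\<lambda>(i,j). (i, - j - 1)"])
    show "bij_betw (\<lambda>(i,j). (i, - j - 1)) ?O ?E"
      by (rule bij_betw_byWitness[where f' = "\<lambda>(i,j). (i, - j - 1)"]) auto
    have "tri (- j - 1) = tri j" for j
      using int_tri[of j] int_tri[of "- j - 1"] by (intro nat_eqI_int) (simp add: algebra_simps)
    thus "1 + ?g (case z of (i, j) \<Rightarrow> (i, - j - 1)) = 1 + ?g z" for z
      by (auto simp: case_prod_unfold)
  qed auto
  moreover have "gser (?O \<union> ?E) (\<lambda>z. 1 + ?g z) (\<lambda>_. 1) = 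
     gser ?O (\<lambda>z. 1 + ?g z) (\<lambda>_. 1) + gser ?E (\<lambda>z. 1 + ?g z) (\<lambda>_. 1)"
  proof (rule gser_Un)
    have "fin_fibres (?O \<union> ?E) ?g" by (rule fin_fibres_two_tri) auto
    thus "fin_fibres (?O \<union> ?E) (\<lambda>z. 1 + ?g z)"
      unfolding fin_fibres_def
    proof (intro allI)
      fix n assume *: "\<forall>n. finite {x \<in> ?O \<union> ?E. ?g x = n}"
      have "{x \<in> ?O \<union> ?E. 1 + ?g x = n} \<subseteq> {x \<in> ?O \<union> ?E. ?g x = n - 1}" by auto
      thus "finite {x \<in> ?O \<union> ?E. 1 + ?g x = n}" using * finite_subset by blast
    qed
  qed auto
  moreover have "?O \<union> ?E = UNIV" by auto
  ultimately have "fps_const 2 * gser ?O ?f (\<lambda>_. 1) = gser UNIV (\<lambda>z. 1 + ?g z) (\<lambda>_. 1)"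
    by (simp add: numeral_fps_const[symmetric])
  moreover have "fps_X * dilate 2 psi2 * dilate 6 psi2 = gser UNIV (\<lambda>z. 1 + ?g z) (\<lambda>_. 1)"
    unfolding mult.assoc by (simp add: dilate_psi2 gser_two_tri gser_X case_prod_unfold)
  ultimately show ?thesis unfolding 1 by (simp add: gser_cmult)
qed

text \<open>The numbers x + y sqrt(-3) with x + y even are exactly the doubles of Eisenstein
  integers, whose norm form is \<open>Qf\<close>.\<close>

lemma uv_plus: "u_ser + v_ser = 2 * dilate 4 hexa"
proof -
  let ?f = "\<lambda>(x::int,y::int). 1 * nat (x\<^sup>2) + 3 * nat (y\<^sup>2)"
  let ?E = "{(x::int, y). even (x + y)}"
  have "u_ser + v_ser = dilate 1 phi * dilate 3 phi + dilate 1 phim * dilate 3 phim"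
    by (simp add: u_ser_def v_ser_def)
  also have "\<dots> = gser UNIV ?f (\<lambda>(x,y). 1 + sign_even x * sign_even y)"
    unfolding dilate_phi[OF zero_less_one] dilate_phim[OF zero_less_one] dilate_phi[OF zero_less_numeral] dilate_phim[OF zero_less_numeral]
    by (subst (1 2) gser_two_squares) (simp_all add: gser_add case_prod_unfold)
  also have "\<dots> = gser ?E ?f (\<lambda>(x,y). 1 + sign_even x * sign_even y)"
    by (rule gser_restrict[OF fin_fibres_two_squares]) (auto simp: sign_even_def split: if_splits)
  also have "\<dots> = gser UNIV (\<lambda>z. 4 * (case z of (x,y) \<Rightarrow> nat (Qf x y))) (\<lambda>_. 2)"
  proof (rule gser_reindex[where h = "\<lambda>(m,y). (2 * m + y, y)"])
    show "bij_betw (\<lambda>(m,y). (2 * m + y, y)) UNIV ?E"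
      by (rule bij_betw_byWitness[where f' = "\<lambda>(x,y). ((x - y) div 2, y)"]) auto
    fix z :: "int \<times> int"
    obtain m y where z: "z = (m, y)" by force
    have "int (?f (2 * m + y, y)) = (2 * m + y)\<^sup>2 + 3 * y\<^sup>2" by simp
    also have "\<dots> = 4 * Qf m y" by (simp add: Qf_def power2_eq_square algebra_simps)
    also have "\<dots> = int (4 * nat (Qf m y))" using Qf_nonneg[of m y] by simp
    finally show "?f (case z of (m, y) \<Rightarrow> (2 * m + y, y)) = 4 * (case z of (x,y) \<Rightarrow> nat (Qf x y))"
      unfolding of_nat_eq_iff by (simp add: z)
  qed (auto simp: sign_even_def)
  also have "\<dots> = fps_const 2 * dilate 4 hexa"
    by (simp add: hexa_def gser_dilate gser_cmult)
  finally show ?thesis by (simp add: numeral_fps_const)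
qed

text \<open>Splitting by the parity of y: even y gives the form x^2 + 3y^2, hence u, and odd y gives
  the exponents 1 + 2 tri i + 6 tri j, hence u - v.\<close>

lemma hexa_eq: "hexa = 2 * u_ser - v_ser"
proof -
  let ?g = "\<lambda>(x,y). nat (Qf x y)"
  let ?O = "{(x::int, y::int). odd y}" and ?E = "{(x::int, y::int). even y}"
  have "?E \<union> ?O = UNIV" by auto
  hence "hexa = gser (?E \<union> ?O) ?g (\<lambda>_. 1)" by (simp add: hexa_def)
  also have "\<dots> = gser ?E ?g (\<lambda>_. 1) + gser ?O ?g (\<lambda>_. 1)"
    by (rule gser_Un) (auto intro: fin_fibres_subset[OF fin_fibres_Qf])
  also have "gser ?E ?g (\<lambda>_. 1) = gser UNIV (\<lambda>(x,y). 1 * nat (x\<^sup>2) + 3 * nat (y\<^sup>2)) (\<lambda>_. 1)"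
  proof (rule gser_reindex[where h = "\<lambda>(x,y). (x - y, 2 * y)"])
    show "bij_betw (\<lambda>(x,y). (x - y, 2 * y)) UNIV ?E"
      by (rule bij_betw_byWitness[where f' = "\<lambda>(x,y). (x + y div 2, y div 2)"]) auto
    fix z :: "int \<times> int"
    obtain x y where z: "z = (x, y)" by force
    have "Qf (x - y) (2 * y) = x\<^sup>2 + 3 * y\<^sup>2" by (simp add: Qf_def power2_eq_square algebra_simps)
    thus "?g (case z of (x,y) \<Rightarrow> (x - y, 2 * y)) = (case z of (x,y) \<Rightarrow> 1 * nat (x\<^sup>2) + 3 * nat (y\<^sup>2))"
      by (simp add: z nat_add_distrib nat_mult_distrib)
  qed auto
  also have "\<dots> = dilate 1 phi * dilate 3 phi"
    unfolding dilate_phi[OF zero_less_one] dilate_phi[OF zero_less_numeral]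
    by (subst gser_two_squares) (simp_all add: case_prod_unfold)
  also have "gser ?O ?g (\<lambda>_. 1) = gser UNIV (\<lambda>z. 1 + (case z of (i,j) \<Rightarrow> 2 * tri i + 6 * tri j)) (\<lambda>_. 1)"
  proof (rule gser_reindex[where h = "\<lambda>(i,j). (i - j, 2 * j + 1)"])
    show "bij_betw (\<lambda>(i,j). (i - j, 2 * j + 1)) UNIV ?O"
      by (rule bij_betw_byWitness[where f' = "\<lambda>(x,y). (x + y div 2, y div 2)"]) auto
    fix z :: "int \<times> int"
    obtain i j where z: "z = (i, j)" by force
    have "Qf (i - j) (2 * j + 1) = int (1 + 2 * tri i + 6 * tri j)"
      using int_tri[of i] int_tri[of j] by (simp add: Qf_def power2_eq_square algebra_simps)
    thus "?g (case z of (i,j) \<Rightarrow> (i - j, 2 * j + 1)) = 1 + (case z of (i,j) \<Rightarrow> 2 * tri i + 6 * tri j)"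
      by (simp add: z del: of_nat_add)
  qed auto
  also have "\<dots> = fps_X * dilate 2 psi2 * dilate 6 psi2"
    unfolding mult.assoc by (simp add: dilate_psi2 gser_two_tri gser_X case_prod_unfold)
  also have "\<dots> = u_ser - v_ser" by (rule uv_minus[symmetric])
  finally show ?thesis by (simp add: u_ser_def)
qed

lemma phi_nth_0 [simp]: "phi $ 0 = 1" 
proof -
  have "{x::int. x = 0} = {0}" by auto
  thus ?thesis by (simp add: phi_def gser_nth)
qed

lemma phim_nth_0 [simp]: "phim $ 0 = 1"
proof -
  have "{x::int. x = 0} = {0}" by auto
  thus ?thesis by (simp add: phim_def gser_nth sign_even_def)
qed

lemma psi2_nth: "psi2 $ n = (if \<exists>k. n = k * (k + 1) div 2 then 2 else 0)"
proof (cases "\<exists>k. n = k * (k + 1) div 2")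
  case True
  then obtain k where k: "n = k * (k + 1) div 2" by blast
  have "2 * n = k * (k + 1)" by (simp add: k)
  hence *: "2 * int n = int k * (int k + 1)" by (metis of_nat_1 of_nat_add of_nat_mult of_nat_numeral)
  have "tri x = n \<longleftrightarrow> x = int k \<or> x = - int k - 1" for x
  proof -
    have "tri x = n \<longleftrightarrow> x * (x + 1) = int k * (int k + 1)"
      using int_tri[of x] * by linarith
    also have "\<dots> \<longleftrightarrow> (x - int k) * (x + int k + 1) = 0" by (auto simp: algebra_simps)
    finally show ?thesis by auto
  qed
  hence "{x. tri x = n} = {int k, - int k - 1}" by auto
  thus ?thesis using True by (simp add: psi2_def gser_nth)
next
  case False
  have "tri x \<noteq> n" for x
  proof
    assume x: "tri x = n"
    define k where "k = nat (if x \<ge> 0 then x else - x - 1)"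
    have "int k * (int k + 1) = 2 * int n" using int_tri[of x] by (simp add: k_def x algebra_simps)
    hence "k * (k + 1) = 2 * n" by (metis of_nat_1 of_nat_add of_nat_mult of_nat_numeral of_nat_eq_iff)
    thus False using False by (metis nonzero_mult_div_cancel_left zero_neq_numeral)
  qed
  thus ?thesis using False by (simp add: psi2_def gser_nth)
qed

section \<open>The logarithmic derivative of the modulus\<close>

text \<open>The operator q d/dq rather than d/dq, because it commutes with q -> q^t up to the factor
  t.\<close>

definition qd :: "rat fps \<Rightarrow> rat fps" where
  "qd f = fps_X * fps_deriv f"

lemma qd_nth: "qd f $ n = of_nat n * f $ n"
  by (cases n) (simp_all add: qd_def)

lemma qd_add: "qd (f + g) = qd f + qd g"
  and qd_diff: "qd (f - g) = qd f - qd g"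
  and qd_mult: "qd (f * g) = f * qd g + g * qd f"
  and qd_const [simp]: "qd (fps_const c) = 0"
  and qd_1 [simp]: "qd 1 = 0"
  by (simp_all add: qd_def algebra_simps)

lemma qd_numeral [simp]: "qd (numeral k) = 0"
  by (simp add: numeral_fps_const)

lemma qd_power2: "qd (f\<^sup>2) = 2 * f * qd f"
  by (simp add: power2_eq_square qd_mult algebra_simps)

lemma qd_dilate: "t > 0 \<Longrightarrow> qd (dilate t f) = of_nat t * dilate t (qd f)"
  by (rule fps_ext) (auto simp: qd_nth dilate_nth fps_of_nat[symmetric])

lemma phi_neq_0 [simp]: "phi \<noteq> 0" and phim_neq_0 [simp]: "phim \<noteq> 0"
  using phi_nth_0 phim_nth_0 by (metis fps_zero_nth zero_neq_one)+

lemma psi2_nth_0 [simp]: "psi2 $ 0 = 2"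
  by (auto simp: psi2_nth intro: exI[of _ 0])

lemma psi2_neq_0 [simp]: "psi2 \<noteq> 0"
  using psi2_nth_0 by (metis fps_zero_nth zero_neq_numeral)

lemma dilate_neq_0 [simp]: "t > 0 \<Longrightarrow> dilate t f = 0 \<longleftrightarrow> f = 0"
  using dilate_inj[of t f 0] by simp

text \<open>Jacobi's phi(q)^4 - phi(-q)^4 = 16 q psi(q^2)^4, with the 16 absorbed by
  \<open>psi2\<close>.\<close>

lemma phi_power4_minus: "phi ^ 4 - phim ^ 4 = fps_X * dilate 2 psi2 ^ 4"
proof -
  have "dilate 2 (psi2\<^sup>2) = dilate 2 (2 * phi * dilate 2 psi2)" by (simp only: psi2_square)
  hence 1: "(dilate 2 psi2)\<^sup>2 = 2 * dilate 2 phi * dilate 4 psi2"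
    by (simp add: dilate_power dilate_mult dilate_dilate)
  have "phi ^ 4 - phim ^ 4 = (phi\<^sup>2 - phim\<^sup>2) * (phi\<^sup>2 + phim\<^sup>2)"
    by (simp add: algebra_simps power4_eq_xxxx power2_eq_square)
  also have "\<dots> = fps_X * (2 * dilate 2 phi * dilate 4 psi2)\<^sup>2"
    unfolding phi_square_minus phi_square_plus by (simp add: power2_eq_square)
  also have "\<dots> = fps_X * ((dilate 2 psi2)\<^sup>2)\<^sup>2" by (simp only: 1)
  finally show ?thesis by (simp flip: power_mult)
qed

lemma phi_square_minus_neq_0: "phi\<^sup>2 - phim\<^sup>2 \<noteq> 0"
  unfolding phi_square_minus by simp

lemma phi_square_plus_neq_0: "phi\<^sup>2 + phim\<^sup>2 \<noteq> 0"
  unfolding phi_square_plus by simp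

text \<open>Both sides transform in the same way under \<open>q \<mapsto> q\<^sup>2\<close>, so their quotient is invariant under
  this substitution and hence constant.\<close>

lemma wronskian_phi: "4 * (phi * qd phim - phim * qd phi) = - (phi * phim * (phi ^ 4 - phim ^ 4))"
proof -
  define W where "W = phi * qd phim - phim * qd phi"
  \<comment> \<open>The series phi phim (phi^4 - phim^4) has constant term 0 and cannot be inverted.
    \<open>U\<close> is this series without its factor q, and \<open>qd\<close> supplies the same
    factor on the other side.\<close>
  define U where "U = phi * phim * dilate 2 psi2 ^ 4"
  define V where "V = - 4 * (phi * fps_deriv phim - phim * fps_deriv phi) * inverse U"
  define A B V2 where "A = dilate 2 phi" and "B = dilate 2 phim" and "V2 = dilate 2 V"
  have "U $ 0 \<noteq> 0" by (simp add: U_def)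
  hence U: "inverse U * U = 1" by (rule inverse_mult_eq_1)
  have WV: "4 * W = - (phi * phim * (phi ^ 4 - phim ^ 4) * V)"
  proof -
    have "phi * phim * (phi ^ 4 - phim ^ 4) * V = fps_X * U * V"
      by (simp add: phi_power4_minus U_def)
    also have "\<dots> = fps_X * (- 4 * (phi * fps_deriv phim - phim * fps_deriv phi)) * (inverse U * U)"
      by (simp add: V_def)
    also have "\<dots> = - 4 * W" by (simp only: U) (simp add: W_def qd_def algebra_simps)
    finally show ?thesis by simp
  qed
  have A: "phi\<^sup>2 + phim\<^sup>2 = 2 * A\<^sup>2" and B: "phi * phim = B\<^sup>2"
    by (simp_all add: A_def B_def phi_square_plus phi_times_phim)
  have dA: "2 * phi * qd phi + 2 * phim * qd phim = 4 * A * qd A"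
    using arg_cong[OF A, of qd] by (simp add: qd_add qd_mult qd_power2 algebra_simps)
  have dB: "phi * qd phim + phim * qd phi = 2 * B * qd B"
    using arg_cong[OF B, of qd] by (simp add: qd_add qd_mult qd_power2 algebra_simps)
  have W2: "A * qd B - B * qd A = 2 * dilate 2 W"
    by (simp add: A_def B_def W_def qd_dilate dilate_mult dilate_diff algebra_simps)
  have W2V: "4 * dilate 2 W = - (A * B * (A ^ 4 - B ^ 4) * V2)"
    using arg_cong[OF WV, of "dilate 2"]
    by (simp add: A_def B_def V2_def dilate_mult dilate_diff dilate_power dilate_uminus)
  \<comment> \<open>Combining the two differentiated quadratic relations expresses the Wronskian at
    q^2 by the one at q.\<close>
  have "4 * A * B * (A * qd B - B * qd A) = 2 * A\<^sup>2 * (2 * B * qd B) - B\<^sup>2 * (4 * A * qd A)"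
    by (simp add: algebra_simps power2_eq_square)
  also have "\<dots> = (phi\<^sup>2 + phim\<^sup>2) * (phi * qd phim + phim * qd phi) - phi * phim * (2 * phi * qd phi + 2 * phim * qd phim)"
    by (simp only: A B dA dB)
  also have "\<dots> = (phi\<^sup>2 - phim\<^sup>2) * W"
    by (simp add: W_def algebra_simps power2_eq_square)
  finally have "8 * A * B * dilate 2 W = (phi\<^sup>2 - phim\<^sup>2) * W"
    unfolding W2 by (simp add: mult_ac)
  from arg_cong[OF this, of "\<lambda>z. 4 * z"]
  have "2 * A * B * (4 * dilate 2 W) * 4 = (phi\<^sup>2 - phim\<^sup>2) * (4 * W)" by (simp add: mult_ac)
  hence "2 * A\<^sup>2 * B\<^sup>2 * ((2 * A\<^sup>2)\<^sup>2 - 4 * (B\<^sup>2)\<^sup>2) * V2 = (phi\<^sup>2 - phim\<^sup>2) * (phi * phim * (phi ^ 4 - phim ^ 4)) * V"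
    unfolding WV W2V by (simp add: algebra_simps power2_eq_square power4_eq_xxxx)
  hence "(phi\<^sup>2 + phim\<^sup>2) * (phi * phim) * (phi\<^sup>2 - phim\<^sup>2)\<^sup>2 * V2 = (phi\<^sup>2 + phim\<^sup>2) * (phi * phim) * (phi\<^sup>2 - phim\<^sup>2)\<^sup>2 * V"
    unfolding A[symmetric] B[symmetric] by (simp add: algebra_simps power2_eq_square power4_eq_xxxx)
  hence "V2 = V"
    using phi_square_minus_neq_0 phi_square_plus_neq_0 by simp
  hence "V = fps_const (V $ 0)" unfolding V2_def by (rule dilate_invariant_imp_const)
  moreover have "V $ 0 = 1"
  proof -
    have "(phi - phim) $ 1 = 4"
      unfolding phi_minus mult.assoc numeral_fps_const by simp
    hence "4 * phi $ 1 - 4 * phim $ 1 = 16" by simp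
    moreover have "dilate 2 psi2 ^ 4 $ 0 = 16" by (simp add: power4_eq_xxxx)
    ultimately show ?thesis by (simp add: V_def U_def numeral_fps_const)
  qed
  ultimately have "V = 1" by simp
  thus ?thesis using WV by (simp add: W_def)
qed

section \<open>Product formulas\<close>

text \<open>Congruence modulo q^(N+1); infinite products are compared through their
  truncations.\<close>

definition agree :: "nat \<Rightarrow> 'a::zero fps \<Rightarrow> 'a fps \<Rightarrow> bool" where
  "agree N f g \<longleftrightarrow> (\<forall>m\<le>N. f $ m = g $ m)"

lemma agree_refl [simp]: "agree N f f"
  by (simp add: agree_def)

lemma agree_trans [trans]: "agree N f g \<Longrightarrow> agree N g h \<Longrightarrow> agree N f h"
  by (simp add: agree_def)

lemma agree_sym: "agree N f g \<Longrightarrow> agree N g f"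
  by (simp add: agree_def)

lemma agree_mono: "agree N f g \<Longrightarrow> K \<le> N \<Longrightarrow> agree K f g"
  by (simp add: agree_def)

lemma agree_imp_eq: "(\<And>N. agree N f g) \<Longrightarrow> f = g"
  by (rule fps_ext) (auto simp: agree_def)

lemma agree_mult: "agree N f g \<Longrightarrow> agree N f' g' \<Longrightarrow> agree N (f * f') (g * g')"
  by (auto simp: agree_def fps_mult_nth intro!: sum.cong)

lemma agree_power: "agree N f g \<Longrightarrow> agree N (f ^ k) (g ^ k)"
  by (induction k) (auto intro: agree_mult)

lemma agree_inverse:
  fixes f g :: "'a::field fps"
  assumes "agree N f g" "f $ 0 \<noteq> 0"
  shows "agree N (inverse f) (inverse g)"
proof -
  have g: "g $ 0 \<noteq> 0" using assms by (auto simp: agree_def)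
  have "agree N (inverse f * inverse g * g) (inverse f * inverse g * f)"
    by (intro agree_mult agree_refl agree_sym[OF assms(1)])
  also have "inverse f * inverse g * g = inverse f"
    using inverse_mult_eq_1[OF g] by (simp add: mult.assoc)
  also have "inverse f * inverse g * f = inverse g"
    using inverse_mult_eq_1[OF assms(2)] by (metis mult.commute mult.left_commute mult_1)
  finally show ?thesis .
qed

lemma agree_dilate:
  assumes "agree N f g" "t > 0"
  shows "agree N (dilate t f) (dilate t g)"
  unfolding agree_def
proof (intro allI impI)
  fix m assume "m \<le> N"
  hence "m div t \<le> N" using div_le_dividend[of m t] by linarith
  with \<open>m \<le> N\<close> show "dilate t f $ m = dilate t g $ m"
    using assms by (auto simp: dilate_nth agree_def)
qed

section \<open>The Euler product and the theta series\<close>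

definition eu :: "nat \<Rightarrow> rat fps" where
  "eu N = (\<Prod>s<N. 1 - fps_X ^ (Suc s))"

text \<open>The factors 1 - q^j with j > n do not touch the coefficient of q^n, so the diagonal of
  the partial products is their limit.\<close>

definition euler :: "rat fps" where
  "euler = Abs_fps (\<lambda>n. eu n $ n)"

lemma eu_nth_0 [simp]: "eu N $ 0 = 1"
  by (induction N) (simp_all add: eu_def)

lemma agree_eu_Suc: "agree N (eu (Suc N)) (eu N)"
proof -
  have "eu (Suc N) = eu N - fps_X ^ Suc N * eu N" by (simp add: eu_def algebra_simps)
  thus ?thesis by (auto simp: agree_def fps_X_power_mult_nth simp del: power_Suc)
qed

lemma agree_eu: "K \<ge> N \<Longrightarrow> agree N (eu K) (eu N)"
proof (induction K rule: dec_induct)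
  case (step K)
  thus ?case using agree_trans[OF agree_mono[OF agree_eu_Suc[of K]]] by blast
qed simp

lemma agree_euler: "K \<ge> N \<Longrightarrow> agree N euler (eu K)"
  unfolding agree_def euler_def
proof (intro allI impI)
  fix m assume "N \<le> K" "m \<le> N"
  thus "Abs_fps (\<lambda>n. eu n $ n) $ m = eu K $ m" using agree_eu[of m K] by (simp add: agree_def)
qed

lemma euler_nth_0 [simp]: "euler $ 0 = 1"
  by (simp add: euler_def)

lemma euler_neq_0 [simp]: "euler \<noteq> 0"
  using euler_nth_0 by (metis fps_zero_nth zero_neq_one)

text \<open>Shanks' finite form of Gauss' identity for triangular numbers: the increment of the left-hand
  side, multiplied by \<open>1 - X^(2m+1)\<close>, is the telescoping sum of \<open>U\<close>.\<close>

lemma shanks: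
  fixes P R :: "nat \<Rightarrow> rat fps"
  assumes P: "\<And>n. P (Suc n) * (1 - fps_X ^ (2*n+1)) = P n * (1 - fps_X ^ (2*n+2))"
    and R: "\<And>n. R (Suc n) * (1 - fps_X ^ (2*n+2)) = R n * (1 - fps_X ^ (2*n+1))"
    and PR: "\<And>n. P n * R n = 1"
  shows "(\<Sum>s<n. P n * R s * fps_X ^ (s * (2*n+1))) = (\<Sum>s<2*n. fps_X ^ (s * (s+1) div 2))"
proof (induction n)
  case (Suc m)
  let ?q = "fps_X :: rat fps"
  define t where "t = (\<lambda>n s. P n * R s * ?q ^ (s * (2*n+1)))"
  define U where "U = (\<lambda>s. P m * R s * (1 - ?q ^ (2*s)) * ?q ^ (s * (2*m+1)))"
  have tS: "(1 - ?q ^ (2*m+1)) * t (Suc m) s = P m * R s * ((1 - ?q ^ (2*m+2)) * ?q ^ (2*s) * ?q ^ (s * (2*m+1)))" for s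
  proof -
    have "(1 - ?q ^ (2*m+1)) * t (Suc m) s = (P (Suc m) * (1 - ?q ^ (2*m+1))) * R s * ?q ^ (s * (2*Suc m+1))"
      by (simp only: t_def mult_ac)
    also have "\<dots> = P m * (1 - ?q ^ (2*m+2)) * R s * ?q ^ (2*s + s * (2*m+1))"
      unfolding P by (simp add: algebra_simps)
    finally show ?thesis by (simp only: power_add mult_ac)
  qed
  have US: "U (Suc s) = P m * R s * ((1 - ?q ^ (2*s+1)) * ?q ^ (2*m+1) * ?q ^ (s * (2*m+1)))" for s
  proof -
    have "U (Suc s) = P m * (R (Suc s) * (1 - ?q ^ (2*s+2))) * ?q ^ (2*m+1 + s * (2*m+1))"
      by (simp add: U_def algebra_simps)
    also have "\<dots> = P m * (R s * (1 - ?q ^ (2*s+1))) * (?q ^ (2*m+1) * ?q ^ (s * (2*m+1)))"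
      by (simp only: R) (simp only: power_add)
    finally show ?thesis by (simp only: mult_ac)
  qed
  have diff: "(1 - ?q ^ (2*m+1)) * (t (Suc m) s - t m s) = U (Suc s) - U s" for s
  proof -
    have key: "(1 - ?q ^ (2*m+2)) * ?q ^ (2*s) - (1 - ?q ^ (2*m+1)) = 
      (1 - ?q ^ (2*s+1)) * ?q ^ (2*m+1) - (1 - ?q ^ (2*s))"
      by (simp add: algebra_simps power_add)
    have "(1 - ?q ^ (2*m+1)) * (t (Suc m) s - t m s) = 
       P m * R s * ?q ^ (s * (2*m+1)) * ((1 - ?q ^ (2*m+2)) * ?q ^ (2*s) - (1 - ?q ^ (2*m+1)))"
      unfolding right_diff_distrib[of _ "t (Suc m) s"] tS by (simp only: t_def right_diff_distrib mult_ac)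
    also have "\<dots> = U (Suc s) - U s"
      unfolding key US by (simp only: U_def right_diff_distrib left_diff_distrib mult_ac)
    finally show ?thesis .
  qed
  have "(1 - ?q ^ (2*m+1)) * ((\<Sum>s<Suc m. t (Suc m) s) - (\<Sum>s<m. t m s)) =
     (\<Sum>s<m. (1 - ?q ^ (2*m+1)) * (t (Suc m) s - t m s)) + (1 - ?q ^ (2*m+1)) * t (Suc m) m"
  proof -
    have "c * ((x + y) - z) = c * (x - z) + c * y" for c x y z :: "rat fps"
      by (simp add: algebra_simps)
    thus ?thesis by (simp only: sum.lessThan_Suc sum_subtractf[symmetric] sum_distrib_left)
  qed
  also have "\<dots> = (U m - U 0) + (1 - ?q ^ (2*m+1)) * t (Suc m) m"
    unfolding diff by (simp only: sum_lessThan_telescope)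
  also have "\<dots> = (1 - ?q ^ (2*m)) * ?q ^ (m * (2*m+1)) + (1 - ?q ^ (2*m+2)) * ?q ^ (2*m) * ?q ^ (m * (2*m+1))"
    unfolding tS PR by (simp add: U_def PR)
  \<comment> \<open>The boundary terms combine into the triangular exponents of index 2m and 2m +
    1.\<close>
  also have "\<dots> = (1 - ?q ^ (2*m+1)) * (?q ^ (m * (2*m+1)) + ?q ^ (2*m+1) * ?q ^ (m * (2*m+1)))"
    by (simp add: algebra_simps power_add power2_eq_square mult_2)
  finally have "(\<Sum>s<Suc m. t (Suc m) s) - (\<Sum>s<m. t m s) = ?q ^ (m * (2*m+1)) + ?q ^ (2*m+1) * ?q ^ (m * (2*m+1))"
  proof (subst (asm) mult_left_cancel)
    have "(1 - ?q ^ (2*m+1)) $ 0 = 1" by simp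
    thus "1 - ?q ^ (2*m+1) \<noteq> 0" by (metis fps_zero_nth zero_neq_one)
  qed auto
  moreover have "2 * m * (2 * m + 1) div 2 = m * (2*m+1)" by (simp add: mult.assoc)
  moreover have "(2 * m + 1) * (2 * m + 1 + 1) div 2 = (2*m+1) + m * (2*m+1)"
  proof -
    have "(2 * m + 1) * (2 * m + 1 + 1) = 2 * ((2*m+1) + m * (2*m+1))" by (simp add: algebra_simps)
    thus ?thesis by (simp only: nonzero_mult_div_cancel_left)
  qed
  ultimately have "(\<Sum>s<Suc m. t (Suc m) s) = (?q ^ (2*m*(2*m+1) div 2) + ?q ^ ((2*m+1)*(2*m+1+1) div 2)) + (\<Sum>s<m. t m s)"
    by (simp only: diff_eq_eq power_add)
  also have "(\<Sum>s<m. t m s) = (\<Sum>s<2*m. ?q ^ (s * (s+1) div 2))" using Suc by (simp add: t_def)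
  finally show ?case by (simp add: t_def)
qed simp

text \<open>Gauss' psi(q) = E(q^2)^2 / E(q), with E the Euler product, as the limit of
  \<open>shanks\<close>. \<open>Q\<close> and \<open>Od\<close> collect the factors of even and of
  odd exponent, so that E is the limit of \<open>Od n * Q n\<close>.\<close>

lemma psi2_euler: "psi2 * euler = 2 * (dilate 2 euler)\<^sup>2"
proof -
  let ?q = "fps_X :: rat fps"
  define Q where "Q = (\<lambda>n. \<Prod>s<n. 1 - ?q ^ (2*s+2))"
  define Od where "Od = (\<lambda>n. \<Prod>s<n. 1 - ?q ^ (2*s+1))"
  have Q0: "Q n $ 0 = 1" and O0: "Od n $ 0 = 1" for n
    by (induction n) (simp_all add: Q_def Od_def)
  define P where "P = (\<lambda>n. Q n * inverse (Od n))"
  define R where "R = (\<lambda>n. Od n * inverse (Q n))"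
  have inv: "inverse (Q n) * Q n = 1" "inverse (Od n) * Od n = 1" for n
    by (rule inverse_mult_eq_1; simp add: Q0 O0)+
  have Q_eq: "Q n = dilate 2 (eu n)" for n
    by (induction n) (simp_all add: Q_def eu_def dilate_mult dilate_diff dilate_power dilate_X 
          flip: power_mult power_Suc)
  have eu_eq: "eu (2 * n) = Od n * Q n" for n
    by (induction n) (simp_all add: Q_def Od_def eu_def algebra_simps)
  have P: "P (Suc n) * (1 - ?q ^ (2*n+1)) = P n * (1 - ?q ^ (2*n+2))" for n
  proof -
    have "P (Suc n) * (1 - ?q ^ (2*n+1)) = P (Suc n) * (1 - ?q ^ (2*n+1)) * (inverse (Od n) * Od n)"
      by (simp only: inv mult_1_right)
    also have "\<dots> = Q n * (1 - ?q ^ (2*n+2)) * inverse (Od n) * (inverse (Od (Suc n)) * (Od n * (1 - ?q ^ (2*n+1))))"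
      by (simp add: P_def Q_def mult_ac)
    also have "Od n * (1 - ?q ^ (2*n+1)) = Od (Suc n)" by (simp add: Od_def)
    finally show ?thesis unfolding inv by (simp only: P_def mult_ac mult_1_left)
  qed
  have R: "R (Suc n) * (1 - ?q ^ (2*n+2)) = R n * (1 - ?q ^ (2*n+1))" for n
  proof -
    have "R (Suc n) * (1 - ?q ^ (2*n+2)) = R (Suc n) * (1 - ?q ^ (2*n+2)) * (inverse (Q n) * Q n)"
      by (simp only: inv mult_1_right)
    also have "\<dots> = Od n * (1 - ?q ^ (2*n+1)) * inverse (Q n) * (inverse (Q (Suc n)) * (Q n * (1 - ?q ^ (2*n+2))))"
      by (simp add: R_def Od_def mult_ac)
    also have "Q n * (1 - ?q ^ (2*n+2)) = Q (Suc n)" by (simp add: Q_def)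
    finally show ?thesis unfolding inv by (simp only: R_def mult_ac mult_1_left)
  qed
  have PR: "P n * R n = 1" for n
  proof -
    have "P n * R n = (inverse (Q n) * Q n) * (inverse (Od n) * Od n)" by (simp only: P_def R_def mult_ac)
    thus ?thesis by (simp only: inv mult_1_right)
  qed
  have "agree N psi2 (2 * P (Suc N))" for N
    unfolding agree_def
  proof (intro allI impI)
    fix m assume m: "m \<le> N"
    let ?n = "Suc N"
    \<comment> \<open>Every summand with s > 0 is divisible by q^(2n+1) with n = N + 1, beyond the
      degree m <= N in question; only s = 0 survives.\<close>
    have "(\<Sum>s<?n. P ?n * R s * ?q ^ (s * (2*?n+1))) $ m = (\<Sum>s\<in>{..<?n}. if s = 0 then (P ?n * R 0) $ m else 0)"
      unfolding fps_sum_nth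
    proof (rule sum.cong)
      fix s
      have "m < s * (2 * ?n + 1)" if "s \<noteq> 0" 
        using m that mult_le_mono1[of 1 s "2 * ?n + 1"] by auto
      thus "(P ?n * R s * ?q ^ (s * (2*?n+1))) $ m = (if s = 0 then (P ?n * R 0) $ m else 0)"
        by (auto simp: fps_X_power_mult_right_nth)
    qed simp
    also have "\<dots> = P ?n $ m" by (simp add: R_def Od_def Q_def)
    finally have "P ?n $ m = (\<Sum>s<2*?n. ?q ^ (s * (s+1) div 2)) $ m"
      by (simp only: shanks[of P R, OF P R PR])
    also have "\<dots> = (\<Sum>s\<in>{..<2*?n}. if m = s * (s+1) div 2 then 1 else 0)"
      unfolding fps_sum_nth by (rule sum.cong) (simp_all add: fps_X_power_nth)
    also have "\<dots> = (if \<exists>k. m = k * (k + 1) div 2 then 1 else 0)"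
    proof (cases "\<exists>k. m = k * (k + 1) div 2")
      case True
      then obtain k where k: "m = k * (k + 1) div 2" by blast
      have inj: "s = k" if "m = s * (s + 1) div 2" for s
      proof (rule ccontr)
        have mono: "a < b \<Longrightarrow> a * (a + 1) < b * (b + 1)" for a b :: nat
          by (intro mult_strict_mono) auto
        have two: "j * (j + 1) = 2 * (j * (j + 1) div 2)" for j :: nat by simp
        have "s * (s + 1) = 2 * m" unfolding that by (rule two)
        moreover have "k * (k + 1) = 2 * m" unfolding k by (rule two)
        moreover assume "s \<noteq> k"
        hence "s * (s + 1) < k * (k + 1) \<or> k * (k + 1) < s * (s + 1)"
          using mono[of s k] mono[of k s] by linarith
        ultimately show False by simp
      qed
      have "k \<le> m" unfolding k by (cases k) auto
      hence "k < 2 * ?n" using m by simp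
      moreover have "(\<Sum>s\<in>{..<2*?n}. if m = s * (s+1) div 2 then 1 else 0 :: rat) = (\<Sum>s\<in>{..<2*?n}. if s = k then 1 else 0)"
        using inj k by (intro sum.cong) auto
      ultimately show ?thesis using True by simp
    next
      case False
      thus ?thesis by auto
    qed
    finally show "psi2 $ m = (2 * P ?n) $ m" by (simp add: psi2_nth numeral_fps_const)
  qed
  hence 1: "agree N (psi2 * euler) (2 * P (Suc N) * eu (2 * Suc N))" for N
    by (intro agree_mult agree_euler) auto
  have "2 * P n * eu (2 * n) = 2 * (dilate 2 (eu n))\<^sup>2" for n
  proof -
    have "2 * P n * eu (2 * n) = 2 * (Q n)\<^sup>2 * (inverse (Od n) * Od n)" 
      unfolding eu_eq P_def by (simp only: mult_ac power2_eq_square)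
    thus ?thesis by (simp only: inv Q_eq mult_1_right)
  qed
  with 1 have "agree N (psi2 * euler) (2 * (dilate 2 (eu (Suc N)))\<^sup>2)" for N by metis
  moreover have "agree N (2 * (dilate 2 (eu (Suc N)))\<^sup>2) (2 * (dilate 2 euler)\<^sup>2)" for N
    by (intro agree_mult agree_power agree_dilate agree_sym[OF agree_euler]) auto
  ultimately show ?thesis by (blast intro: agree_imp_eq agree_trans)
qed

text \<open>Gauss' product at q and at q^2 eliminates psi from psi(q)^2 = phi(q) psi(q^2).\<close>

lemma phi_euler: "phi * euler\<^sup>2 * (dilate 4 euler)\<^sup>2 = (dilate 2 euler) ^ 5"
proof -
  define E1 E2 E4 where "E1 = euler" and "E2 = dilate 2 euler" and "E4 = dilate 4 euler"
  have nz: "E1 \<noteq> 0" "E2 \<noteq> 0" by (simp_all add: E1_def E2_def)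
  have 1: "psi2 * E1 = 2 * E2\<^sup>2" using psi2_euler by (simp add: E1_def E2_def)
  have 2: "dilate 2 psi2 * E2 = 2 * E4\<^sup>2"
    using arg_cong[OF psi2_euler, of "dilate 2"]
    by (simp add: E4_def E2_def dilate_mult dilate_power dilate_dilate)
  have "2 * (2 * E2 ^ 5) = (2 * E2\<^sup>2)\<^sup>2 * E2" by (simp add: power2_eq_square eval_nat_numeral)
  also have "\<dots> = psi2\<^sup>2 * E1\<^sup>2 * E2" unfolding 1[symmetric] by (simp add: power_mult_distrib)
  also have "\<dots> = 2 * phi * E1\<^sup>2 * (dilate 2 psi2 * E2)" by (simp add: psi2_square algebra_simps)
  also have "\<dots> = 2 * (2 * (phi * E1\<^sup>2 * E4\<^sup>2))" by (subst 2) (simp only: mult_ac)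
  finally show ?thesis by (simp add: E1_def E2_def E4_def)
qed

text \<open>The quotient V of the two sides satisfies V(q) = V(q^2)^2, by phi phim = phim(q^2)^2 and
  the product for phi, and hence is 1.\<close>

lemma phim_euler: "phim * dilate 2 euler = euler\<^sup>2"
proof -
  define E1 E2 E4 where "E1 = euler" and "E2 = dilate 2 euler" and "E4 = dilate 4 euler"
  define V where "V = phim * E2 * inverse (E1\<^sup>2)"
  have nz: "E1 \<noteq> 0" "E2 \<noteq> 0" "E4 \<noteq> 0" by (simp_all add: E1_def E2_def E4_def)
  have E0: "E1\<^sup>2 $ 0 = 1" "E2\<^sup>2 $ 0 = 1" by (simp_all add: E1_def E2_def power2_eq_square)
  have V: "V * E1\<^sup>2 = phim * E2"
    using inverse_mult_eq_1[of "E1\<^sup>2"] E0 by (simp add: V_def mult.assoc)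
  have V2: "dilate 2 V * E2\<^sup>2 = dilate 2 phim * E4"
    using arg_cong[OF V, of "dilate 2"] 
    by (simp add: E1_def E2_def E4_def dilate_mult dilate_power dilate_dilate)
  have "(dilate 2 V)\<^sup>2 * E2 ^ 4 * E1\<^sup>2 = (dilate 2 V * E2\<^sup>2)\<^sup>2 * E1\<^sup>2"
    by (simp add: power_mult_distrib flip: power_mult)
  also have "\<dots> = (dilate 2 phim)\<^sup>2 * E4\<^sup>2 * E1\<^sup>2" unfolding V2 by (simp add: power_mult_distrib)
  also have "\<dots> = phim * (phi * E1\<^sup>2 * E4\<^sup>2)" unfolding phi_times_phim[symmetric] by (simp add: mult_ac)
  also have "\<dots> = phim * E2 ^ 5" using phi_euler by (simp add: E1_def E2_def E4_def)
  also have "\<dots> = phim * E2 * E2 ^ 4" by (simp add: eval_nat_numeral)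
  also have "\<dots> = V * E2 ^ 4 * E1\<^sup>2" unfolding V[symmetric] by (simp add: mult_ac)
  finally have "V = (dilate 2 V)\<^sup>2" using nz by simp
  hence "V = 1" by (rule eq_dilate_square_imp_1) (use E0 in \<open>simp add: V_def E2_def\<close>)
  thus ?thesis using V by (simp add: E1_def E2_def)
qed

section \<open>Logarithmic derivatives as Lambert series\<close>

text \<open>The Lambert series of all n q^n / (1 - q^n), that is (1 - E_2) / 24.\<close>

definition divsum :: "rat fps" where
  "divsum = Abs_fps (\<lambda>n. if n = 0 then 0 else of_nat (\<Sum>d\<in>{d. d dvd n}. d))"

text \<open>Logarithmic derivative factor by factor: 1 - q^n contributes -n q^n / (1 - q^n).\<close>

lemma qd_euler: "qd euler = - euler * divsum"
proof -
  \<comment> \<open>This is q / (1 - q), so that \<open>dilate k g\<close> is q^k / (1 -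
    q^k).\<close>
  define g :: "rat fps" where "g = Abs_fps (\<lambda>n. if n = 0 then 0 else 1)"
  have g: "(1 - fps_X) * g = fps_X"
    by (rule fps_ext) (auto simp: g_def algebra_simps)
  have gk: "(1 - fps_X ^ k) * dilate k g = fps_X ^ k" if "k > 0" for k
    using arg_cong[OF g, of "dilate k"] that by (simp add: dilate_mult dilate_diff dilate_X)
  define L where "L = (\<lambda>N. \<Sum>s<N. of_nat (Suc s) * dilate (Suc s) g)"
  have eu: "qd (eu N) = - eu N * L N" for N
  proof (induction N)
    case 0
    show ?case by (simp add: eu_def L_def)
  next
    case (Suc N)
    have "qd (1 - fps_X ^ Suc N) = - of_nat (Suc N) * fps_X ^ Suc N"
      by (rule fps_ext) (auto simp: qd_nth fps_of_nat[symmetric] simp del: power_Suc)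
    also have "\<dots> = - of_nat (Suc N) * ((1 - fps_X ^ Suc N) * dilate (Suc N) g)"
      by (simp only: gk zero_less_Suc)
    finally have *: "qd (1 - fps_X ^ Suc N) = - of_nat (Suc N) * ((1 - fps_X ^ Suc N) * dilate (Suc N) g)" .
    have e: "eu (Suc N) = eu N * (1 - fps_X ^ Suc N)" and l: "L (Suc N) = L N + of_nat (Suc N) * dilate (Suc N) g"
      by (simp_all add: eu_def L_def)
    show ?case unfolding e l qd_mult Suc * by (simp add: algebra_simps del: of_nat_Suc power_Suc)
  qed
  have L: "agree N (L N) divsum" for N
    unfolding agree_def
  proof (intro allI impI)
    fix m assume m: "m \<le> N"
    show "L N $ m = divsum $ m"
    proof (cases "m = 0")
      case True
      thus ?thesis by (simp add: L_def divsum_def fps_sum_nth g_def fps_of_nat[symmetric])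
    next
      case False
      have "L N $ m = (\<Sum>s<N. if Suc s dvd m then of_nat (Suc s) else 0)"
        unfolding L_def fps_sum_nth
      proof (rule sum.cong)
        fix s
        show "(of_nat (Suc s) * dilate (Suc s) g) $ m = (if Suc s dvd m then of_nat (Suc s) else 0)"
          using False by (auto simp: dilate_nth g_def fps_of_nat[symmetric] dvd_div_eq_0_iff simp del: of_nat_Suc)
      qed simp
      also have "\<dots> = (\<Sum>d\<in>{1..N}. if d dvd m then of_nat d else 0)"
        by (rule sum.reindex_bij_witness[of _ "\<lambda>d. d - 1" Suc]) auto
      also have "\<dots> = (\<Sum>d\<in>{d. d dvd m}. of_nat d)"
      proof -
        have "{d. d dvd m} = {d\<in>{1..N}. d dvd m}" using False m 
          by (auto dest: dvd_imp_le simp: Suc_le_eq dvd_pos_nat)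
        thus ?thesis by (simp only: sum.inter_filter[OF finite_atLeastAtMost])
      qed
      finally show ?thesis using False by (simp add: divsum_def)
    qed
  qed
  show ?thesis
  proof (rule agree_imp_eq)
    fix N
    have "agree N (qd euler) (qd (eu N))"
      using agree_euler[of N N] by (simp add: agree_def qd_nth)
    also have "qd (eu N) = (- 1) * (eu N * L N)" by (simp add: eu)
    also have "agree N \<dots> ((- 1) * (euler * divsum))"
      by (intro agree_mult agree_refl L agree_sym[OF agree_euler]) simp
    finally show "agree N (qd euler) (- euler * divsum)" by simp
  qed
qed

text \<open>The product for phim gives its logarithmic derivative, phi phim = phim(q^2)^2 gives that
  of phi, and \<open>wronskian_phi\<close> turns their difference into phi^4 - phim^4.\<close>

lemma psi2_power4: "fps_X * dilate 2 psi2 ^ 4 = 16 * divsum - 48 * dilate 2 divsum + 32 * dilate 4 divsum"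
proof -
  define S S2 S4 where "S = divsum" and "S2 = dilate 2 divsum" and "S4 = dilate 4 divsum"
  define Y2 where "Y2 = dilate 2 phim"
  define E2 where "E2 = dilate 2 euler"
  have E2: "qd E2 = - 2 * E2 * S2"
    by (simp add: E2_def S2_def qd_dilate qd_euler dilate_mult dilate_uminus)
  have "E2 \<noteq> 0" by (simp add: E2_def)
  have "phim * E2 = euler\<^sup>2" using phim_euler by (simp add: E2_def)
  from arg_cong[OF this, of qd] have "phim * qd E2 + E2 * qd phim = 2 * euler * qd euler"
    by (simp add: qd_mult qd_power2)
  also have "\<dots> = - 2 * euler\<^sup>2 * S" by (simp add: qd_euler S_def power2_eq_square)
  also have "\<dots> = - 2 * (phim * E2) * S" using phim_euler by (simp add: E2_def)
  finally have "E2 * qd phim = E2 * (phim * (2 * S2 - 2 * S))" by (simp add: E2 algebra_simps)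
  hence dY: "qd phim = phim * (2 * S2 - 2 * S)" using \<open>E2 \<noteq> 0\<close> by simp
  have dY2: "qd Y2 = Y2 * (4 * S4 - 4 * S2)"
    by (simp add: Y2_def S2_def S4_def S_def qd_dilate dY dilate_mult dilate_diff dilate_dilate algebra_simps)
  have XY: "phi * phim = Y2\<^sup>2" by (simp add: phi_times_phim Y2_def)
  from arg_cong[OF this, of qd] have "phi * qd phim + phim * qd phi = 2 * Y2 * qd Y2"
    by (simp add: qd_mult qd_power2)
  also have "\<dots> = 2 * (phi * phim) * (4 * S4 - 4 * S2)" unfolding XY dY2 by (simp add: power2_eq_square)
  finally have dX: "phim * qd phi = phim * phi * (8 * S4 - 10 * S2 + 2 * S)"
    unfolding dY by (simp add: algebra_simps)
  have "- (phi * phim * (phi ^ 4 - phim ^ 4)) = 4 * (phi * qd phim) - 4 * (phim * qd phi)"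
    unfolding wronskian_phi[symmetric] by (simp add: algebra_simps)
  also have "\<dots> = - (phi * phim * (16 * S - 48 * S2 + 32 * S4))"
    unfolding dX dY by (simp add: algebra_simps)
  finally have "phi * phim * (phi ^ 4 - phim ^ 4) = phi * phim * (16 * S - 48 * S2 + 32 * S4)" by simp
  hence "phi ^ 4 - phim ^ 4 = 16 * S - 48 * S2 + 32 * S4" by simp
  thus ?thesis by (simp add: phi_power4_minus S_def S2_def S4_def)
qed

text \<open>The even coefficients vanish because the left-hand side is odd; for the odd ones only the
  first term of the previous formula contributes.\<close>

lemma psi2_power4_nth:
  "(fps_X * dilate 2 psi2 ^ 4) $ n = (if odd n then 16 * of_nat (\<Sum>d\<in>{d. d dvd n}. d) else 0)"
proof (cases "odd n")
  case True
  hence "n \<noteq> 0" "\<not> 4 dvd n" by (auto intro: odd_pos elim: dvd_trans[rotated])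
  thus ?thesis using True unfolding psi2_power4
    by (simp add: numeral_fps_const dilate_nth divsum_def)
next
  case False
  have "dilate 2 psi2 ^ 4 = dilate 2 (psi2 ^ 4)" by (simp add: dilate_power)
  thus ?thesis using False by (cases n) (simp_all add: dilate_nth)
qed

section \<open>Liouville's identity and the Eisenstein series\<close>

text \<open>The sum of a b over this set is the coefficient of q^(2m) in the square of the sum of
  sigma(n) q^n over odd n.\<close>

definition odd_quads :: "int \<Rightarrow> (int \<times> int \<times> int \<times> int) set" where
  "odd_quads m = {(a,x,b,y). a > 0 \<and> x > 0 \<and> b > 0 \<and> y > 0 \<and> odd a \<and> odd x \<and> odd b \<and> odd y \<and> a * x + b * y = 2 * m}"

text \<open>Auxiliary set with weight d^2, to parts of which the weights (a - b)^2 and (a + b)^2 on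
  \<open>odd_quads\<close> are transported.\<close>

definition mixed_quads :: "int \<Rightarrow> (int \<times> int \<times> int \<times> int) set" where
  "mixed_quads m = {(d,x,b,e). d > 0 \<and> x > 0 \<and> b > 0 \<and> e > 0 \<and> even d \<and> odd x \<and> odd b \<and> even e \<and> d * x + b * e = 2 * m}"

lemma finite_pos_quads:
  "finite {(a::int,x,b,y). a > 0 \<and> x > 0 \<and> b > 0 \<and> y > 0 \<and> a * x + b * y = n}"
proof (rule finite_subset)
  show "{(a,x,b,y). a > 0 \<and> x > 0 \<and> b > 0 \<and> y > 0 \<and> a * x + b * y = n} \<subseteq> {1..n} \<times> {1..n} \<times> {1..n} \<times> {1..n}"
  proof (rule subsetI)
    fix z assume "z \<in> {(a::int,x,b,y). a > 0 \<and> x > 0 \<and> b > 0 \<and> y > 0 \<and> a * x + b * y = n}"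
    then obtain a x b y where z: "z = (a,x,b,y)" and pos: "a > 0" "x > 0" "b > 0" "y > 0" and n: "a * x + b * y = n"
      by auto
    have "a * 1 \<le> a * x" "1 * x \<le> a * x" "b * 1 \<le> b * y" "1 * y \<le> b * y" "a * x > 0" "b * y > 0"
      using pos by (auto simp del: mult_1_left mult_1_right intro!: mult_left_mono mult_right_mono)
    hence "a \<le> n" "x \<le> n" "b \<le> n" "y \<le> n" using n by linarith+
    thus "z \<in> {1..n} \<times> {1..n} \<times> {1..n} \<times> {1..n}" using pos by (simp add: z)
  qed
qed auto

lemma finite_odd_quads: "finite (odd_quads m)"
  by (rule finite_subset[OF _ finite_pos_quads[of "2 * m"]]) (auto simp: odd_quads_def)

lemma finite_mixed_quads: "finite (mixed_quads m)"
  by (rule finite_subset[OF _ finite_pos_quads[of "2 * m"]]) (auto simp: mixed_quads_def)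

lemma sum_trichotomy:
  fixes f g :: "'a \<Rightarrow> 'c::linorder" and h :: "'a \<Rightarrow> int"
  assumes "finite S"
  shows "sum h S = sum h {z\<in>S. f z < g z} + sum h {z\<in>S. f z = g z} + sum h {z\<in>S. f z > g z}"
proof -
  have "S = ({z\<in>S. f z < g z} \<union> {z\<in>S. f z = g z}) \<union> {z\<in>S. f z > g z}" by auto
  also have "sum h \<dots> = sum h ({z\<in>S. f z < g z} \<union> {z\<in>S. f z = g z}) + sum h {z\<in>S. f z > g z}"
    by (rule sum.union_disjoint) (use assms in auto)
  also have "sum h ({z\<in>S. f z < g z} \<union> {z\<in>S. f z = g z}) = sum h {z\<in>S. f z < g z} + sum h {z\<in>S. f z = g z}"
    by (rule sum.union_disjoint) (use assms in auto)
  finally show ?thesis .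
qed

text \<open>Write 4ab = (a + b)^2 - (a - b)^2. Apart from the terms with x = y, the first square
  sums to twice the part b < d of the sum of d^2 over \<open>mixed_quads\<close>, and the second
  sums to twice the part x < e. The complementary parts b > d and x > e agree, and parity excludes b
  = d and x = e. Hence everything cancels except x = y.\<close>

lemma liouville_odd:
  "4 * (\<Sum>(a,x,b,y)\<in>odd_quads m. a * b) = (\<Sum>(a,x,b,y)\<in>{(a,x,b,y)\<in>odd_quads m. x = y}. (a + b)\<^sup>2)"
proof -
  let ?S = "odd_quads m" and ?U = "mixed_quads m"
  have eq: "4 * (\<Sum>(a,x,b,y)\<in>?S. a * b) = (\<Sum>(a,x,b,y)\<in>?S. (a + b)\<^sup>2) - (\<Sum>(a,x,b,y)\<in>?S. (a - b)\<^sup>2)"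
    unfolding sum_distrib_left sum_subtractf[symmetric]
    by (rule sum.cong) (auto simp: power2_eq_square algebra_simps)
  have swap1: "(\<Sum>(a,x,b,y)\<in>{(a,x,b,y)\<in>?S. x < y}. (a + b)\<^sup>2) = (\<Sum>(a,x,b,y)\<in>{(a,x,b,y)\<in>?S. x > y}. (a + b)\<^sup>2)"
    by (rule sum.reindex_bij_witness[of _ "\<lambda>(a,x,b,y). (b,y,a,x)" "\<lambda>(a,x,b,y). (b,y,a,x)"])
       (auto simp: odd_quads_def algebra_simps)
  have swap2: "(\<Sum>(a,x,b,y)\<in>{(a,x,b,y)\<in>?S. a < b}. (a - b)\<^sup>2) = (\<Sum>(a,x,b,y)\<in>{(a,x,b,y)\<in>?S. a > b}. (a - b)\<^sup>2)"
    by (rule sum.reindex_bij_witness[of _ "\<lambda>(a,x,b,y). (b,y,a,x)" "\<lambda>(a,x,b,y). (b,y,a,x)"])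
       (auto simp: odd_quads_def algebra_simps power2_commute)
  \<comment> \<open>From a x + b y = (a - b) x + b (x + y); the next two bijections use (a + b) y +
    a (x - y) and d (x - e) + (b + d) e in the same way.\<close>
  have U1: "(\<Sum>(a,x,b,y)\<in>{(a,x,b,y)\<in>?S. a > b}. (a - b)\<^sup>2) = (\<Sum>(d,x,b,e)\<in>{(d,x,b,e)\<in>?U. e > x}. d\<^sup>2)"
    by (rule sum.reindex_bij_witness[of _ "\<lambda>(d,x,b,e). (d + b, x, b, e - x)" "\<lambda>(a,x,b,y). (a - b, x, b, x + y)"])
       (auto simp: odd_quads_def mixed_quads_def algebra_simps)
  have U2: "(\<Sum>(a,x,b,y)\<in>{(a,x,b,y)\<in>?S. x > y}. (a + b)\<^sup>2) = (\<Sum>(d,x,b,e)\<in>{(d,x,b,e)\<in>?U. b < d}. d\<^sup>2)"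
    by (rule sum.reindex_bij_witness[of _ "\<lambda>(d,x,b,e). (b, e + x, d - b, x)" "\<lambda>(a,x,b,y). (a + b, y, a, x - y)"])
       (auto simp: odd_quads_def mixed_quads_def algebra_simps)
  have U3: "(\<Sum>(d,x,b,e)\<in>{(d,x,b,e)\<in>?U. e < x}. d\<^sup>2) = (\<Sum>(d,x,b,e)\<in>{(d,x,b,e)\<in>?U. b > d}. d\<^sup>2)"
    by (rule sum.reindex_bij_witness[of _ "\<lambda>(d,x,b,e). (d, x + e, b - d, e)" "\<lambda>(d,x,b,e). (d, x - e, b + d, e)"])
       (auto simp: mixed_quads_def algebra_simps)
  have split1: "(\<Sum>(d,x,b,e)\<in>?U. d\<^sup>2) = (\<Sum>(d,x,b,e)\<in>{(d,x,b,e)\<in>?U. e > x}. d\<^sup>2) + (\<Sum>(d,x,b,e)\<in>{(d,x,b,e)\<in>?U. e < x}. d\<^sup>2)"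
  proof -
    have e: "(\<Sum>(d,x,b,e)\<in>{(d,x,b,e)\<in>?U. x = e}. d\<^sup>2) = 0"
      by (rule sum.neutral) (auto simp: mixed_quads_def)
    show ?thesis
      using sum_trichotomy[OF finite_mixed_quads, of "\<lambda>(d,x,b,e). d\<^sup>2" m "\<lambda>(d,x,b,e). x" "\<lambda>(d,x,b,e). e"] e
      by (simp add: case_prod_unfold)
  qed
  have split2: "(\<Sum>(d,x,b,e)\<in>?U. d\<^sup>2) = (\<Sum>(d,x,b,e)\<in>{(d,x,b,e)\<in>?U. b < d}. d\<^sup>2) + (\<Sum>(d,x,b,e)\<in>{(d,x,b,e)\<in>?U. b > d}. d\<^sup>2)"
  proof -
    have e: "(\<Sum>(d,x,b,e)\<in>{(d,x,b,e)\<in>?U. b = d}. d\<^sup>2) = 0"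
      by (rule sum.neutral) (auto simp: mixed_quads_def)
    show ?thesis
      using sum_trichotomy[OF finite_mixed_quads, of "\<lambda>(d,x,b,e). d\<^sup>2" m "\<lambda>(d,x,b,e). b" "\<lambda>(d,x,b,e). d"] e
      by (simp add: case_prod_unfold)
  qed
  have split3: "(\<Sum>(a,x,b,y)\<in>?S. (a + b)\<^sup>2) = (\<Sum>(a,x,b,y)\<in>{(a,x,b,y)\<in>?S. x < y}. (a + b)\<^sup>2) +
     (\<Sum>(a,x,b,y)\<in>{(a,x,b,y)\<in>?S. x = y}. (a + b)\<^sup>2) + (\<Sum>(a,x,b,y)\<in>{(a,x,b,y)\<in>?S. x > y}. (a + b)\<^sup>2)"
    using sum_trichotomy[OF finite_odd_quads, of "\<lambda>(a,x,b,y). (a + b)\<^sup>2" m "\<lambda>(a,x,b,y). x" "\<lambda>(a,x,b,y). y"]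
    by (simp add: case_prod_unfold)
  have split4: "(\<Sum>(a,x,b,y)\<in>?S. (a - b)\<^sup>2) = (\<Sum>(a,x,b,y)\<in>{(a,x,b,y)\<in>?S. a < b}. (a - b)\<^sup>2) + (\<Sum>(a,x,b,y)\<in>{(a,x,b,y)\<in>?S. a > b}. (a - b)\<^sup>2)"
  proof -
    have "(\<Sum>(a,x,b,y)\<in>{(a,x,b,y)\<in>?S. a = b}. (a - b)\<^sup>2) = 0" by (rule sum.neutral) auto
    thus ?thesis
      using sum_trichotomy[OF finite_odd_quads, of "\<lambda>(a,x,b,y). (a - b)\<^sup>2" m "\<lambda>(a,x,b,y). a" "\<lambda>(a,x,b,y). b"]
      by (simp add: case_prod_unfold)
  qed
  show ?thesis
    unfolding eq split3 split4 swap1 swap2 using U1 U2 U3 split1 split2 by linarith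
qed

text \<open>If x = y, then a + b = 2m / x and a runs over the m / x odd numbers below this value;
  each contributes (2m / x)^2.\<close>

lemma sum_equal_cofactors:
  assumes "m > 0"
  shows "(\<Sum>(a,x,b,y)\<in>{(a,x,b,y)\<in>odd_quads m. x = y}. (a + b)\<^sup>2) = (\<Sum>x\<in>{x. x > 0 \<and> odd x \<and> x dvd m}. 4 * (m div x) ^ 3)"
proof -
  let ?D = "{x. x > 0 \<and> odd x \<and> x dvd m}"
  have fin: "finite ?D" by (rule finite_subset[of _ "{1..m}"]) (use assms in \<open>auto dest: zdvd_imp_le\<close>)
  have "(\<Sum>(a,x,b,y)\<in>{(a,x,b,y)\<in>odd_quads m. x = y}. (a + b)\<^sup>2) = 
        (\<Sum>(x,i)\<in>(SIGMA x:?D. {1..m div x}). 4 * (m div x)\<^sup>2)"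
  proof (rule sum.reindex_bij_witness[of _ "\<lambda>(x,i). (2 * i - 1, x, 2 * (m div x) - 2 * i + 1, x)" "\<lambda>(a,x,b,y). (x, (a + 1) div 2)"])
    fix z assume "z \<in> {(a,x,b,y)\<in>odd_quads m. x = y}"
    then obtain a b x where z: "z = (a,x,b,x)" and pos: "a > 0" "b > 0" "x > 0" "odd a" "odd b" "odd x"
      and eq: "a * x + b * x = 2 * m"
      by (auto simp: odd_quads_def)
    obtain i' where "a = 2 * i' + 1" using \<open>odd a\<close> by (rule oddE)
    define i where "i = i' + 1"
    have i: "a = 2 * i - 1" using \<open>a = 2 * i' + 1\<close> by (simp add: i_def)
    obtain j' where "b = 2 * j' + 1" using \<open>odd b\<close> by (rule oddE)
    define j where "j = j' + 1"
    have j: "b = 2 * j - 1" using \<open>b = 2 * j' + 1\<close> by (simp add: j_def)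
    have m: "m = x * (i + j - 1)" using eq by (simp add: i j algebra_simps)
    have md: "m div x = i + j - 1" using pos by (simp add: m)
    have ai: "(a + 1) div 2 = i" by (simp add: i)
    show "(case case z of (a,x,b,y) \<Rightarrow> (x, (a + 1) div 2) of (x,i) \<Rightarrow> (2 * i - 1, x, 2 * (m div x) - 2 * i + 1, x)) = z"
      by (simp add: z ai md) (simp add: i j)
    show "(case z of (a,x,b,y) \<Rightarrow> (x, (a + 1) div 2)) \<in> (SIGMA x:?D. {1..m div x})"
      using pos by (simp add: z ai md) (use pos in \<open>simp add: i j m\<close>)
    show "(case case z of (a,x,b,y) \<Rightarrow> (x, (a + 1) div 2) of (x,i) \<Rightarrow> 4 * (m div x)\<^sup>2) = (case z of (a,x,b,y) \<Rightarrow> (a + b)\<^sup>2)"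
      by (simp add: z md) (simp add: i j power2_eq_square algebra_simps)
  next
    fix z assume "z \<in> (SIGMA x:?D. {1..m div x})"
    then obtain x i where z: "z = (x, i)" and x: "x > 0" "odd x" "x dvd m" and i: "1 \<le> i" "i \<le> m div x" by auto
    show "(case case z of (x,i) \<Rightarrow> (2 * i - 1, x, 2 * (m div x) - 2 * i + 1, x) of (a,x,b,y) \<Rightarrow> (x, (a + 1) div 2)) = z"
      by (simp add: z)
    have "x * (m div x) = m" using x by simp
    hence "(2 * i - 1) * x + (2 * (m div x) - 2 * i + 1) * x = 2 * m" by (simp add: algebra_simps)
    thus "(case z of (x,i) \<Rightarrow> (2 * i - 1, x, 2 * (m div x) - 2 * i + 1, x)) \<in> {(a,x,b,y)\<in>odd_quads m. x = y}"
      using x i by (simp add: z odd_quads_def)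
  qed
  also have "\<dots> = (\<Sum>x\<in>?D. \<Sum>i\<in>{1..m div x}. 4 * (m div x)\<^sup>2)"
    by (rule sum.Sigma[symmetric]) (use fin in auto)
  also have "\<dots> = (\<Sum>x\<in>?D. 4 * (m div x) ^ 3)"
    using assms by (intro sum.cong) (auto simp: power2_eq_square power3_eq_cube pos_imp_zdiv_nonneg_iff)
  finally show ?thesis .
qed

lemma sum_odd_quads:
  assumes "m > 0"
  shows "(\<Sum>(a,x,b,y)\<in>odd_quads m. a * b) = (\<Sum>x\<in>{x. x > 0 \<and> odd x \<and> x dvd m}. (m div x) ^ 3)"
  using liouville_odd[of m] sum_equal_cofactors[OF assms] by (simp add: sum_distrib_left[symmetric])

definition odd_cofactor_cubes :: "rat fps" where
  "odd_cofactor_cubes = Abs_fps (\<lambda>n. if n = 0 then 0 else \<Sum>x\<in>{x. odd x \<and> x dvd n}. of_nat ((n div x) ^ 3))"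

text \<open>The square of the series in \<open>psi2_power4_nth\<close> is q psi2(q)^8 taken at q^2.
  Its coefficient at 2n is a sum over \<open>odd_quads\<close>, which \<open>sum_odd_quads\<close>
  evaluates.\<close>

lemma psi2_power8: "fps_X * psi2 ^ 8 = 256 * odd_cofactor_cubes"
proof -
  define OP where "OP = {(a::nat,x::nat). odd a \<and> odd x}"
  define h where "h = gser OP (\<lambda>(a,x). a * x) (\<lambda>(a,x). of_nat a)"
  have ff: "fin_fibres OP (\<lambda>(a,x). a * x)"
    unfolding fin_fibres_def
  proof
    fix n
    have "a \<le> a * x \<and> x \<le> a * x" if "odd a" "odd x" for a x :: nat
      using that by (auto simp: odd_pos Suc_le_eq)
    hence "{z \<in> OP. (case z of (a, x) \<Rightarrow> a * x) = n} \<subseteq> {..n} \<times> {..n}"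
      by (auto simp: OP_def)
    thus "finite {z \<in> OP. (case z of (a, x) \<Rightarrow> a * x) = n}" by (rule finite_subset) auto
  qed
  have h_nth: "h $ n = (if odd n then of_nat (\<Sum>d\<in>{d. d dvd n}. d) else 0)" for n
  proof (cases "odd n")
    case True
    have "h $ n = (\<Sum>(a,x)\<in>{z \<in> OP. (case z of (a, x) \<Rightarrow> a * x) = n}. of_nat a)"
      by (simp add: h_def gser_nth)
    also have "\<dots> = (\<Sum>d\<in>{d. d dvd n}. of_nat d)"
      using True by (intro sum.reindex_bij_witness[of _ "\<lambda>d. (d, n div d)" fst])
         (auto simp: OP_def odd_pos elim!: dvdE)
    finally show ?thesis using True by simp
  next
    case False
    hence "{z \<in> OP. (case z of (a, x) \<Rightarrow> a * x) = n} = {}" by (auto simp: OP_def)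
    thus ?thesis using False unfolding h_def gser_nth by (simp only: sum.empty if_False)
  qed
  have "fps_X * dilate 2 psi2 ^ 4 = 16 * h"
    by (rule fps_ext) (simp only: psi2_power4_nth h_nth numeral_fps_const fps_mult_left_const_nth, simp)
  hence "(fps_X * dilate 2 psi2 ^ 4)\<^sup>2 = 256 * (h * h)" by (simp add: power2_eq_square)
  moreover have "(fps_X * dilate 2 psi2 ^ 4)\<^sup>2 = dilate 2 (fps_X * psi2 ^ 8)"
    by (simp add: dilate_mult dilate_power dilate_X power_mult_distrib flip: power_mult)
  ultimately have eq: "dilate 2 (fps_X * psi2 ^ 8) = 256 * (h * h)" by simp
  have hh: "h * h = gser (OP \<times> OP) (\<lambda>(z,z'). (case z of (a,x) \<Rightarrow> a * x) + (case z' of (a,x) \<Rightarrow> a * x))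
      (\<lambda>(z,z'). (case z of (a,x) \<Rightarrow> of_nat a) * (case z' of (a,x) \<Rightarrow> of_nat a))"
    unfolding h_def by (rule gser_mult[OF ff ff])
  have "(h * h) $ (2 * n) = odd_cofactor_cubes $ n" for n
  proof (cases "n = 0")
    case False
    have "(h * h) $ (2 * n) = (\<Sum>(a,x,b,y)\<in>odd_quads (int n). of_int (a * b))"
      unfolding hh gser_nth
    proof (rule sum.reindex_bij_witness[of _ "\<lambda>(a,x,b,y). ((nat a, nat x), (nat b, nat y))" "\<lambda>((a,x),(b,y)). (int a, int x, int b, int y)"], goal_cases)
      case (2 z)
      then obtain a x b y where z: "z = ((a,x),(b,y))" "odd a" "odd x" "odd b" "odd y" "a * x + b * y = 2 * n"
        by (auto simp: OP_def)
      have "int a * int x + int b * int y = 2 * int n" using z(6) by (metis of_nat_add of_nat_mult of_nat_numeral)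
      then show ?case using z by (auto simp: odd_quads_def odd_pos)
    next
      case (4 z)
      then obtain a x b y where z: "z = (a,x,b,y)" and pos: "a > 0" "x > 0" "b > 0" "y > 0" "odd a" "odd x" "odd b" "odd y"
         and eq: "a * x + b * y = 2 * int n" by (auto simp: odd_quads_def)
      have "nat a * nat x + nat b * nat y = nat (a * x + b * y)"
        using pos by (simp add: nat_add_distrib nat_mult_distrib)
      also have "\<dots> = 2 * n" unfolding eq by simp
      finally show ?case using pos by (simp add: z OP_def even_nat_iff)
    qed (auto simp: odd_quads_def)
    also have "\<dots> = of_int (\<Sum>(a,x,b,y)\<in>odd_quads (int n). a * b)"
      by (simp add: case_prod_unfold)
    also have "(\<Sum>(a,x,b,y)\<in>odd_quads (int n). a * b) = (\<Sum>x\<in>{x. x > 0 \<and> odd x \<and> x dvd int n}. (int n div x) ^ 3)"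
      using False by (intro sum_odd_quads) auto
    also have "\<dots> = (\<Sum>x\<in>{x. odd x \<and> x dvd n}. int ((n div x) ^ 3))"
      by (rule sum.reindex_bij_witness[of _ int nat])
         (auto simp: odd_pos even_nat_iff nat_dvd_iff zdiv_int)
    finally show ?thesis using False by (simp add: odd_cofactor_cubes_def)
  qed (simp add: odd_cofactor_cubes_def h_nth)
  hence "(256 * (h * h)) $ (2 * n) = (256 * odd_cofactor_cubes) $ n" for n
    by (simp add: numeral_fps_const)
  hence "dilate 2 (fps_X * psi2 ^ 8) $ (2 * n) = (256 * odd_cofactor_cubes) $ n" for n
    unfolding eq by simp
  thus ?thesis by (intro fps_ext) (simp add: dilate_nth)
qed

section \<open>The Eisenstein series in terms of phi and phim\<close>

definition E4 :: "rat fps" where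
  "E4 = Abs_fps E4c"

text \<open>The divisors d of n with n / d even are the divisors of n / 2, so subtracting their
  cubes leaves the d with n / d odd.\<close>

lemma E4_minus: "E4 - dilate 2 E4 = 240 * odd_cofactor_cubes"
proof (rule fps_ext)
  fix n
  show "(E4 - dilate 2 E4) $ n = (240 * odd_cofactor_cubes) $ n"
  proof (cases "n = 0")
    case True
    thus ?thesis by (simp add: E4_def E4c_def odd_cofactor_cubes_def)
  next
    case False
    let ?D = "{d. d dvd n}"
    have fin: "finite ?D" using False by simp
    have D: "?D = {d. d dvd n \<and> odd (n div d)} \<union> {d. d dvd n \<and> even (n div d)}" by auto
    have "sigma3 n = (\<Sum>d\<in>{d. d dvd n \<and> odd (n div d)}. d ^ 3) + (\<Sum>d\<in>{d. d dvd n \<and> even (n div d)}. d ^ 3)"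
      unfolding sigma3_def by (subst D, rule sum.union_disjoint) (use fin in auto)
    moreover have "(\<Sum>d\<in>{d. d dvd n \<and> odd (n div d)}. d ^ 3) = (\<Sum>x\<in>{x. odd x \<and> x dvd n}. (n div x) ^ 3)"
      using False by (intro sum.reindex_bij_witness[of _ "\<lambda>x. n div x" "\<lambda>x. n div x"]) (auto elim!: dvdE)
    moreover have "(\<Sum>d\<in>{d. d dvd n \<and> even (n div d)}. d ^ 3) = (if even n then sigma3 (n div 2) else 0)"
    proof (cases "even n")
      case True
      obtain k where k: "n = 2 * k" using True by blast
      have "d dvd 2 * k \<and> even (2 * k div d) \<longleftrightarrow> d dvd k" for d
      proof
        assume "d dvd 2 * k \<and> even (2 * k div d)"
        then obtain c where c: "2 * k = d * c" and "even (2 * k div d)" by blast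
        moreover have "d > 0" using c False k by (intro Nat.gr0I) auto
        ultimately have "even c" by simp
        then obtain e where "c = 2 * e" by blast
        thus "d dvd k" using c by simp
      next
        assume "d dvd k"
        then obtain e where "k = d * e" by blast
        moreover from this have "2 * k = d * (2 * e)" by simp
        moreover have "d > 0" using \<open>k = d * e\<close> False k by (intro Nat.gr0I) auto
        ultimately show "d dvd 2 * k \<and> even (2 * k div d)" by simp
      qed
      hence "{d. d dvd n \<and> even (n div d)} = {d. d dvd n div 2}"
        by (simp add: k)
      thus ?thesis using True by (simp add: sigma3_def)
    next
      case odd: False
      have "odd (n div d)" if "d dvd n" for d
        using odd that by (metis dvd_div_mult_self even_mult_iff)
      hence "{d. d dvd n \<and> even (n div d)} = {}" by blast
      thus ?thesis using odd by (simp only: sum.empty if_False)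
    qed
    ultimately have "of_nat (sigma3 n) - (if even n then of_nat (sigma3 (n div 2)) else 0) = (\<Sum>x\<in>{x. odd x \<and> x dvd n}. rat_of_nat ((n div x) ^ 3))"
      by auto
    thus ?thesis using False
      by (auto simp: E4_def E4c_def odd_cofactor_cubes_def dilate_nth numeral_fps_const dvd_div_eq_0_iff split: if_splits)
  qed
qed

text \<open>The fourth power of psi(q)^2 = phi(q) psi(q^2) turns q psi(q)^8 into phi^4 times
  Jacobi's difference phi^4 - phim^4.\<close>

lemma E4_minus_phi: "E4 - dilate 2 E4 = 15 * phi ^ 4 * (phi ^ 4 - phim ^ 4)"
proof -
  have "psi2 ^ 8 = (psi2\<^sup>2) ^ 4" by (simp flip: power_mult)
  also have "\<dots> = 16 * phi ^ 4 * dilate 2 psi2 ^ 4" unfolding psi2_square by (simp add: power_mult_distrib)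
  finally have "256 * odd_cofactor_cubes = 16 * phi ^ 4 * (phi ^ 4 - phim ^ 4)"
    unfolding phi_power4_minus psi2_power8[symmetric] by (simp add: mult_ac)
  from arg_cong[OF this, of "\<lambda>z. 15 * z"]
  have "16 * (E4 - dilate 2 E4) = 16 * (15 * phi ^ 4 * (phi ^ 4 - phim ^ 4))"
    unfolding E4_minus by (simp add: algebra_simps)
  thus ?thesis by (subst (asm) mult_left_cancel) auto
qed

lemma dilate2_phi_power4:
  "4 * dilate 2 phi ^ 4 = (phi\<^sup>2 + phim\<^sup>2)\<^sup>2" "dilate 2 phim ^ 4 = phi\<^sup>2 * phim\<^sup>2"
proof -
  have "4 * dilate 2 phi ^ 4 = (2 * (dilate 2 phi)\<^sup>2)\<^sup>2" by (simp add: power_mult_distrib flip: power_mult)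
  thus "4 * dilate 2 phi ^ 4 = (phi\<^sup>2 + phim\<^sup>2)\<^sup>2" by (simp only: phi_square_plus)
  have "dilate 2 phim ^ 4 = ((dilate 2 phim)\<^sup>2)\<^sup>2" by (simp flip: power_mult)
  thus "dilate 2 phim ^ 4 = phi\<^sup>2 * phim\<^sup>2" unfolding phi_times_phim[symmetric] by (simp add: power_mult_distrib)
qed

text \<open>The right-hand side G is the classical phi^8 (1 - x + x^2) with 1 - x = phim^4 / phi^4.
  By \<open>E4_minus_phi\<close> at q^2, G(q) - G(q^2) equals E_4(q^2) - E_4(q^4), so the difference
  of the two sides is fixed by q -> q^2 and has constant term 0.\<close>

lemma E4_2: "dilate 2 E4 = phi ^ 8 - phi ^ 4 * phim ^ 4 + phim ^ 8"
proof -
  define G where "G = phi ^ 8 - phi ^ 4 * phim ^ 4 + phim ^ 8"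
  define e where "e = dilate 2 E4 - G"
  define A where "A = dilate 2 phi ^ 4"
  define B where "B = dilate 2 phim ^ 4"
  define a where "a = phi\<^sup>2"
  define b where "b = phim\<^sup>2"
  have A: "4 * A = (a + b)\<^sup>2" and B: "B = a * b"
    by (simp_all add: A_def B_def a_def b_def dilate2_phi_power4)
  have G: "G = a ^ 4 - a\<^sup>2 * b\<^sup>2 + b ^ 4" by (simp add: G_def a_def b_def flip: power_mult)
  have G2: "dilate 2 G = A\<^sup>2 - A * B + B\<^sup>2"
    by (simp add: G_def A_def B_def dilate_mult dilate_diff dilate_add dilate_power flip: power_mult)
  have E: "dilate 2 E4 - dilate 4 E4 = 15 * A * (A - B)"
    using arg_cong[OF E4_minus_phi, of "dilate 2"]
    by (simp add: A_def B_def dilate_mult dilate_diff dilate_power dilate_dilate)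
  have "16 * (15 * A * (A - B)) = 16 * (G - dilate 2 G)"
  proof -
    have "16 * (15 * A * (A - B)) = 15 * (4 * A) * (4 * A - 4 * B)" by (simp add: algebra_simps)
    also have "\<dots> = 16 * (a ^ 4 - a\<^sup>2 * b\<^sup>2 + b ^ 4) - ((4 * A)\<^sup>2 - 4 * (4 * A) * B + 16 * B\<^sup>2)"
      unfolding A B by (simp add: algebra_simps power2_eq_square power4_eq_xxxx)
    also have "\<dots> = 16 * (G - dilate 2 G)" unfolding G2 by (simp add: G algebra_simps power2_eq_square)
    finally show ?thesis .
  qed
  hence "15 * A * (A - B) = G - dilate 2 G" by (subst (asm) mult_left_cancel) auto
  hence "dilate 2 E4 - dilate 4 E4 = G - dilate 2 G" using E by simp
  hence "dilate 2 e = e" by (simp add: e_def dilate_diff dilate_dilate algebra_simps)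
  hence "e = fps_const (e $ 0)" by (rule dilate_invariant_imp_const)
  moreover have "e $ 0 = 0" by (simp add: e_def G_def E4_def E4c_def fps_power_zeroth)
  ultimately show ?thesis by (simp add: e_def G_def)
qed

lemma E4_1: "E4 = 16 * phi ^ 8 - 16 * phi ^ 4 * phim ^ 4 + phim ^ 8"
proof -
  have "E4 = dilate 2 E4 + 15 * phi ^ 4 * (phi ^ 4 - phim ^ 4)" unfolding E4_minus_phi[symmetric] by simp
  thus ?thesis unfolding E4_2 by (simp add: algebra_simps flip: power_add)
qed

text \<open>This is \<open>E4_2\<close> at q^2. Substituting phi(q^2)^4 = (phi^2 + phim^2)^2 / 4
  creates a denominator 16, here cleared; \<open>E4_8\<close> repeats the step.\<close>

lemma E4_4: "16 * dilate 4 E4 = phi ^ 8 + 14 * phi ^ 4 * phim ^ 4 + phim ^ 8"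
proof -
  define A where "A = dilate 2 phi ^ 4"
  define a b where "a = phi\<^sup>2" and "b = phim\<^sup>2"
  have A: "4 * A = (a + b)\<^sup>2" and B: "dilate 2 phim ^ 4 = a * b"
    by (simp_all add: A_def a_def b_def dilate2_phi_power4)
  have "dilate 4 E4 = A\<^sup>2 - A * (dilate 2 phim ^ 4) + (dilate 2 phim ^ 4)\<^sup>2"
    using arg_cong[OF E4_2, of "dilate 2"]
    by (simp add: A_def dilate_mult dilate_diff dilate_add dilate_power dilate_dilate flip: power_mult)
  from arg_cong[OF this, of "\<lambda>z. 16 * z"] have "16 * dilate 4 E4 = (4 * A)\<^sup>2 - 4 * (4 * A) * (a * b) + 16 * (a * b)\<^sup>2"
    unfolding B by (simp add: algebra_simps power2_eq_square)
  also have "\<dots> = a ^ 4 + 14 * a\<^sup>2 * b\<^sup>2 + b ^ 4"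
    unfolding A by (simp add: algebra_simps power2_eq_square power4_eq_xxxx)
  finally show ?thesis by (simp add: a_def b_def flip: power_mult)
qed

lemma E4_8:
  "256 * dilate 8 E4 = (phi\<^sup>2 + phim\<^sup>2) ^ 4 + 56 * phi\<^sup>2 * phim\<^sup>2 * (phi\<^sup>2 + phim\<^sup>2)\<^sup>2 + 16 * phi ^ 4 * phim ^ 4"
proof -
  define A where "A = dilate 2 phi ^ 4"
  define a b where "a = phi\<^sup>2" and "b = phim\<^sup>2"
  have A: "4 * A = (a + b)\<^sup>2" and B: "dilate 2 phim ^ 4 = a * b"
    by (simp_all add: A_def a_def b_def dilate2_phi_power4)
  have "16 * dilate 8 E4 = A\<^sup>2 + 14 * A * (dilate 2 phim ^ 4) + (dilate 2 phim ^ 4)\<^sup>2"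
    using arg_cong[OF E4_4, of "dilate 2"]
    by (simp add: A_def dilate_mult dilate_diff dilate_add dilate_power dilate_dilate flip: power_mult)
  from arg_cong[OF this, of "\<lambda>z. 16 * z"] have "256 * dilate 8 E4 = (4 * A)\<^sup>2 + 56 * (4 * A) * (a * b) + 16 * (a * b)\<^sup>2"
    unfolding B by (simp add: algebra_simps power2_eq_square)
  also have "\<dots> = (a + b) ^ 4 + 56 * a * b * (a + b)\<^sup>2 + 16 * a\<^sup>2 * b\<^sup>2"
    unfolding A by (simp add: algebra_simps power2_eq_square power4_eq_xxxx)
  finally show ?thesis by (simp add: a_def b_def flip: power_mult)
qed

section \<open>Rational parametrization at level 12\<close>

definition phi3 :: "rat fps" where "phi3 = dilate 3 phi"
definition phim3 :: "rat fps" where "phim3 = dilate 3 phim"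
text \<open>By phi phim = phim(q^2)^2 at q and at q^3 this is the geometric mean of u and v.\<close>

definition w_ser :: "rat fps" where "w_ser = dilate 2 v_ser"
definition b_ser :: "rat fps" where "b_ser = dilate 2 hexa"

lemma u_eq: "u_ser = phi * phi3" and v_eq: "v_ser = phim * phim3"
  by (simp_all add: u_ser_def v_ser_def phi3_def phim3_def)

lemma theta_nth_0 [simp]: "phi3 $ 0 = 1" "phim3 $ 0 = 1" "u_ser $ 0 = 1" "v_ser $ 0 = 1" "w_ser $ 0 = 1" "b_ser $ 0 = 1"
  by (simp_all add: u_eq v_eq phi3_def phim3_def w_ser_def b_ser_def hexa_eq numeral_fps_const)

lemma fps_neq_0_if_nth_0: "f $ 0 \<noteq> 0 \<Longrightarrow> f \<noteq> 0"
  by auto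

lemma uvw_neq_0 [simp]: "u_ser \<noteq> 0" "v_ser \<noteq> 0" "w_ser \<noteq> 0" "phi3 \<noteq> 0" "phim3 \<noteq> 0"
  by (rule fps_neq_0_if_nth_0; simp)+

lemma w_square: "w_ser\<^sup>2 = u_ser * v_ser"
proof -
  have 3: "phi3 * phim3 = (dilate 6 phim)\<^sup>2"
    using arg_cong[OF phi_times_phim, of "dilate 3"]
    by (simp add: phi3_def phim3_def dilate_mult dilate_power dilate_dilate)
  have "w_ser\<^sup>2 = (dilate 2 phim)\<^sup>2 * (dilate 6 phim)\<^sup>2"
    by (simp add: w_ser_def v_ser_def dilate_mult dilate_dilate power_mult_distrib)
  also have "\<dots> = (phi * phim) * (phi3 * phim3)" unfolding 3 phi_times_phim ..
  finally show ?thesis by (simp add: u_eq v_eq mult_ac)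
qed

lemma u2_square: "(2 * dilate 2 u_ser)\<^sup>2 = (phi\<^sup>2 + phim\<^sup>2) * (phi3\<^sup>2 + phim3\<^sup>2)"
proof -
  have "phi3\<^sup>2 + phim3\<^sup>2 = 2 * (dilate 6 phi)\<^sup>2"
    using arg_cong[OF phi_square_plus, of "dilate 3"]
    by (simp add: phi3_def phim3_def dilate_mult dilate_add dilate_power dilate_dilate)
  thus ?thesis unfolding phi_square_plus
    by (simp add: u_ser_def dilate_mult dilate_dilate power_mult_distrib)
qed

lemma phi3_power4_minus: "phi3 ^ 4 - phim3 ^ 4 = fps_X ^ 3 * dilate 6 psi2 ^ 4"
  using arg_cong[OF phi_power4_minus, of "dilate 3"]
  by (simp add: phi3_def phim3_def dilate_mult dilate_diff dilate_power dilate_dilate dilate_X)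

text \<open>The modular equation of degree 3: by Jacobi's identity and \<open>uv_minus\<close>, both
  sides are q^4 times the same fourth powers of psi2 at q^2 and q^6.\<close>

lemma uv_minus_power4: "(u_ser - v_ser) ^ 4 = (phi ^ 4 - phim ^ 4) * (phi3 ^ 4 - phim3 ^ 4)"
  unfolding uv_minus phi_power4_minus phi3_power4_minus
  by (simp add: power_mult_distrib algebra_simps eval_nat_numeral)

text \<open>An expansion of the modular equation; the last factor will prove to be b^2.\<close>

lemma w_squared_b_squared:
  "(phi\<^sup>2 * phim3\<^sup>2 + phim\<^sup>2 * phi3\<^sup>2)\<^sup>2 = 4 * w_ser\<^sup>2 * (u_ser\<^sup>2 - u_ser * v_ser + v_ser\<^sup>2)"
  using uv_minus_power4 unfolding w_square u_eq v_eq by algebra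

text \<open>The quotient c = N / (2w) has the square claimed for b, and (2u(q^2))^2 = (c + w)^2. The
  constant term selects the positive root, and b = 2u(q^2) - w, which is \<open>hexa_eq\<close> at
  q^2, then identifies c with b.\<close>

lemma b_facts: 
  shows b_square: "b_ser\<^sup>2 = u_ser\<^sup>2 - u_ser * v_ser + v_ser\<^sup>2"
    and wb: "2 * w_ser * b_ser = phi\<^sup>2 * phim3\<^sup>2 + phim\<^sup>2 * phi3\<^sup>2"
    and u2: "2 * dilate 2 u_ser = b_ser + w_ser"
proof -
  define N where "N = phi\<^sup>2 * phim3\<^sup>2 + phim\<^sup>2 * phi3\<^sup>2"
  define c where "c = N * inverse (2 * w_ser)"
  have w0: "(2 * w_ser) $ 0 \<noteq> 0" by (simp add: numeral_fps_const)
  have c: "2 * w_ser * c = N"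
    using inverse_mult_eq_1[OF w0] by (simp add: c_def mult.left_commute[of _ N] mult.commute[of "2 * w_ser"])
  have N: "N\<^sup>2 = 4 * w_ser\<^sup>2 * (u_ser\<^sup>2 - u_ser * v_ser + v_ser\<^sup>2)"
    unfolding N_def by (rule w_squared_b_squared)
  have "4 * w_ser\<^sup>2 * c\<^sup>2 = N\<^sup>2" unfolding c[symmetric] by (simp add: power_mult_distrib)
  hence c2: "c\<^sup>2 = u_ser\<^sup>2 - u_ser * v_ser + v_ser\<^sup>2" unfolding N by simp
  have "(2 * dilate 2 u_ser)\<^sup>2 = u_ser\<^sup>2 + v_ser\<^sup>2 + N"
    unfolding u2_square unfolding N_def u_eq v_eq by (simp add: algebra_simps power_mult_distrib)
  also have "\<dots> = (c + w_ser)\<^sup>2"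
    unfolding c[symmetric] power2_sum c2 w_square by (simp add: algebra_simps)
  finally have "2 * dilate 2 u_ser = c + w_ser \<or> 2 * dilate 2 u_ser = - (c + w_ser)"
    by (simp only: power2_eq_iff)
  moreover have "2 * dilate 2 u_ser \<noteq> - (c + w_ser)"
  proof
    assume "2 * dilate 2 u_ser = - (c + w_ser)"
    from arg_cong[OF this, of "\<lambda>f. f $ 0"] show False
      by (simp add: numeral_fps_const c_def N_def fps_power_zeroth)
  qed
  ultimately have u2: "2 * dilate 2 u_ser = c + w_ser" by blast
  have "b_ser = 2 * dilate 2 u_ser - w_ser"
    by (simp add: b_ser_def hexa_eq w_ser_def dilate_diff dilate_mult)
  hence b: "b_ser = c" using u2 by simp
  show "b_ser\<^sup>2 = u_ser\<^sup>2 - u_ser * v_ser + v_ser\<^sup>2" using c2 b by simp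
  show "2 * w_ser * b_ser = phi\<^sup>2 * phim3\<^sup>2 + phim\<^sup>2 * phi3\<^sup>2" using c b by (simp add: N_def)
  show "2 * dilate 2 u_ser = b_ser + w_ser" using u2 b by simp
qed

lemma w_uv_minus: "phi\<^sup>2 * phim3\<^sup>2 - phim\<^sup>2 * phi3\<^sup>2 = 2 * w_ser * (u_ser - v_ser)"
proof -
  let ?d = "phi\<^sup>2 * phim3\<^sup>2 - phim\<^sup>2 * phi3\<^sup>2"
  have "?d\<^sup>2 = (phi\<^sup>2 * phim3\<^sup>2 + phim\<^sup>2 * phi3\<^sup>2)\<^sup>2 - 4 * (u_ser * v_ser)\<^sup>2"
    unfolding u_eq v_eq by algebra
  also have "\<dots> = (2 * w_ser * (u_ser - v_ser))\<^sup>2"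
    unfolding wb[symmetric] w_square[symmetric] using b_square w_square by algebra
  finally have "?d = 2 * w_ser * (u_ser - v_ser) \<or> ?d = - (2 * w_ser * (u_ser - v_ser))"
    by (simp add: power2_eq_iff)
  moreover have "?d \<noteq> - (2 * w_ser * (u_ser - v_ser))"
  proof
    assume "?d = - (2 * w_ser * (u_ser - v_ser))"
    \<comment> \<open>Both constant terms vanish, so the coefficients of q decide the sign.\<close>
    from arg_cong[OF this, of "\<lambda>f. f $ 1"] 
    have "?d $ 1 = - ((2 * w_ser * (u_ser - v_ser)) $ 1)" by simp
    moreover have "phi $ 1 - phim $ 1 = 4"
      using arg_cong[OF phi_minus, of "\<lambda>f. f $ 1"] unfolding mult.assoc numeral_fps_const by simp
    hence "?d $ 1 = 8"
      by (simp add: power2_eq_square fps_mult_nth_1 phi3_def phim3_def dilate_nth)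
    moreover have "(2 * w_ser * (u_ser - v_ser)) $ 1 = 8"
      unfolding uv_minus by (simp add: numeral_fps_const fps_mult_nth_1)
    ultimately show False by simp
  qed
  ultimately show ?thesis by blast
qed

text \<open>Solution of \<open>u = k + 2kp\<close>, \<open>b + v = 2k + kp\<close>, which parametrizes the conic
  \<open>b\<^sup>2 = u\<^sup>2 - uv + v\<^sup>2\<close>.\<close>

definition k_ser :: "rat fps" where "k_ser = fps_const (1/3) * (2 * (b_ser + v_ser) - u_ser)"
definition p_ser :: "rat fps" where "p_ser = fps_const (1/3) * (2 * u_ser - b_ser - v_ser) * inverse k_ser"

lemma k_nth_0 [simp]: "k_ser $ 0 = 1"
  by (simp add: k_ser_def numeral_fps_const)

lemma k_neq_0 [simp]: "k_ser \<noteq> 0"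
  by (rule fps_neq_0_if_nth_0) simp

lemma k_eq: "3 * k_ser = 2 * (b_ser + v_ser) - u_ser"
  by (simp add: k_ser_def numeral_fps_const mult.assoc[symmetric])

lemma kp_eq: "3 * (k_ser * p_ser) = 2 * u_ser - b_ser - v_ser"
proof -
  have "k_ser * inverse k_ser = 1" using inverse_mult_eq_1[of k_ser] by (simp add: mult.commute)
  hence "k_ser * p_ser = fps_const (1/3) * (2 * u_ser - b_ser - v_ser)" 
    by (simp add: p_ser_def mult.left_commute)
  thus ?thesis by (simp add: numeral_fps_const mult.assoc[symmetric])
qed

lemma p_nth_0 [simp]: "p_ser $ 0 = 0"
  by (simp add: p_ser_def numeral_fps_const)

lemma u_param: "u_ser = k_ser * (1 + 2 * p_ser)"
proof -
  have "3 * u_ser = 3 * (k_ser * (1 + 2 * p_ser))" using k_eq kp_eq by algebra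
  thus ?thesis by simp
qed

text \<open>Putting b = k (2 + p) - v into the conic cancels v^2 and leaves an equation linear in v
  with coefficient 3k.\<close>

lemma v_param: "v_ser = k_ser * (1 - p_ser\<^sup>2)"
proof -
  have "3 * k_ser * v_ser = 3 * k_ser * (k_ser * (1 - p_ser\<^sup>2))" using k_eq kp_eq b_square by algebra
  thus ?thesis by simp
qed

lemma b_param: "b_ser = k_ser * (1 + p_ser + p_ser\<^sup>2)"
  using k_eq kp_eq u_param v_param by algebra

lemma uv_minus_param: "u_ser - v_ser = k_ser * p_ser * (2 + p_ser)"
  unfolding u_param v_param by (simp add: algebra_simps power2_eq_square)

lemma p_neq_0 [simp]: "p_ser \<noteq> 0"
proof
  assume "p_ser = 0"
  hence "u_ser - v_ser = 0" by (simp add: uv_minus_param)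
  thus False unfolding uv_minus by simp
qed

lemma p_factors_neq_0: "2 + p_ser \<noteq> 0" "1 + 2 * p_ser \<noteq> 0"
  by (rule fps_neq_0_if_nth_0; simp add: numeral_fps_const)+

text \<open>Half the sum and half the difference of \<open>wb\<close> and \<open>w_uv_minus\<close>,
  where b + (u - v) = k (1 + p)(1 + 2p) and b - (u - v) = k (1 - p).\<close>

lemma phi_phim3: "phi\<^sup>2 * phim3\<^sup>2 = w_ser * k_ser * (1 + p_ser) * (1 + 2 * p_ser)" (is ?A)
  and phim_phi3: "phim\<^sup>2 * phi3\<^sup>2 = w_ser * k_ser * (1 - p_ser)" (is ?B)
proof -
  have "2 * (phi\<^sup>2 * phim3\<^sup>2) = 2 * (w_ser * k_ser * (1 + p_ser) * (1 + 2 * p_ser))"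
    using wb w_uv_minus unfolding b_param uv_minus_param by algebra
  thus ?A by (subst (asm) mult_left_cancel) auto
  have "2 * (phim\<^sup>2 * phi3\<^sup>2) = 2 * (w_ser * k_ser * (1 - p_ser))"
    using wb w_uv_minus unfolding b_param uv_minus_param by algebra
  thus ?B by (subst (asm) mult_left_cancel) auto
qed

section \<open>Separating phi(q) from phi(q^3) by differentiation\<close>

lemma wronskian_phi3: "4 * (phi3 * qd phim3 - phim3 * qd phi3) = - (3 * phi3 * phim3 * (phi3 ^ 4 - phim3 ^ 4))"
proof -
  have "4 * (phi3 * qd phim3 - phim3 * qd phi3) = 3 * dilate 3 (4 * (phi * qd phim - phim * qd phi))"
    by (simp add: phi3_def phim3_def qd_dilate dilate_mult dilate_diff algebra_simps)
  thus ?thesis unfolding wronskian_phi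
    by (simp add: phi3_def phim3_def dilate_mult dilate_diff dilate_power dilate_uminus)
qed

text \<open>Logarithmic derivatives of \<open>v/u\<close> and of \<open>phim\<^sup>2 phi3\<^sup>2 / (phi\<^sup>2 phim3\<^sup>2)\<close>, computed both
  from the parametrization and from the Wronskians.\<close>

lemma qd_p_first:
  "8 * k_ser\<^sup>2 * (1 + p_ser + p_ser\<^sup>2) * qd p_ser = u_ser * v_ser * ((phi ^ 4 - phim ^ 4) + 3 * (phi3 ^ 4 - phim3 ^ 4))"
proof -
  have du: "qd u_ser = k_ser * (2 * qd p_ser) + (1 + 2 * p_ser) * qd k_ser"
    and dv: "qd v_ser = k_ser * (- (2 * p_ser * qd p_ser)) + (1 - p_ser\<^sup>2) * qd k_ser"
    unfolding u_param v_param by (simp_all add: qd_mult qd_add qd_diff qd_power2)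
  have "qd u_ser = phi * qd phi3 + phi3 * qd phi" "qd v_ser = phim * qd phim3 + phim3 * qd phim"
    unfolding u_eq v_eq by (simp_all add: qd_mult)
  hence "- (4 * (u_ser * qd v_ser - v_ser * qd u_ser)) = u_ser * v_ser * ((phi ^ 4 - phim ^ 4) + 3 * (phi3 ^ 4 - phim3 ^ 4))"
    using wronskian_phi wronskian_phi3 unfolding u_eq v_eq by algebra
  moreover have "- (4 * (u_ser * qd v_ser - v_ser * qd u_ser)) = 8 * k_ser\<^sup>2 * (1 + p_ser + p_ser\<^sup>2) * qd p_ser"
    unfolding du dv unfolding u_param v_param by algebra
  ultimately show ?thesis by simp
qed

lemma qd_p_second:
  "4 * k_ser\<^sup>2 * (2 + 2 * p_ser - p_ser\<^sup>2) * qd p_ser = u_ser * v_ser * ((phi ^ 4 - phim ^ 4) - 3 * (phi3 ^ 4 - phim3 ^ 4))"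
proof -
  define f g where "f = phi\<^sup>2 * phim3\<^sup>2" and "g = phim\<^sup>2 * phi3\<^sup>2"
  define c where "c = w_ser * k_ser"
  have f: "f = c * ((1 + p_ser) * (1 + 2 * p_ser))" and g: "g = c * (1 - p_ser)"
    unfolding f_def g_def c_def phi_phim3 phim_phi3 by (simp_all only: mult_ac)
  have df: "qd f = c * ((1 + p_ser) * (2 * qd p_ser) + (1 + 2 * p_ser) * qd p_ser) + (1 + p_ser) * (1 + 2 * p_ser) * qd c"
    and dg: "qd g = c * (- qd p_ser) + (1 - p_ser) * qd c"
    unfolding f g by (simp_all add: qd_mult qd_add qd_diff)
  have df': "qd f = phi\<^sup>2 * (2 * phim3 * qd phim3) + phim3\<^sup>2 * (2 * phi * qd phi)"
    and dg': "qd g = phim\<^sup>2 * (2 * phi3 * qd phi3) + phi3\<^sup>2 * (2 * phim * qd phim)"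
    unfolding f_def g_def by (simp_all add: qd_mult qd_power2)
  have "- (4 * (f * qd g - g * qd f)) = 2 * (u_ser * v_ser)\<^sup>2 * ((phi ^ 4 - phim ^ 4) - 3 * (phi3 ^ 4 - phim3 ^ 4))"
    unfolding df' dg' unfolding f_def g_def u_eq v_eq using wronskian_phi wronskian_phi3 by algebra
  moreover have "- (4 * (f * qd g - g * qd f)) = 2 * (u_ser * v_ser) * (4 * k_ser\<^sup>2 * (2 + 2 * p_ser - p_ser\<^sup>2) * qd p_ser)"
    unfolding df dg unfolding f g c_def w_square[symmetric] by algebra
  ultimately have "2 * (u_ser * v_ser) * (4 * k_ser\<^sup>2 * (2 + 2 * p_ser - p_ser\<^sup>2) * qd p_ser) =
     2 * (u_ser * v_ser) * (u_ser * v_ser * ((phi ^ 4 - phim ^ 4) - 3 * (phi3 ^ 4 - phim3 ^ 4)))"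
    by (simp add: power2_eq_square mult_ac)
  thus ?thesis by (subst (asm) mult_left_cancel) auto
qed

text \<open>Multiplying the two formulas for \<open>qd p_ser\<close> crosswise eliminates the
  derivative. The result is the ratio of two differences whose product is known from
  \<open>uv_minus_power4\<close>.\<close>

lemma cubic_multiplier: "(phi ^ 4 - phim ^ 4) * p_ser\<^sup>2 = (phi3 ^ 4 - phim3 ^ 4) * (2 + p_ser)\<^sup>2"
proof -
  have "6 * (u_ser * v_ser) * ((phi ^ 4 - phim ^ 4) * p_ser\<^sup>2) = 6 * (u_ser * v_ser) * ((phi3 ^ 4 - phim3 ^ 4) * (2 + p_ser)\<^sup>2)"
    using qd_p_first qd_p_second by algebra
  thus ?thesis by (subst (asm) mult_left_cancel) auto
qed

text \<open>Ratio and product of the differences at q and at q^3 give the square of the first; after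
  cancelling q, the constant terms fix the sign.\<close>

lemma phi_power4_minus_param: "phi ^ 4 - phim ^ 4 = k_ser\<^sup>2 * p_ser * (2 + p_ser) ^ 3"
proof -
  let ?r = "phi ^ 4 - phim ^ 4"
  have "p_ser\<^sup>2 * ?r\<^sup>2 = p_ser\<^sup>2 * ((u_ser - v_ser) * (k_ser * (2 + p_ser)\<^sup>2))\<^sup>2"
    using cubic_multiplier uv_minus_power4 unfolding uv_minus_param by algebra
  hence "?r\<^sup>2 = ((u_ser - v_ser) * (k_ser * (2 + p_ser)\<^sup>2))\<^sup>2" by simp
  hence "?r = (u_ser - v_ser) * (k_ser * (2 + p_ser)\<^sup>2) \<or> ?r = - ((u_ser - v_ser) * (k_ser * (2 + p_ser)\<^sup>2))"
    by (simp add: power2_eq_iff)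
  moreover have "?r \<noteq> - ((u_ser - v_ser) * (k_ser * (2 + p_ser)\<^sup>2))"
  proof
    assume "?r = - ((u_ser - v_ser) * (k_ser * (2 + p_ser)\<^sup>2))"
    hence "fps_X * dilate 2 psi2 ^ 4 = fps_X * (- (dilate 2 psi2 * dilate 6 psi2 * (k_ser * (2 + p_ser)\<^sup>2)))"
      unfolding phi_power4_minus uv_minus by (simp add: mult_ac)
    hence "dilate 2 psi2 ^ 4 = - (dilate 2 psi2 * dilate 6 psi2 * (k_ser * (2 + p_ser)\<^sup>2))" 
      by (subst (asm) mult_left_cancel) auto
    from arg_cong[OF this, of "\<lambda>f. f $ 0"] show False
      by (simp add: fps_power_zeroth numeral_fps_const)
  qed
  ultimately have "?r = (u_ser - v_ser) * (k_ser * (2 + p_ser)\<^sup>2)" by blast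
  thus ?thesis unfolding uv_minus_param by algebra
qed

lemma phi3_power4_minus_param: "phi3 ^ 4 - phim3 ^ 4 = k_ser\<^sup>2 * p_ser ^ 3 * (2 + p_ser)"
proof -
  have "(2 + p_ser)\<^sup>2 * (phi3 ^ 4 - phim3 ^ 4) = (2 + p_ser)\<^sup>2 * (k_ser\<^sup>2 * p_ser ^ 3 * (2 + p_ser))"
    using cubic_multiplier unfolding phi_power4_minus_param by algebra
  thus ?thesis using p_factors_neq_0 by simp
qed

text \<open>In (phi3^4 - phim3^4) phi^4 = u^4 - (phi^2 phim3^2)^2 everything except phi^4 is already
  parametrized. Together with \<open>phi3_param\<close> this says phi^2 / phi3^2 = 1 + 2p.\<close>

lemma phi_param: "phi ^ 4 = k_ser\<^sup>2 * (1 + 2 * p_ser) ^ 3"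
proof -
  have "(k_ser\<^sup>2 * p_ser ^ 3 * (2 + p_ser)) * phi ^ 4 = u_ser ^ 4 - (phi\<^sup>2 * phim3\<^sup>2)\<^sup>2"
    unfolding phi3_power4_minus_param[symmetric] u_eq by algebra
  also have "\<dots> = (k_ser\<^sup>2 * p_ser ^ 3 * (2 + p_ser)) * (k_ser\<^sup>2 * (1 + 2 * p_ser) ^ 3)"
    using w_square unfolding phi_phim3 u_param v_param by algebra
  finally show ?thesis using p_factors_neq_0 by simp
qed

lemma phim_param: "phim ^ 4 = k_ser\<^sup>2 * (1 - p_ser) ^ 3 * (1 + p_ser)"
  using phi_param phi_power4_minus_param by algebra

lemma phi3_param: "phi3 ^ 4 = k_ser\<^sup>2 * (1 + 2 * p_ser)"
proof -
  have "phi ^ 4 * phi3 ^ 4 = u_ser ^ 4" by (simp add: u_eq power_mult_distrib)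
  hence "(k_ser\<^sup>2 * (1 + 2 * p_ser) ^ 3) * phi3 ^ 4 = (k_ser\<^sup>2 * (1 + 2 * p_ser) ^ 3) * (k_ser\<^sup>2 * (1 + 2 * p_ser))"
    unfolding phi_param u_param by algebra
  thus ?thesis using p_factors_neq_0 by simp
qed

lemma phim3_param: "phim3 ^ 4 = k_ser\<^sup>2 * (1 - p_ser) * (1 + p_ser) ^ 3"
  using phi3_param phi3_power4_minus_param by algebra

definition om_ser :: "rat fps" where "om_ser = w_ser * inverse k_ser"

lemma w_param: "w_ser = k_ser * om_ser"
proof -
  have "k_ser * inverse k_ser = 1" using inverse_mult_eq_1[of k_ser] by (simp add: mult.commute)
  thus ?thesis by (simp add: om_ser_def mult.left_commute)
qed

lemma om_square: "om_ser\<^sup>2 = (1 + 2 * p_ser) * (1 - p_ser\<^sup>2)"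
proof -
  have "k_ser\<^sup>2 * om_ser\<^sup>2 = k_ser\<^sup>2 * ((1 + 2 * p_ser) * (1 - p_ser\<^sup>2))"
    using w_square unfolding w_param u_param v_param by algebra
  thus ?thesis by simp
qed

text \<open>Multiplying by u^2 regroups the product into phi^4 and phim^2 phi3^2, both known, so no
  further square root has to be taken.\<close>

lemma phi_phim_param: "phi\<^sup>2 * phim\<^sup>2 = k_ser\<^sup>2 * (1 + 2 * p_ser) * (1 - p_ser) * om_ser"
proof -
  have "u_ser\<^sup>2 * (phi\<^sup>2 * phim\<^sup>2) = phi ^ 4 * (phim\<^sup>2 * phi3\<^sup>2)" unfolding u_eq by algebra
  also have "\<dots> = u_ser\<^sup>2 * (k_ser\<^sup>2 * (1 + 2 * p_ser) * (1 - p_ser) * om_ser)"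
    unfolding phi_param phim_phi3 u_param w_param by algebra
  finally show ?thesis by simp
qed

lemma phi3_phim3_param: "phi3\<^sup>2 * phim3\<^sup>2 = k_ser\<^sup>2 * (1 + p_ser) * om_ser"
proof -
  have "u_ser\<^sup>2 * (phi3\<^sup>2 * phim3\<^sup>2) = phi3 ^ 4 * (phi\<^sup>2 * phim3\<^sup>2)" unfolding u_eq by algebra
  also have "\<dots> = u_ser\<^sup>2 * (k_ser\<^sup>2 * (1 + p_ser) * om_ser)"
    unfolding phi3_param phi_phim3 u_param w_param by algebra
  finally show ?thesis by simp
qed

text \<open>The factors 2 and 4 clear denominators. The last case is \<open>uv_plus\<close> at q^2
  with 2u(q^2) = b + w; the term w brings in om.\<close>

lemma hexa_param: 
  "hexa = k_ser * (1 + 4 * p_ser + p_ser\<^sup>2)"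
  "dilate 2 hexa = k_ser * (1 + p_ser + p_ser\<^sup>2)"
  "2 * dilate 4 hexa = k_ser * (2 + 2 * p_ser - p_ser\<^sup>2)"
  "4 * dilate 8 hexa = k_ser * (1 + p_ser + p_ser\<^sup>2 + 3 * om_ser)"
proof -
  show "hexa = k_ser * (1 + 4 * p_ser + p_ser\<^sup>2)" unfolding hexa_eq u_param v_param by algebra
  show "dilate 2 hexa = k_ser * (1 + p_ser + p_ser\<^sup>2)" using b_param by (simp add: b_ser_def)
  show "2 * dilate 4 hexa = k_ser * (2 + 2 * p_ser - p_ser\<^sup>2)" using uv_plus unfolding u_param v_param by algebra
  have "2 * dilate 8 hexa = dilate 2 u_ser + w_ser"
    using arg_cong[OF uv_plus, of "dilate 2"] by (simp add: dilate_add dilate_mult dilate_dilate w_ser_def)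
  hence "4 * dilate 8 hexa = 2 * dilate 2 u_ser + 2 * w_ser" by algebra
  thus "4 * dilate 8 hexa = k_ser * (1 + p_ser + p_ser\<^sup>2 + 3 * om_ser)"
    unfolding u2 b_param w_param by algebra
qed

section \<open>Eta quotients\<close>

text \<open>Mirrors the case distinction of \<open>eta_factor\<close>, with the full product in
  place of the truncated one.\<close>

definition euler_power :: "nat \<Rightarrow> int \<Rightarrow> rat fps" where
  "euler_power t k = (if k \<ge> 0 then dilate t euler ^ nat k else inverse (dilate t euler) ^ nat (- k))"

lemma agree_eta_factor:
  assumes "t > 0"
  shows "agree N (eta_factor t k N) (euler_power t k)"
proof -
  define P :: "rat fps" where "P = (\<Prod>n\<in>{1..N}. 1 - fps_X ^ (t*n))"
  have "P = (\<Prod>s<N. 1 - fps_X ^ (t * Suc s))"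
    unfolding P_def by (rule prod.reindex_bij_witness[of _ Suc "\<lambda>n. n - 1"]) auto
  also have "\<dots> = dilate t (eu N)"
    using assms by (simp add: eu_def dilate_prod dilate_diff dilate_power dilate_X power_mult del: power_Suc mult_Suc_right)
  finally have "agree N P (dilate t euler)"
    using agree_dilate[OF agree_sym[OF agree_euler[OF order_refl]] assms] by simp
  moreover from this have "P $ 0 \<noteq> 0" by (simp add: agree_def)
  ultimately show ?thesis
    unfolding eta_factor_def P_def[symmetric] euler_power_def Let_def
    by (auto intro!: agree_power agree_inverse)
qed

lemma agree_eta_prod:
  assumes "\<forall>(t,k)\<in>set L. t > 0"
  shows "agree N (\<Prod>(t,k)\<leftarrow>L. eta_factor t k N) (\<Prod>(t,k)\<leftarrow>L. euler_power t k)"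
  using assms by (induction L) (auto intro!: agree_mult agree_eta_factor)

text \<open>The truncation in \<open>etaprod_coeff\<close> moves with the coefficient, so the
  comparison is made for each n separately, with truncation at n - s; for n < s both sides are
  0.\<close>

lemma eta_quot_nth:
  assumes "\<forall>(t,k)\<in>set L. t > 0" "(\<Sum>(t,k)\<leftarrow>L. int t * k) div 24 = int s"
  shows "eta_quot L n = (fps_X ^ s * (\<Prod>(t,k)\<leftarrow>L. euler_power t k)) $ n"
proof -
  have "nat (int n - int s) = n - s" by simp
  thus ?thesis
    using agree_eta_prod[OF assms(1), of "n - s"]
    by (auto simp: eta_quot_def assms(2) Let_def etaprod_coeff_def fps_X_power_mult_nth agree_def)
qed

lemma Abs_fps_eta_quot:
  assumes "\<forall>(t,k)\<in>set L. t > 0" "(\<Sum>(t,k)\<leftarrow>L. int t * k) div 24 = int s"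
  shows "Abs_fps (eta_quot L) = fps_X ^ s * (\<Prod>(t,k)\<leftarrow>L. euler_power t k)"
  by (rule fps_ext) (simp add: eta_quot_nth[OF assms])

definition euler2 :: "rat fps" where "euler2 = dilate 2 euler"
definition euler3 :: "rat fps" where "euler3 = dilate 3 euler"
definition euler6 :: "rat fps" where "euler6 = dilate 6 euler"
definition euler12 :: "rat fps" where "euler12 = dilate 12 euler"
definition euler4 :: "rat fps" where "euler4 = dilate 4 euler"
definition psi2_2 :: "rat fps" where "psi2_2 = dilate 2 psi2"
definition psi2_6 :: "rat fps" where "psi2_6 = dilate 6 psi2"

lemma euler_dilates_neq_0 [simp]: "euler2 \<noteq> 0" "euler3 \<noteq> 0" "euler4 \<noteq> 0" "euler6 \<noteq> 0" "euler12 \<noteq> 0"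
  by (simp_all add: euler2_def euler3_def euler4_def euler6_def euler12_def)

lemma euler_dilates_inverse:
  "inverse euler * euler = 1" "inverse euler2 * euler2 = 1" "inverse euler3 * euler3 = 1" "inverse euler4 * euler4 = 1"
  "inverse euler6 * euler6 = 1" "inverse euler12 * euler12 = 1"
  by (rule inverse_mult_eq_1; simp add: euler2_def euler3_def euler4_def euler6_def euler12_def)+

section \<open>Products of theta series as eta quotients\<close>

lemma theta_euler:
  "phim * euler2 = euler\<^sup>2" "psi2_2 * euler2 = 2 * euler4\<^sup>2" "phi * euler\<^sup>2 * euler4\<^sup>2 = euler2 ^ 5" "dilate 2 phim * euler4 = euler2\<^sup>2"
proof -
  show "phim * euler2 = euler\<^sup>2" "phi * euler\<^sup>2 * euler4\<^sup>2 = euler2 ^ 5"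
    using phim_euler phi_euler by (simp_all add: euler2_def euler4_def)
  show "psi2_2 * euler2 = 2 * euler4\<^sup>2" "dilate 2 phim * euler4 = euler2\<^sup>2"
    using arg_cong[OF psi2_euler, of "dilate 2"] arg_cong[OF phim_euler, of "dilate 2"]
    by (simp_all add: euler2_def euler4_def psi2_2_def dilate_mult dilate_power dilate_dilate)
qed

text \<open>Negative exponents are moved to the other side, and each identity is verified after multiplying
  by a monomial in the Euler products.\<close>

lemma theta_eta_1: "phi * phim\<^sup>2 * psi2_2 = 2 * euler\<^sup>2 * euler2\<^sup>2"
proof -
  have "(euler\<^sup>2 * euler4\<^sup>2 * euler2 ^ 3) * (phi * phim\<^sup>2 * psi2_2) = (phi * euler\<^sup>2 * euler4\<^sup>2) * (phim * euler2)\<^sup>2 * (psi2_2 * euler2)"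
    by algebra
  also have "\<dots> = (euler\<^sup>2 * euler4\<^sup>2 * euler2 ^ 3) * (2 * euler\<^sup>2 * euler2\<^sup>2)"
    unfolding theta_euler by algebra
  finally show ?thesis by (subst (asm) mult_left_cancel) auto
qed

lemma theta_eta_2: "phi\<^sup>2 * phim\<^sup>2 * psi2_2 ^ 4 = 16 * euler2 ^ 4 * euler4 ^ 4"
proof -
  have "(euler ^ 4 * euler4 ^ 4 * euler2 ^ 6) * (phi\<^sup>2 * phim\<^sup>2 * psi2_2 ^ 4) = (phi * euler\<^sup>2 * euler4\<^sup>2)\<^sup>2 * (phim * euler2)\<^sup>2 * (psi2_2 * euler2) ^ 4"
    by algebra
  also have "\<dots> = (euler ^ 4 * euler4 ^ 4 * euler2 ^ 6) * (16 * euler2 ^ 4 * euler4 ^ 4)"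
    unfolding theta_euler by algebra
  finally show ?thesis by (subst (asm) mult_left_cancel) auto
qed

lemma theta_eta_3: "euler\<^sup>2 * (phi\<^sup>2 * phim * psi2_2 ^ 5) = 32 * euler2 ^ 4 * euler4 ^ 6"
proof -
  have "(euler\<^sup>2 * euler4 ^ 4 * euler2 ^ 6) * (euler\<^sup>2 * (phi\<^sup>2 * phim * psi2_2 ^ 5)) = (phi * euler\<^sup>2 * euler4\<^sup>2)\<^sup>2 * (phim * euler2) * (psi2_2 * euler2) ^ 5"
    by algebra
  also have "\<dots> = (euler\<^sup>2 * euler4 ^ 4 * euler2 ^ 6) * (32 * euler2 ^ 4 * euler4 ^ 6)"
    unfolding theta_euler by algebra
  finally show ?thesis by (subst (asm) mult_left_cancel) auto
qed

lemma theta_eta_4: "euler4\<^sup>2 * (phi\<^sup>2 * phim ^ 5 * psi2_2) = 2 * euler ^ 6 * euler2 ^ 4"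
proof -
  have "(euler ^ 4 * euler4\<^sup>2 * euler2 ^ 6) * (euler4\<^sup>2 * (phi\<^sup>2 * phim ^ 5 * psi2_2)) = (phi * euler\<^sup>2 * euler4\<^sup>2)\<^sup>2 * (phim * euler2) ^ 5 * (psi2_2 * euler2)"
    by algebra
  also have "\<dots> = (euler ^ 4 * euler4\<^sup>2 * euler2 ^ 6) * (2 * euler ^ 6 * euler2 ^ 4)"
    unfolding theta_euler by algebra
  finally show ?thesis by (subst (asm) mult_left_cancel) auto
qed

lemma theta_eta_5: "phi\<^sup>2 * phim ^ 3 * psi2_2 ^ 3 = 8 * euler\<^sup>2 * euler2 ^ 4 * euler4\<^sup>2"
proof -
  have "(euler ^ 4 * euler4 ^ 4 * euler2 ^ 6) * (phi\<^sup>2 * phim ^ 3 * psi2_2 ^ 3) = (phi * euler\<^sup>2 * euler4\<^sup>2)\<^sup>2 * (phim * euler2) ^ 3 * (psi2_2 * euler2) ^ 3"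
    by algebra
  also have "\<dots> = (euler ^ 4 * euler4 ^ 4 * euler2 ^ 6) * (8 * euler\<^sup>2 * euler2 ^ 4 * euler4\<^sup>2)"
    unfolding theta_euler by algebra
  finally show ?thesis by (subst (asm) mult_left_cancel) auto
qed

lemma theta_eta_6: "euler ^ 4 * euler4 ^ 3 * (phi\<^sup>2 * dilate 2 phim * psi2_2) = 2 * euler2 ^ 11"
proof -
  have "(euler4\<^sup>2 * euler2) * (euler ^ 4 * euler4 ^ 3 * (phi\<^sup>2 * dilate 2 phim * psi2_2)) = (phi * euler\<^sup>2 * euler4\<^sup>2)\<^sup>2 * (dilate 2 phim * euler4) * (psi2_2 * euler2)"
    by algebra
  also have "\<dots> = (euler4\<^sup>2 * euler2) * (2 * euler2 ^ 11)"
    unfolding theta_euler by algebra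
  finally show ?thesis by (subst (asm) mult_left_cancel) auto
qed

lemmas dilate_rules = dilate_mult dilate_power dilate_add dilate_diff dilate_dilate dilate_X

lemma theta_eta_level3:
  "phi3 * phim3\<^sup>2 * psi2_6 = 2 * euler3\<^sup>2 * euler6\<^sup>2"
  "euler3\<^sup>2 * (phi3\<^sup>2 * phim3 * psi2_6 ^ 5) = 32 * euler6 ^ 4 * euler12 ^ 6"
  "euler12\<^sup>2 * (phi3\<^sup>2 * phim3 ^ 5 * psi2_6) = 2 * euler3 ^ 6 * euler6 ^ 4"
  "phi3\<^sup>2 * phim3 ^ 3 * psi2_6 ^ 3 = 8 * euler3\<^sup>2 * euler6 ^ 4 * euler12\<^sup>2"
  "euler3 ^ 4 * euler12 ^ 3 * (phi3\<^sup>2 * dilate 6 phim * psi2_6) = 2 * euler6 ^ 11"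
  using theta_eta_1[THEN arg_cong, of "dilate 3"] theta_eta_3[THEN arg_cong, of "dilate 3"]
    theta_eta_4[THEN arg_cong, of "dilate 3"] theta_eta_5[THEN arg_cong, of "dilate 3"]
    theta_eta_6[THEN arg_cong, of "dilate 3"]
  by (simp_all add: phi3_def phim3_def psi2_2_def psi2_6_def euler2_def euler3_def euler4_def euler6_def euler12_def dilate_rules)

lemma uv_minus_psi: "u_ser - v_ser = fps_X * psi2_2 * psi2_6"
  by (simp add: uv_minus psi2_2_def psi2_6_def)

text \<open>The eta product splits into E(q)^2 E(q^2)^2 and the same at q^3;
  \<open>theta_eta_1\<close> turns each half into theta series.\<close>

lemma f46_theta: "4 * Abs_fps f46 = v_ser\<^sup>2 * u_ser * (u_ser - v_ser)"
proof -
  have "Abs_fps f46 = fps_X * (euler\<^sup>2 * euler2\<^sup>2) * (euler3\<^sup>2 * euler6\<^sup>2)"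
    unfolding f46_def by (subst Abs_fps_eta_quot[where s = 1])
      (simp_all add: euler_power_def euler2_def euler3_def euler6_def mult_ac)
  hence "4 * Abs_fps f46 = fps_X * (2 * euler\<^sup>2 * euler2\<^sup>2) * (2 * euler3\<^sup>2 * euler6\<^sup>2)" by simp
  also have "\<dots> = v_ser\<^sup>2 * u_ser * (fps_X * psi2_2 * psi2_6)"
    unfolding theta_eta_1[symmetric] theta_eta_level3(1)[symmetric] u_eq v_eq by algebra
  finally show ?thesis by (simp only: uv_minus_psi)
qed

lemma f48_theta: "16 * Abs_fps f48 = phi\<^sup>2 * phim\<^sup>2 * (phi ^ 4 - phim ^ 4)"
proof -
  have "Abs_fps f48 = fps_X * (euler2 ^ 4 * euler4 ^ 4)"
    unfolding f48_def by (subst Abs_fps_eta_quot[where s = 1])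
      (simp_all add: euler_power_def euler2_def euler4_def mult_ac)
  hence "16 * Abs_fps f48 = fps_X * (16 * euler2 ^ 4 * euler4 ^ 4)" by simp
  thus ?thesis unfolding theta_eta_2[symmetric] phi_power4_minus psi2_2_def by (simp add: mult_ac)
qed

lemma a424_theta: "4 * Abs_fps a424 = u_ser\<^sup>2 * w_ser * (u_ser - v_ser)"
proof -
  define G where "G = Abs_fps a424"
  have G: "G = fps_X * (inverse euler ^ 4 * euler2 ^ 11 * inverse euler3 ^ 4 * inverse euler4 ^ 3 * euler6 ^ 11 * inverse euler12 ^ 3)"
    unfolding G_def a424_def by (subst Abs_fps_eta_quot[where s = 1])
      (simp_all add: euler_power_def euler2_def euler3_def euler4_def euler6_def euler12_def mult_ac)
  \<comment> \<open>\<open>?D\<close> collects the negative exponents.\<close>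
  let ?D = "(euler ^ 4 * euler4 ^ 3) * (euler3 ^ 4 * euler12 ^ 3)"
  have w: "w_ser = dilate 2 phim * dilate 6 phim" by (simp add: w_ser_def v_ser_def dilate_rules)
  have "?D * (4 * G) = fps_X * (2 * euler2 ^ 11) * (2 * euler6 ^ 11)"
    unfolding G using euler_dilates_inverse by algebra
  also have "\<dots> = ?D * (u_ser\<^sup>2 * w_ser * (fps_X * psi2_2 * psi2_6))"
    unfolding theta_eta_6[symmetric] theta_eta_level3(5)[symmetric] u_eq w by algebra
  finally have "4 * G = u_ser\<^sup>2 * w_ser * (fps_X * psi2_2 * psi2_6)"
    by (subst (asm) mult_left_cancel) auto
  thus ?thesis by (simp only: uv_minus_psi G_def)
qed

lemma p_nth_1: "p_ser $ 1 = 2"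
proof -
  have "(u_ser - v_ser) $ 1 = 4" unfolding uv_minus by (simp add: fps_mult_nth_1)
  thus ?thesis unfolding uv_minus_param
    by (simp add: fps_mult_nth_1 numeral_fps_const)
qed

text \<open>The two eta quotients are reached through M1^2 and M1 M2, which are products of theta
  series at q and q^3. The coefficient of q gives the sign of M1, and cancelling M1 gives M2. Their
  difference simplifies by (1 + p)(2 + p) - (1 - p) p = 2 (1 + p + p^2).\<close>

lemma f412_theta:
  "4 * Abs_fps f412 = k_ser ^ 4 * (1 + 2 * p_ser) * (1 - p_ser\<^sup>2) * (1 + p_ser + p_ser\<^sup>2) * p_ser * (2 + p_ser)"
proof -
  define M1 M2 where "M1 = Abs_fps (eta_quot [(1,-1),(2,2),(3,3),(4,3),(6,2),(12,-1)])"
    and "M2 = Abs_fps (eta_quot [(1,3),(2,2),(3,-1),(4,-1),(6,2),(12,3)])"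
  have M1: "M1 = fps_X * (inverse euler * euler2\<^sup>2 * euler3 ^ 3 * euler4 ^ 3 * euler6\<^sup>2 * inverse euler12)"
    unfolding M1_def by (subst Abs_fps_eta_quot[where s = 1])
      (simp_all add: euler_power_def euler2_def euler3_def euler4_def euler6_def euler12_def mult_ac)
  have M2: "M2 = fps_X\<^sup>2 * (euler ^ 3 * euler2\<^sup>2 * inverse euler3 * inverse euler4 * euler6\<^sup>2 * euler12 ^ 3)"
    unfolding M2_def by (subst Abs_fps_eta_quot[where s = 2])
      (simp_all add: euler_power_def euler2_def euler3_def euler4_def euler6_def euler12_def mult_ac)
  define R1 where "R1 = k_ser ^ 4 * (1 + 2 * p_ser) * (1 - p_ser\<^sup>2) * (1 + p_ser) * p_ser * (2 + p_ser)\<^sup>2"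
  define R2 where "R2 = k_ser ^ 4 * (1 + 2 * p_ser) * (1 - p_ser\<^sup>2) * (1 - p_ser) * p_ser\<^sup>2 * (2 + p_ser)"
  have "(8 * M1)\<^sup>2 = R1\<^sup>2"
  proof -
    have "(euler\<^sup>2 * euler12\<^sup>2) * (8 * M1)\<^sup>2 = fps_X\<^sup>2 * (32 * euler2 ^ 4 * euler4 ^ 6) * (2 * euler3 ^ 6 * euler6 ^ 4)"
      unfolding M1 using euler_dilates_inverse by algebra
    also have "\<dots> = (euler\<^sup>2 * euler12\<^sup>2) * (u_ser\<^sup>2 * v_ser * phim3 ^ 4 * (fps_X * psi2_2 * psi2_6) * (fps_X * psi2_2 ^ 4))"
      unfolding theta_eta_3[symmetric] theta_eta_level3(3)[symmetric] u_eq v_eq by algebra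
    finally have "(8 * M1)\<^sup>2 = u_ser\<^sup>2 * v_ser * phim3 ^ 4 * (fps_X * psi2_2 * psi2_6) * (fps_X * psi2_2 ^ 4)"
      by (subst (asm) mult_left_cancel) auto
    also have "fps_X * psi2_2 ^ 4 = k_ser\<^sup>2 * p_ser * (2 + p_ser) ^ 3"
      using phi_power4_minus phi_power4_minus_param by (simp add: psi2_2_def)
    also have "u_ser\<^sup>2 * v_ser * phim3 ^ 4 * (fps_X * psi2_2 * psi2_6) * (k_ser\<^sup>2 * p_ser * (2 + p_ser) ^ 3) = R1\<^sup>2"
      unfolding uv_minus_psi[symmetric] unfolding uv_minus_param u_param v_param phim3_param R1_def by algebra
    finally show ?thesis .
  qed
  hence "8 * M1 = R1 \<or> 8 * M1 = - R1" by (simp only: power2_eq_iff)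
  moreover have "8 * M1 \<noteq> - R1"
  proof
    assume "8 * M1 = - R1"
    hence "(8 * M1) $ 1 = - (R1 $ 1)" by simp
    moreover have "R1 $ 1 = 8"
      unfolding R1_def using p_nth_1 by (simp add: fps_mult_nth_1 fps_power_zeroth numeral_fps_const power2_eq_square)
    moreover have "(8 * M1) $ 1 = 8"
      unfolding M1 by (simp add: numeral_fps_const fps_power_zeroth euler2_def euler3_def euler4_def euler6_def euler12_def)
    ultimately show False by simp
  qed
  ultimately have R1: "8 * M1 = R1" by blast
  have "(8 * M1) * (8 * M2) = R1 * R2"
  proof -
    have "(8 * M1) * (8 * M2) = fps_X ^ 3 * (8 * euler\<^sup>2 * euler2 ^ 4 * euler4\<^sup>2) * (8 * euler3\<^sup>2 * euler6 ^ 4 * euler12\<^sup>2)"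
      unfolding M1 M2 using euler_dilates_inverse by algebra
    also have "\<dots> = u_ser\<^sup>2 * v_ser ^ 3 * (fps_X * psi2_2 * psi2_6) ^ 3"
      unfolding theta_eta_5[symmetric] theta_eta_level3(4)[symmetric] u_eq v_eq by algebra
    also have "\<dots> = R1 * R2"
      unfolding uv_minus_psi[symmetric] unfolding uv_minus_param u_param v_param R1_def R2_def by algebra
    finally show ?thesis .
  qed
  moreover have "M1 \<noteq> 0"
  proof
    assume "M1 = 0"
    hence "M1 $ 1 = 0" by simp
    thus False unfolding M1 by (simp add: fps_power_zeroth euler2_def euler3_def euler4_def euler6_def euler12_def)
  qed
  ultimately have R2: "8 * M2 = R2" unfolding R1[symmetric] by (subst (asm) mult_left_cancel) auto
  have "Abs_fps f412 = M1 - M2"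
    by (rule fps_ext) (simp add: f412_def M1_def M2_def)
  hence "2 * (4 * Abs_fps f412) = R1 - R2" using R1 R2 by algebra
  also have "\<dots> = 2 * (k_ser ^ 4 * (1 + 2 * p_ser) * (1 - p_ser\<^sup>2) * (1 + p_ser + p_ser\<^sup>2) * p_ser * (2 + p_ser))"
    unfolding R1_def R2_def by algebra
  finally show ?thesis by (subst (asm) mult_left_cancel) auto
qed

text \<open>A form suited to q -> q^2, which maps u, v and b to (b + w) / 2, w and (u + v) /
  2.\<close>

lemma f412_uvb: "4 * Abs_fps f412 = u_ser * v_ser * b_ser * (u_ser - v_ser)"
  unfolding f412_theta uv_minus_param u_param v_param b_param by algebra

section \<open>Cusp forms at q^2 and q^4\<close>

lemma dilate2_v: "dilate 2 v_ser = w_ser" and dilate2_b: "2 * dilate 2 b_ser = u_ser + v_ser"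
  by (simp_all add: w_ser_def b_ser_def dilate_rules uv_plus)

lemma f46_2_theta: "16 * dilate 2 (Abs_fps f46) = w_ser\<^sup>2 * (b_ser\<^sup>2 - w_ser\<^sup>2)"
proof -
  have "4 * dilate 2 (Abs_fps f46) = w_ser\<^sup>2 * dilate 2 u_ser * (dilate 2 u_ser - w_ser)"
    using arg_cong[OF f46_theta, of "dilate 2"] by (simp add: dilate_rules dilate2_v)
  thus ?thesis using u2 by algebra
qed

lemma f46_4_theta:
  "128 * dilate 4 (Abs_fps f46) = (b_ser + w_ser) * w_ser * ((u_ser + v_ser)\<^sup>2 - 2 * (b_ser + w_ser) * w_ser)"
proof -
  have "16 * dilate 4 (Abs_fps f46) = (dilate 2 w_ser)\<^sup>2 * ((dilate 2 b_ser)\<^sup>2 - (dilate 2 w_ser)\<^sup>2)"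
    using arg_cong[OF f46_2_theta, of "dilate 2"] by (simp add: dilate_rules)
  \<comment> \<open>The series w(q^2) occurs only squared, and its square is known from
    \<open>w_square\<close> at q^2.\<close>
  moreover have "(dilate 2 w_ser)\<^sup>2 = dilate 2 u_ser * w_ser"
    using arg_cong[OF w_square, of "dilate 2"] by (simp add: dilate_rules dilate2_v)
  ultimately show ?thesis using u2 dilate2_b by algebra
qed

lemma f412_2_theta: "32 * dilate 2 (Abs_fps f412) = w_ser * (b_ser\<^sup>2 - w_ser\<^sup>2) * (u_ser + v_ser)"
proof -
  have "4 * dilate 2 (Abs_fps f412) = dilate 2 u_ser * w_ser * dilate 2 b_ser * (dilate 2 u_ser - w_ser)"
    using arg_cong[OF f412_uvb, of "dilate 2"] by (simp add: dilate_rules dilate2_v)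
  thus ?thesis using u2 dilate2_b by algebra
qed

section \<open>The substitution q -> -q and odd parts\<close>

definition alternate :: "rat fps \<Rightarrow> rat fps" where
  "alternate f = f oo (- fps_X)"

lemma alternate_nth: "alternate f $ n = (-1) ^ n * f $ n"
  using fps_compose_uminus'[of f] by (simp add: alternate_def)

lemma alternate_mult: "alternate (f * g) = alternate f * alternate g"
  by (simp add: alternate_def fps_compose_mult_distrib)

lemma alternate_diff: "alternate (f - g) = alternate f - alternate g"
  by (simp add: alternate_def fps_compose_sub_distrib)

lemma alternate_phi: "alternate phi = phim"
proof (rule fps_ext)
  fix n
  have "sign_even x = (-1) ^ n" if "nat (x\<^sup>2) = n" for x
  proof -
    have "even n \<longleftrightarrow> even x" using that by (auto simp: even_nat_iff)
    thus ?thesis by (simp add: sign_even_def)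
  qed
  hence "phim $ n = (\<Sum>x\<in>{x \<in> UNIV. nat (x\<^sup>2) = n}. (-1) ^ n)"
    unfolding phim_def gser_nth by (intro sum.cong) auto
  thus "alternate phi $ n = phim $ n"
    by (simp add: alternate_nth phi_def gser_nth)
qed

lemma alternate_alternate [simp]: "alternate (alternate f) = f"
  by (rule fps_ext) (simp add: alternate_nth flip: power_mult_distrib)

lemma alternate_dilate_odd: "odd t \<Longrightarrow> alternate (dilate t f) = dilate t (alternate f)"
  by (rule fps_ext) (auto simp: alternate_nth dilate_nth odd_pos power_mult elim!: dvdE)

lemma alternate_dilate_even: "even t \<Longrightarrow> t > 0 \<Longrightarrow> alternate (dilate t f) = dilate t f"
  by (rule fps_ext) (auto simp: alternate_nth dilate_nth elim!: dvdE)

text \<open>The exchange of phi and phim persists at q^3 because 3 is odd, whereas w is a series in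
  q^2.\<close>

lemma alternate_u: "alternate u_ser = v_ser" and alternate_v: "alternate v_ser = u_ser"
  and alternate_w: "alternate w_ser = w_ser"
proof -
  show 1: "alternate u_ser = v_ser"
    by (simp add: u_ser_def v_ser_def alternate_mult alternate_dilate_odd alternate_phi)
  show "alternate v_ser = u_ser" unfolding 1[symmetric] by simp
  show "alternate w_ser = w_ser" by (simp add: w_ser_def alternate_dilate_even)
qed

definition f16 :: "rat fps" where
  "f16 = Abs_fps (\<lambda>n. if odd n then a424 n else 0)"

text \<open>The odd part is half the difference with the image under q -> -q, which exchanges u and
  v and fixes w.\<close>

lemma f16_theta: "8 * f16 = w_ser * (u_ser - v_ser) * (u_ser\<^sup>2 + v_ser\<^sup>2)"
proof -
  have "2 * f16 = Abs_fps a424 - alternate (Abs_fps a424)"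
    by (rule fps_ext) (auto simp: f16_def alternate_nth numeral_fps_const)
  hence "8 * f16 = 4 * Abs_fps a424 - 4 * alternate (Abs_fps a424)" by algebra
  also have "4 * alternate (Abs_fps a424) = alternate (4 * Abs_fps a424)"
    by (rule fps_ext) (simp add: alternate_nth numeral_fps_const)
  finally show ?thesis unfolding a424_theta
    by (simp add: alternate_mult alternate_diff power2_eq_square alternate_u alternate_v alternate_w algebra_simps)
qed

section \<open>The linear relations\<close>

lemma E4_dilates:
  "E4 = 16 * phi ^ 8 - 16 * phi ^ 4 * phim ^ 4 + phim ^ 8"
  "dilate 2 E4 = phi ^ 8 - phi ^ 4 * phim ^ 4 + phim ^ 8"
  "dilate 3 E4 = 16 * phi3 ^ 8 - 16 * phi3 ^ 4 * phim3 ^ 4 + phim3 ^ 8"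
  "16 * dilate 4 E4 = phi ^ 8 + 14 * phi ^ 4 * phim ^ 4 + phim ^ 8"
  "dilate 6 E4 = phi3 ^ 8 - phi3 ^ 4 * phim3 ^ 4 + phim3 ^ 8"
  "256 * dilate 8 E4 = (phi\<^sup>2 + phim\<^sup>2) ^ 4 + 56 * phi\<^sup>2 * phim\<^sup>2 * (phi\<^sup>2 + phim\<^sup>2)\<^sup>2 + 16 * phi ^ 4 * phim ^ 4"
  "16 * dilate 12 E4 = phi3 ^ 8 + 14 * phi3 ^ 4 * phim3 ^ 4 + phim3 ^ 8"
  "256 * dilate 24 E4 = (phi3\<^sup>2 + phim3\<^sup>2) ^ 4 + 56 * phi3\<^sup>2 * phim3\<^sup>2 * (phi3\<^sup>2 + phim3\<^sup>2)\<^sup>2 + 16 * phi3 ^ 4 * phim3 ^ 4"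
proof -
  show "E4 = 16 * phi ^ 8 - 16 * phi ^ 4 * phim ^ 4 + phim ^ 8" by (rule E4_1)
  show "dilate 2 E4 = phi ^ 8 - phi ^ 4 * phim ^ 4 + phim ^ 8" by (rule E4_2)
  show "16 * dilate 4 E4 = phi ^ 8 + 14 * phi ^ 4 * phim ^ 4 + phim ^ 8" by (rule E4_4)
  show "256 * dilate 8 E4 = (phi\<^sup>2 + phim\<^sup>2) ^ 4 + 56 * phi\<^sup>2 * phim\<^sup>2 * (phi\<^sup>2 + phim\<^sup>2)\<^sup>2 + 16 * phi ^ 4 * phim ^ 4" by (rule E4_8)
qed (use E4_1[THEN arg_cong, of "dilate 3"] in \<open>simp add: phi3_def phim3_def dilate_rules\<close>,
     use E4_2[THEN arg_cong, of "dilate 3"] in \<open>simp add: phi3_def phim3_def dilate_rules\<close>,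
     use E4_4[THEN arg_cong, of "dilate 3"] in \<open>simp add: phi3_def phim3_def dilate_rules\<close>,
     use E4_8[THEN arg_cong, of "dilate 3"] in \<open>simp add: phi3_def phim3_def dilate_rules\<close>)

section \<open>All series in terms of k, p and om\<close>

lemma E4_param:
  "E4 = k_ser ^ 4 * (1 + 124 * p_ser + 964 * p_ser ^ 2 + 2788 * p_ser ^ 3 + 3910 * p_ser ^ 4 + 2788 * p_ser ^ 5 + 964 * p_ser ^ 6 + 124 * p_ser ^ 7 + p_ser ^ 8)"
  using phi_param phim_param unfolding E4_dilates(1) by algebra

lemma E4_2_param:
  "dilate 2 E4 = k_ser ^ 4 * (1 + 4 * p_ser + 64 * p_ser ^ 2 + 178 * p_ser ^ 3 + 235 * p_ser ^ 4 + 178 * p_ser ^ 5 + 64 * p_ser ^ 6 + 4 * p_ser ^ 7 + p_ser ^ 8)"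
  using phi_param phim_param unfolding E4_dilates(2) by algebra

lemma E4_3_param:
  "dilate 3 E4 = k_ser ^ 4 * (1 + 4 * p_ser + 4 * p_ser ^ 2 + 28 * p_ser ^ 3 + 70 * p_ser ^ 4 + 28 * p_ser ^ 5 + 4 * p_ser ^ 6 + 4 * p_ser ^ 7 + p_ser ^ 8)"
  using phi3_param phim3_param unfolding E4_dilates(3) by algebra

lemma E4_4_param:
  "16 * dilate 4 E4 = k_ser ^ 4 * (16 + 64 * p_ser + 64 * p_ser ^ 2 - 32 * p_ser ^ 3 + 160 * p_ser ^ 4 + 448 * p_ser ^ 5 + 124 * p_ser ^ 6 - 116 * p_ser ^ 7 + p_ser ^ 8)"
  using phi_param phim_param unfolding E4_dilates(4) by algebra

lemma E4_6_param:
  "dilate 6 E4 = k_ser ^ 4 * (1 + 4 * p_ser + 4 * p_ser ^ 2 - 2 * p_ser ^ 3 - 5 * p_ser ^ 4 - 2 * p_ser ^ 5 + 4 * p_ser ^ 6 + 4 * p_ser ^ 7 + p_ser ^ 8)"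
  using phi3_param phim3_param unfolding E4_dilates(5) by algebra

text \<open>The part with om comes from the terms of odd degree in phi^2 and phim^2, to which
  \<open>phi_phim_param\<close> applies; the other terms need only fourth powers.\<close>

lemma E4_8_param:
  "256 * dilate 8 E4 = k_ser ^ 4 * (136 + 544 * p_ser + 64 * p_ser ^ 2 - 1712 * p_ser ^ 3 - 440 * p_ser ^ 4 + 2608 * p_ser ^ 5 + 604 * p_ser ^ 6 - 1076 * p_ser ^ 7 + p_ser ^ 8 + om_ser * (120 + 360 * p_ser + 720 * p_ser ^ 2 + 840 * p_ser ^ 3 - 900 * p_ser ^ 4 - 1260 * p_ser ^ 5 + 120 * p_ser ^ 6))"
  using phi_param phim_param phi_phim_param om_square unfolding E4_dilates(6) by algebra

lemma E4_12_param:
  "16 * dilate 12 E4 = k_ser ^ 4 * (16 + 64 * p_ser + 64 * p_ser ^ 2 - 32 * p_ser ^ 3 - 80 * p_ser ^ 4 - 32 * p_ser ^ 5 + 4 * p_ser ^ 6 + 4 * p_ser ^ 7 + p_ser ^ 8)"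
  using phi3_param phim3_param unfolding E4_dilates(7) by algebra

lemma E4_24_param:
  "256 * dilate 24 E4 = k_ser ^ 4 * (136 + 544 * p_ser + 544 * p_ser ^ 2 - 272 * p_ser ^ 3 - 680 * p_ser ^ 4 - 272 * p_ser ^ 5 + 4 * p_ser ^ 6 + 4 * p_ser ^ 7 + p_ser ^ 8 + om_ser * (120 + 360 * p_ser + 240 * p_ser ^ 2 - 120 * p_ser ^ 3 - 180 * p_ser ^ 4 - 60 * p_ser ^ 5))"
  using phi3_param phim3_param phi3_phim3_param om_square unfolding E4_dilates(8) by algebra

lemma f46_param:
  "4 * Abs_fps f46 = k_ser ^ 4 * (2 * p_ser + 5 * p_ser ^ 2 - 2 * p_ser ^ 3 - 10 * p_ser ^ 4 - 2 * p_ser ^ 5 + 5 * p_ser ^ 6 + 2 * p_ser ^ 7)"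
  unfolding f46_theta u_param v_param by algebra

lemma f46_2_param:
  "16 * dilate 2 (Abs_fps f46) = k_ser ^ 4 * (4 * p_ser ^ 2 + 12 * p_ser ^ 3 + 5 * p_ser ^ 4 - 10 * p_ser ^ 5 - 9 * p_ser ^ 6 - 2 * p_ser ^ 7)"
  using om_square unfolding f46_2_theta b_param w_param by algebra

lemma f46_4_param:
  "128 * dilate 4 (Abs_fps f46) = k_ser ^ 4 * (- 4 * p_ser ^ 2 - 12 * p_ser ^ 3 - 5 * p_ser ^ 4 + 10 * p_ser ^ 5 + 9 * p_ser ^ 6 + 2 * p_ser ^ 7 + om_ser * (4 * p_ser ^ 2 + 8 * p_ser ^ 3 + 9 * p_ser ^ 4 + 5 * p_ser ^ 5 + p_ser ^ 6))"
  using om_square unfolding f46_4_theta u_param v_param b_param w_param by algebra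

lemma f48_param:
  "16 * Abs_fps f48 = k_ser ^ 4 * (om_ser * (8 * p_ser + 20 * p_ser ^ 2 + 2 * p_ser ^ 3 - 17 * p_ser ^ 4 - 11 * p_ser ^ 5 - 2 * p_ser ^ 6))"
  unfolding f48_theta phi_phim_param phi_power4_minus_param by algebra

lemma f48_3_param:
  "16 * dilate 3 (Abs_fps f48) = k_ser ^ 4 * (om_ser * (2 * p_ser ^ 3 + 3 * p_ser ^ 4 + p_ser ^ 5))"
  proof -
  have "16 * dilate 3 (Abs_fps f48) = phi3\<^sup>2 * phim3\<^sup>2 * (phi3 ^ 4 - phim3 ^ 4)"
    using arg_cong[OF f48_theta, of "dilate 3"] by (simp add: dilate_rules phi3_def phim3_def)
  thus ?thesis unfolding phi3_phim3_param phi3_power4_minus_param by algebra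
qed

lemma f412_param:
  "4 * Abs_fps f412 = k_ser ^ 4 * (2 * p_ser + 7 * p_ser ^ 2 + 7 * p_ser ^ 3 - 7 * p_ser ^ 5 - 7 * p_ser ^ 6 - 2 * p_ser ^ 7)"
  unfolding f412_theta by algebra

lemma f412_2_param:
  "32 * dilate 2 (Abs_fps f412) = k_ser ^ 4 * (om_ser * (8 * p_ser ^ 2 + 16 * p_ser ^ 3 + 6 * p_ser ^ 4 - 2 * p_ser ^ 5 - p_ser ^ 6))"
  using om_square unfolding f412_2_theta u_param v_param b_param w_param by algebra

lemma f16_param:
  "8 * f16 = k_ser ^ 4 * (om_ser * (4 * p_ser + 10 * p_ser ^ 2 + 8 * p_ser ^ 3 + 2 * p_ser ^ 4 + 2 * p_ser ^ 5 + p_ser ^ 6))"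
  unfolding f16_theta u_param v_param w_param by algebra

text \<open>\<open>E4_param\<close> is kept apart because \<open>E4\<close> also occurs inside
  \<open>dilate t E4\<close>; it has to be rewritten last, like \<open>hexa\<close> itself.\<close>

lemmas series_param = E4_2_param E4_3_param E4_4_param E4_6_param E4_8_param E4_12_param E4_24_param f46_param f46_2_param f46_4_param f48_param f48_3_param f412_param f412_2_param f16_param

text \<open>Each of these 19 identities is a row of \<open>nu_table\<close> times a common
  denominator; the digits of the name are c1, c2, c3. Multiples such as
  \<open>16 * dilate 4 E4\<close> are the left-hand sides of the parametrizations, so both sides
  become k^4 times explicit polynomials.\<close>

lemma hexa_product_112:
  "40 * (hexa * hexa * hexa * dilate 2 hexa) =
    3 * E4 - 8 * dilate 2 E4 - 27 * dilate 3 E4 + 72 * dilate 6 E4"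
  unfolding hexa_param(2-) series_param unfolding hexa_param(1) E4_param by algebra

lemma hexa_product_114:
  "50 * (hexa * hexa * hexa * (2 * dilate 4 hexa)) =
    3 * E4 - 9 * dilate 2 E4 + 27 * dilate 3 E4 + (16 * dilate 4 E4) - 81 * dilate 6 E4 + 9 * (16 * dilate 12 E4) + 270 * (4 * Abs_fps f46) + 540 * (16 * dilate 2 (Abs_fps f46))"
  unfolding hexa_param(2-) series_param unfolding hexa_param(1) E4_param by algebra

lemma hexa_product_118:
  "320 * (hexa * hexa * hexa * (4 * dilate 8 hexa)) =
    24 * E4 - 72 * dilate 2 E4 - 216 * dilate 3 E4 + 9 * (16 * dilate 4 E4) + 648 * dilate 6 E4 - (256 * dilate 8 E4) - 81 * (16 * dilate 12 E4) + 9 * (256 * dilate 24 E4) - 540 * (16 * Abs_fps f48) + 4860 * (16 * dilate 3 (Abs_fps f48)) + 3240 * (32 * dilate 2 (Abs_fps f412)) + 3240 * (8 * f16)"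
  unfolding hexa_param(2-) series_param unfolding hexa_param(1) E4_param by algebra

lemma hexa_product_122:
  "50 * (hexa * hexa * dilate 2 hexa * dilate 2 hexa) =
    E4 + 4 * dilate 2 E4 + 9 * dilate 3 E4 + 36 * dilate 6 E4 + 90 * (4 * Abs_fps f46)"
  unfolding hexa_param(2-) series_param unfolding hexa_param(1) E4_param by algebra

lemma hexa_product_124:
  "40 * (hexa * hexa * dilate 2 hexa * (2 * dilate 4 hexa)) =
    E4 + 5 * dilate 2 E4 - 9 * dilate 3 E4 - (16 * dilate 4 E4) - 45 * dilate 6 E4 + 9 * (16 * dilate 12 E4) + 180 * (4 * Abs_fps f412)"
  unfolding hexa_param(2-) series_param unfolding hexa_param(1) E4_param by algebra

lemma hexa_product_128:
  "400 * (hexa * hexa * dilate 2 hexa * (4 * dilate 8 hexa)) =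
    8 * E4 + 40 * dilate 2 E4 + 72 * dilate 3 E4 - 9 * (16 * dilate 4 E4) + 360 * dilate 6 E4 + (256 * dilate 8 E4) - 81 * (16 * dilate 12 E4) + 9 * (256 * dilate 24 E4) + 720 * (4 * Abs_fps f46) + 2880 * (16 * dilate 2 (Abs_fps f46)) + 2880 * (128 * dilate 4 (Abs_fps f46)) + 900 * (16 * Abs_fps f48) + 8100 * (16 * dilate 3 (Abs_fps f48))"
  unfolding hexa_param(2-) series_param unfolding hexa_param(1) E4_param by algebra

lemma hexa_product_144:
  "50 * (hexa * hexa * (2 * dilate 4 hexa) * (2 * dilate 4 hexa)) =
    E4 + 3 * dilate 2 E4 + 9 * dilate 3 E4 + (16 * dilate 4 E4) + 27 * dilate 6 E4 + 9 * (16 * dilate 12 E4) + 540 * (4 * Abs_fps f46) + 540 * (16 * dilate 2 (Abs_fps f46))"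
  unfolding hexa_param(2-) series_param unfolding hexa_param(1) E4_param by algebra

lemma hexa_product_148:
  "160 * (hexa * hexa * (2 * dilate 4 hexa) * (4 * dilate 8 hexa)) =
    4 * E4 + 12 * dilate 2 E4 - 36 * dilate 3 E4 + 5 * (16 * dilate 4 E4) - 108 * dilate 6 E4 - (256 * dilate 8 E4) - 45 * (16 * dilate 12 E4) + 9 * (256 * dilate 24 E4) + 180 * (16 * Abs_fps f48) - 1620 * (16 * dilate 3 (Abs_fps f48)) + 720 * (4 * Abs_fps f412) + 1080 * (32 * dilate 2 (Abs_fps f412)) + 1080 * (8 * f16)"
  unfolding hexa_param(2-) series_param unfolding hexa_param(1) E4_param by algebra

text \<open>Two factors at q^8 produce om^2, so here and in the other rows with two or more eights
  the equation of the curve is used.\<close>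

lemma hexa_product_188:
  "200 * (hexa * hexa * (4 * dilate 8 hexa) * (4 * dilate 8 hexa)) =
    4 * E4 + 12 * dilate 2 E4 + 36 * dilate 3 E4 + 3 * (16 * dilate 4 E4) + 108 * dilate 6 E4 + (256 * dilate 8 E4) + 27 * (16 * dilate 12 E4) + 9 * (256 * dilate 24 E4) + 5760 * (4 * Abs_fps f46) + 9360 * (16 * dilate 2 (Abs_fps f46)) + 2880 * (128 * dilate 4 (Abs_fps f46)) + 900 * (16 * Abs_fps f48) + 8100 * (16 * dilate 3 (Abs_fps f48))"
  unfolding hexa_param(2-) series_param unfolding hexa_param(1) E4_param using om_square by algebra

lemma hexa_product_222:
  "40 * (hexa * dilate 2 hexa * dilate 2 hexa * dilate 2 hexa) =
    E4 - 6 * dilate 2 E4 - 9 * dilate 3 E4 + 54 * dilate 6 E4"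
  unfolding hexa_param(2-) series_param unfolding hexa_param(1) E4_param by algebra

lemma hexa_product_224:
  "50 * (hexa * dilate 2 hexa * dilate 2 hexa * (2 * dilate 4 hexa)) =
    E4 - 7 * dilate 2 E4 + 9 * dilate 3 E4 + (16 * dilate 4 E4) - 63 * dilate 6 E4 + 9 * (16 * dilate 12 E4) + 90 * (4 * Abs_fps f46) + 90 * (16 * dilate 2 (Abs_fps f46))"
  unfolding hexa_param(2-) series_param unfolding hexa_param(1) E4_param by algebra

lemma hexa_product_228:
  "320 * (hexa * dilate 2 hexa * dilate 2 hexa * (4 * dilate 8 hexa)) =
    8 * E4 - 56 * dilate 2 E4 - 72 * dilate 3 E4 + 9 * (16 * dilate 4 E4) + 504 * dilate 6 E4 - (256 * dilate 8 E4) - 81 * (16 * dilate 12 E4) + 9 * (256 * dilate 24 E4) - 180 * (16 * Abs_fps f48) + 1620 * (16 * dilate 3 (Abs_fps f48)) + 360 * (32 * dilate 2 (Abs_fps f412)) + 1080 * (8 * f16)"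
  unfolding hexa_param(2-) series_param unfolding hexa_param(1) E4_param by algebra

lemma hexa_product_244:
  "40 * (hexa * dilate 2 hexa * (2 * dilate 4 hexa) * (2 * dilate 4 hexa)) =
    E4 - 5 * dilate 2 E4 - 9 * dilate 3 E4 - (16 * dilate 4 E4) + 45 * dilate 6 E4 + 9 * (16 * dilate 12 E4) + 180 * (4 * Abs_fps f412)"
  unfolding hexa_param(2-) series_param unfolding hexa_param(1) E4_param by algebra

lemma hexa_product_248:
  "200 * (hexa * dilate 2 hexa * (2 * dilate 4 hexa) * (4 * dilate 8 hexa)) =
    4 * E4 - 20 * dilate 2 E4 + 36 * dilate 3 E4 - 5 * (16 * dilate 4 E4) - 180 * dilate 6 E4 + (256 * dilate 8 E4) - 45 * (16 * dilate 12 E4) + 9 * (256 * dilate 24 E4) + 360 * (4 * Abs_fps f46) + 540 * (16 * dilate 2 (Abs_fps f46)) + 180 * (128 * dilate 4 (Abs_fps f46)) + 450 * (16 * Abs_fps f48) + 4050 * (16 * dilate 3 (Abs_fps f48))"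
  unfolding hexa_param(2-) series_param unfolding hexa_param(1) E4_param by algebra

lemma hexa_product_288:
  "160 * (hexa * dilate 2 hexa * (4 * dilate 8 hexa) * (4 * dilate 8 hexa)) =
    4 * E4 - 20 * dilate 2 E4 - 36 * dilate 3 E4 - 3 * (16 * dilate 4 E4) + 180 * dilate 6 E4 - (256 * dilate 8 E4) + 27 * (16 * dilate 12 E4) + 9 * (256 * dilate 24 E4) - 180 * (16 * Abs_fps f48) + 1620 * (16 * dilate 3 (Abs_fps f48)) + 2160 * (4 * Abs_fps f412) + 360 * (32 * dilate 2 (Abs_fps f412)) + 1080 * (8 * f16)"
  unfolding hexa_param(2-) series_param unfolding hexa_param(1) E4_param using om_square by algebra

lemma hexa_product_444:
  "50 * (hexa * (2 * dilate 4 hexa) * (2 * dilate 4 hexa) * (2 * dilate 4 hexa)) =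
    E4 - 9 * dilate 2 E4 + 9 * dilate 3 E4 + 3 * (16 * dilate 4 E4) - 81 * dilate 6 E4 + 27 * (16 * dilate 12 E4) + 540 * (4 * Abs_fps f46) + 270 * (16 * dilate 2 (Abs_fps f46))"
  unfolding hexa_param(2-) series_param unfolding hexa_param(1) E4_param by algebra

lemma hexa_product_448:
  "80 * (hexa * (2 * dilate 4 hexa) * (2 * dilate 4 hexa) * (4 * dilate 8 hexa)) =
    2 * E4 - 18 * dilate 2 E4 - 18 * dilate 3 E4 + 7 * (16 * dilate 4 E4) + 162 * dilate 6 E4 - (256 * dilate 8 E4) - 63 * (16 * dilate 12 E4) + 9 * (256 * dilate 24 E4) + 90 * (16 * Abs_fps f48) - 810 * (16 * dilate 3 (Abs_fps f48)) + 360 * (4 * Abs_fps f412) + 540 * (8 * f16)"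
  unfolding hexa_param(2-) series_param unfolding hexa_param(1) E4_param by algebra

lemma hexa_product_488:
  "100 * (hexa * (2 * dilate 4 hexa) * (4 * dilate 8 hexa) * (4 * dilate 8 hexa)) =
    2 * E4 - 18 * dilate 2 E4 + 18 * dilate 3 E4 + 5 * (16 * dilate 4 E4) - 162 * dilate 6 E4 + (256 * dilate 8 E4) + 45 * (16 * dilate 12 E4) + 9 * (256 * dilate 24 E4) + 2880 * (4 * Abs_fps f46) + 1440 * (16 * dilate 2 (Abs_fps f46)) + 180 * (128 * dilate 4 (Abs_fps f46)) + 450 * (16 * Abs_fps f48) + 4050 * (16 * dilate 3 (Abs_fps f48))"
  unfolding hexa_param(2-) series_param unfolding hexa_param(1) E4_param using om_square by algebra

lemma hexa_product_888:
  "80 * (hexa * (4 * dilate 8 hexa) * (4 * dilate 8 hexa) * (4 * dilate 8 hexa)) =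
    2 * E4 - 18 * dilate 2 E4 - 18 * dilate 3 E4 + 9 * (16 * dilate 4 E4) + 162 * dilate 6 E4 - 3 * (256 * dilate 8 E4) - 81 * (16 * dilate 12 E4) + 27 * (256 * dilate 24 E4) + 270 * (16 * Abs_fps f48) - 2430 * (16 * dilate 3 (Abs_fps f48)) + 3240 * (4 * Abs_fps f412) + 1620 * (8 * f16)"
  unfolding hexa_param(2-) series_param unfolding hexa_param(1) E4_param using om_square by algebra

section \<open>From power series to representation numbers\<close>

lemma M_nth:
  assumes "c1 > 0" "c2 > 0" "c3 > 0"
  shows "of_nat (M c1 c2 c3 n) = (hexa * dilate c1 hexa * dilate c2 hexa * dilate c3 hexa) $ n"
proof -
  define Q where "Q = (\<lambda>(x,y). nat (Qf x y))"
  have hexa: "dilate c hexa = gser UNIV (\<lambda>z. c * Q z) (\<lambda>_. 1)" if "c > 0" for c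
    using that by (simp add: hexa_def Q_def gser_dilate)
  have ff: "fin_fibres UNIV (\<lambda>z. c * Q z)" if "c > 0" for c
    unfolding Q_def using that by (intro fin_fibres_cmult fin_fibres_Qf)
  have ff1: "fin_fibres UNIV Q" using ff[of 1] by simp
  define g1 g2 g3 where "g1 = (\<lambda>(z,z'). 1 * Q z + c1 * Q z')"
    and "g2 = (\<lambda>(y,z'). g1 y + c2 * Q z')" and "g3 = (\<lambda>(y,z'). g2 y + c3 * Q z')"
  have fg1: "fin_fibres (UNIV \<times> UNIV) g1" unfolding g1_def
    by (intro fin_fibres_Times ff assms) simp
  have fg2: "fin_fibres ((UNIV \<times> UNIV) \<times> UNIV) g2" unfolding g2_def
    by (intro fin_fibres_Times ff assms fg1)
  have 1: "hexa * dilate c1 hexa = gser (UNIV \<times> UNIV) g1 (\<lambda>_. 1)"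
  proof -
    have "hexa * dilate c1 hexa = dilate 1 hexa * dilate c1 hexa" by simp
    also have "\<dots> = gser (UNIV \<times> UNIV) g1 (\<lambda>_. 1)"
      unfolding g1_def hexa[OF zero_less_one] hexa[OF assms(1)]
      by (subst gser_mult) (auto intro: ff ff1 assms simp: case_prod_unfold)
    finally show ?thesis .
  qed
  have 2: "gser (UNIV \<times> UNIV) g1 (\<lambda>_. 1) * dilate c2 hexa = gser ((UNIV \<times> UNIV) \<times> UNIV) g2 (\<lambda>_. 1)"
    unfolding g2_def hexa[OF assms(2)]
    by (subst gser_mult) (use fg1 in \<open>auto intro: ff assms simp: case_prod_unfold\<close>)
  have 3: "gser ((UNIV \<times> UNIV) \<times> UNIV) g2 (\<lambda>_. 1) * dilate c3 hexa = gser (((UNIV \<times> UNIV) \<times> UNIV) \<times> UNIV) g3 (\<lambda>_. 1)"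
    unfolding g3_def hexa[OF assms(3)]
    by (subst gser_mult) (use fg2 in \<open>auto intro: ff assms simp: case_prod_unfold\<close>)
  have "M c1 c2 c3 n = card {z. g3 z = n}"
    unfolding M_def
  \<comment> \<open>The coordinates are regrouped as nested pairs, the shape that repeated use of
    \<open>gser_mult\<close> produces.\<close>
  proof (rule bij_betw_same_card[where f = "\<lambda>(x1,x2,x3,x4,x5,x6,x7,x8). ((((x1,x2),(x3,x4)),(x5,x6)),(x7,x8))"],
      rule bij_betw_byWitness[where f' = "\<lambda>((((x1,x2),(x3,x4)),(x5,x6)),(x7,x8)). (x1,x2,x3,x4,x5,x6,x7,x8)"])
    have "int n = Qf x1 x2 + int c1 * Qf x3 x4 + int c2 * Qf x5 x6 + int c3 * Qf x7 x8 \<longleftrightarrow>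
      g3 ((((x1,x2),(x3,x4)),(x5,x6)),(x7,x8)) = n" for x1 x2 x3 x4 x5 x6 x7 x8
    proof -
      have "int (g3 ((((x1,x2),(x3,x4)),(x5,x6)),(x7,x8))) = Qf x1 x2 + int c1 * Qf x3 x4 + int c2 * Qf x5 x6 + int c3 * Qf x7 x8"
        by (simp add: g3_def g2_def g1_def Q_def Qf_nonneg)
      thus ?thesis by linarith
    qed
    note eq = this
    show "(\<lambda>(x1,x2,x3,x4,x5,x6,x7,x8). ((((x1,x2),(x3,x4)),(x5,x6)),(x7,x8))) `
       {(x1,x2,x3,x4,x5,x6,x7,x8). int n = Qf x1 x2 + int c1 * Qf x3 x4 + int c2 * Qf x5 x6 + int c3 * Qf x7 x8} \<subseteq> {z. g3 z = n}"
      using eq by auto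
    show "(\<lambda>((((x1,x2),(x3,x4)),(x5,x6)),(x7,x8)). (x1,x2,x3,x4,x5,x6,x7,x8)) ` {z. g3 z = n} \<subseteq>
       {(x1,x2,x3,x4,x5,x6,x7,x8). int n = Qf x1 x2 + int c1 * Qf x3 x4 + int c2 * Qf x5 x6 + int c3 * Qf x7 x8}"
      using eq by auto
  qed auto
  thus ?thesis unfolding 1 2 3 by (simp add: gser_nth)
qed

lemma dil_nth: "t > 0 \<Longrightarrow> dil t f n = dilate t (Abs_fps f) $ n"
  by (simp add: dil_def dilate_nth)

lemma A_nth:
  "A 1 n = E4 $ n" "A 2 n = dilate 2 E4 $ n" "A 3 n = dilate 3 E4 $ n" "A 4 n = dilate 4 E4 $ n"
  "A 5 n = dilate 6 E4 $ n" "A 6 n = dilate 8 E4 $ n" "A 7 n = dilate 12 E4 $ n" "A 8 n = dilate 24 E4 $ n"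
  "A 9 n = Abs_fps f46 $ n" "A 10 n = dilate 2 (Abs_fps f46) $ n" "A 11 n = dilate 4 (Abs_fps f46) $ n"
  "A 12 n = Abs_fps f48 $ n" "A 13 n = dilate 3 (Abs_fps f48) $ n"
  "A 14 n = Abs_fps f412 $ n" "A 15 n = dilate 2 (Abs_fps f412) $ n" "A 16 n = f16 $ n"
  by (simp_all add: A_def dil_nth E4_def f16_def)

lemma sum_16: "(\<Sum>i\<in>{1..16::nat}. g i) = g 1 + g 2 + g 3 + g 4 + g 5 + g 6 + g 7 + g 8 + g 9 + g 10 +
   g 11 + g 12 + g 13 + g 14 + g 15 + (g 16 :: rat)"
  by (simp add: numeral_eq_Suc sum.cl_ivl_Suc)

text \<open>With integer factors moved in front of the coefficients, each product identity becomes
  linear in the values \<open>A i n\<close> and can be divided by its common denominator.\<close>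

lemma numeral_mult_nth:
  fixes f g :: "rat fps"
  shows "(numeral a * g) $ n = numeral a * g $ n"
    and "(f * (numeral a * g)) $ n = numeral a * (f * g) $ n"
proof -
  show 1: "(numeral a * g) $ n = numeral a * g $ n" for g :: "rat fps"
    by (simp add: numeral_fps_const)
  show "(f * (numeral a * g)) $ n = numeral a * (f * g) $ n"
    using 1[of "f * g"] by (simp only: mult.left_commute)
qed

theorem theorem2p2:
  assumes "((c1, c2, c3), nu) \<in> set nu_table"
  shows "of_nat (M c1 c2 c3 n) = (\<Sum>i\<in>{1..16}. nu ! (i - 1) * A i n)"
proof -
  have nth_eq: "f $ n = g $ n" if "f = g" for f g :: "rat fps" using that by simp
  note nth_simps = M_nth numeral_mult_nth mult.assoc
  show ?thesis
    using assms unfolding nu_table_def list.set insert_iff empty_iff prod.inject sum_16 A_nth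
  \<comment> \<open>One goal for each row of \<open>nu_table\<close>, in the order of the
    table.\<close>
  proof (elim disjE conjE FalseE, goal_cases)
    case 1
    show ?case using nth_eq[OF hexa_product_112] by (simp add: 1 nth_simps)
  next
    case 2
    show ?case using nth_eq[OF hexa_product_114] by (simp add: 2 nth_simps)
  next
    case 3
    show ?case using nth_eq[OF hexa_product_118] by (simp add: 3 nth_simps)
  next
    case 4
    show ?case using nth_eq[OF hexa_product_122] by (simp add: 4 nth_simps)
  next
    case 5
    show ?case using nth_eq[OF hexa_product_124] by (simp add: 5 nth_simps)
  next
    case 6
    show ?case using nth_eq[OF hexa_product_128] by (simp add: 6 nth_simps)
  next
    case 7
    show ?case using nth_eq[OF hexa_product_144] by (simp add: 7 nth_simps)
  next
    case 8
    show ?case using nth_eq[OF hexa_product_148] by (simp add: 8 nth_simps)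
  next
    case 9
    show ?case using nth_eq[OF hexa_product_188] by (simp add: 9 nth_simps)
  next
    case 10
    show ?case using nth_eq[OF hexa_product_222] by (simp add: 10 nth_simps)
  next
    case 11
    show ?case using nth_eq[OF hexa_product_224] by (simp add: 11 nth_simps)
  next
    case 12
    show ?case using nth_eq[OF hexa_product_228] by (simp add: 12 nth_simps)
  next
    case 13
    show ?case using nth_eq[OF hexa_product_244] by (simp add: 13 nth_simps)
  next
    case 14
    show ?case using nth_eq[OF hexa_product_248] by (simp add: 14 nth_simps)
  next
    case 15
    show ?case using nth_eq[OF hexa_product_288] by (simp add: 15 nth_simps)
  next
    case 16
    show ?case using nth_eq[OF hexa_product_444] by (simp add: 16 nth_simps)
  next
    case 17
    show ?case using nth_eq[OF hexa_product_448] by (simp add: 17 nth_simps)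
  next
    case 18
    show ?case using nth_eq[OF hexa_product_488] by (simp add: 18 nth_simps)
  next
    case 19
    show ?case using nth_eq[OF hexa_product_888] by (simp add: 19 nth_simps)
  qed
qed

end
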